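(* Let $G$ be a countable sofic group with a sofic approximation sequence $\Sigma$. Let $Z$ be a compact metrizable space, and consider the left shift action of $G$ on $X=Z^G$, given by $(sx)_t=x_{s^{-1}t}$ for $x\in Z^G$ and $s,t\in G$. Then $$\mathrm{mdim}_\Sigma(X)\le\mathrm{mdim}_{\Sigma,\mathrm M}(X)\le\dim(Z).$$ If furthermore $Z$ contains a homeomorphic copy of $[0,1]^n$ for every natural number $n\le\dim(Z)$ (for example, $Z$ could be any polyhedron or the Hilbert cube), then $$\mathrm{mdim}_\Sigma(X)=\mathrm{mdim}_{\Sigma,\mathrm M}(X)=\dim(Z).$$
   Context: Sofic approximations. For $d\in\mathbb N$ write $[d]=\{1,\dots,d\}$ and $\mathrm{Sym}(d)$ for the permutation group of $[d]$. A sofic approximation sequence for a countable group $G$ is a sequence of maps $\Sigma=\{\sigma_i:G\to\mathrm{Sym}(d_i)\}_{i=1}^\infty$ such that: (1) for all $s,t\in G$, $\lim_i |\{a\in[d_i]:\sigma_i(s)\sigma_i(t)(a)=\sigma_i(st)(a)\}|/d_i=1$; (2) for all distinct $s,t\in G$, $\lim_i|\{a\in[d_i]:\sigma_i(s)(a)=\sigma_i(t)(a)\}|/d_i=0$; (3) $\lim_i d_i=+\infty$. $G$ is sofic if it has such a sequence. We write $\sigma_s=\sigma(s)$. Order, $\mathcal D$, and dimension. For finite open covers of a compact space $Y$, $\mathcal V\succ\mathcal U$ means every element of $\mathcal V$ is contained in some element of $\mathcal U$. Put $\mathrm{ord}(\mathcal U)=\max_{y\in Y}\sum_{U\in\mathcal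 U}1_U(y)-1$ and $\mathcal D(\mathcal U)=\min_{\mathcal V\succ\mathcal U}\mathrm{ord}(\mathcal V)$, the minimum over finite open covers $\mathcal V$ of $Y$ refining $\mathcal U$. The covering dimension is $\dim(Y)=\sup_{\mathcal U}\mathcal D(\mathcal U)$ over finite open covers (possibly $+\infty$). Map spaces. Let $G$ act continuously on a compact metrizable space $X$ by $\alpha$, and let $\rho$ be a compatible metric on $X$. For maps $\varphi,\psi:[d]\to X$ put $\rho_2(\varphi,\psi)=\big(\frac1d\sum_{a\in[d]}\rho(\varphi(a),\psi(a))^2\big)^{1/2}$ and $\rho_\infty(\varphi,\psi)=\max_{a\in[d]}\rho(\varphi(a),\psi(a))$. For a nonempty finite $F\subseteq G$, $\delta>0$, and a map $\sigma:G\to\mathrm{Sym}(d)$, $\mathrm{Map}(\rho,F,\delta,\sigma)$ is the set of all $\varphi:[d]\to X$ with $\rho_2(\varphi\circ\sigma_s,\alpha_s\circ\varphi)\le\delta$ for all $s\in F$, a closed subspace of $X^{[d]}$. Sofic mean topological dimension. For a finite open cover $\mathcal U$ of $X$, $\mathcal U^d$ is the open cover of $X^{[d]}$ by the sets $U_1\times\cdots\times U_d$, $U_j\in\mathcal U$. Let $\mathcal D(\mathcal U,\rho,F,\delta,\sigma)=\mathcal D(\mathcal U^d|_{\mathrm{Map}(\rho,F,\delta,\sigma)})$, where $|$ denotes the restricted cover. Put $\mathcal D_\Sigma(\mathcal U,\rho,F,\delta)=\varlimsup_{i\to\infty}\mathcal D(\mathcal U,\rho,F,\delta,\sigma_i)/d_i$,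 set to $-\infty$ if $\mathrm{Map}(\rho,F,\delta,\sigma_i)$ is empty for all sufficiently large $i$; $\mathcal D_\Sigma(\mathcal U)=\inf_F\inf_{\delta>0}\mathcal D_\Sigma(\mathcal U,\rho,F,\delta)$ over nonempty finite $F\subseteq G$ and $\delta>0$ (this does not depend on the choice of $\rho$); and $\mathrm{mdim}_\Sigma(X)=\sup_{\mathcal U}\mathcal D_\Sigma(\mathcal U)$ over finite open covers $\mathcal U$ of $X$. Sofic metric mean dimension. For a metric space $(Y,\rho)$ and $\varepsilon>0$, a subset of $Y$ is $(\rho,\varepsilon)$-separated if $\rho(y,z)\ge\varepsilon$ for all distinct $y,z$ in it; $N_\varepsilon(Y,\rho)$ is the maximal cardinality of $(\rho,\varepsilon)$-separated subsets of $Y$. Put $h^\varepsilon_{\Sigma,\infty}(\rho,F,\delta)=\varlimsup_{i\to\infty}\frac1{d_i}\log N_\varepsilon(\mathrm{Map}(\rho,F,\delta,\sigma_i),\rho_\infty)$, set to $-\infty$ if $\mathrm{Map}(\rho,F,\delta,\sigma_i)$ is empty for all sufficiently large $i$; $h^\varepsilon_{\Sigma,\infty}(\rho)=\inf_F\inf_{\delta>0}h^\varepsilon_{\Sigma,\infty}(\rho,F,\delta)$; $\mathrm{mdim}_{\Sigma,\mathrm M}(X,\rho)=\varliminf_{\varepsilon\to0}\frac{1}{|\log\varepsilon|}h^\varepsilon_{\Sigma,\infty}(\rho)$; and $\mathrm{mdim}_{\Sigma,\mathrm M}(X)=\inf_\rho\mathrm{mdim}_{\Sigma,\mathrm M}(X,\rho)$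 over compatible metrics $\rho$ on $X$. *)

theory Defs
  imports "HOL-Analysis.Analysis" "HOL-Algebra.Group" "HOL-Combinatorics.Permutations"
begin

section \<open>Sofic approximation sequences\<close>

definition sofic_approximation ::
  "('g, 'm) monoid_scheme \<Rightarrow> (nat \<Rightarrow> nat) \<Rightarrow> (nat \<Rightarrow> 'g \<Rightarrow> nat \<Rightarrow> nat) \<Rightarrow> bool" where
  "sofic_approximation G d \<sigma> \<longleftrightarrow>
     (\<forall>i. \<forall>s\<in>carrier G. \<sigma> i s permutes {1..d i}) \<and>
     (\<forall>s\<in>carrier G. \<forall>t\<in>carrier G.
        (\<lambda>i. real (card {a \<in> {1..d i}. \<sigma> i s (\<sigma> i t a) = \<sigma> i (s \<otimes>\<^bsub>G\<^esub> t) a}) / real (d i))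
          \<longlonglongrightarrow> 1) \<and>
     (\<forall>s\<in>carrier G. \<forall>t\<in>carrier G. s \<noteq> t \<longrightarrow>
        (\<lambda>i. real (card {a \<in> {1..d i}. \<sigma> i s a = \<sigma> i t a}) / real (d i)) \<longlonglongrightarrow> 0) \<and>
     filterlim d at_top sequentially"

section \<open>Order of a cover and covering dimension\<close>

definition finite_open_cover :: "'a topology \<Rightarrow> 'a set set \<Rightarrow> bool" where
  "finite_open_cover Y \<U> \<longleftrightarrow>
     finite \<U> \<and> (\<forall>U\<in>\<U>. openin Y U) \<and> \<Union>\<U> = topspace Y"

definition cover_refines :: "'a set set \<Rightarrow> 'a set set \<Rightarrow> bool" where
  "cover_refines \<V> \<U> \<longleftrightarrow> (\<forall>V\<in>\<V>. \<exists>U\<in>\<U>. V \<subseteq> U)"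

text \<open>For a nonempty space and a finite cover the supremum is a maximum of natural numbers. For the
  empty space it is the supremum of the empty set of extended reals, so that the order of every
  cover of the empty space, and hence its covering dimension, is \<open>-\<infinity>\<close>.\<close>

definition cover_ord :: "'a topology \<Rightarrow> 'a set set \<Rightarrow> ereal" where
  "cover_ord Y \<U> = (SUP y\<in>topspace Y. ereal (real (card {U \<in> \<U>. y \<in> U}))) - 1"

definition cover_D :: "'a topology \<Rightarrow> 'a set set \<Rightarrow> ereal" where
  "cover_D Y \<U> = (INF \<V>\<in>{\<V>. finite_open_cover Y \<V> \<and> cover_refines \<V> \<U>}. cover_ord Y \<V>)"

definition covering_dim :: "'a topology \<Rightarrow> ereal" where
  "covering_dim Y = (SUP \<U>\<in>{\<U>. finite_open_cover Y \<U>}. cover_D Y \<U>)"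

section \<open>Map spaces\<close>

definition compatible_metric :: "'x topology \<Rightarrow> ('x \<Rightarrow> 'x \<Rightarrow> real) \<Rightarrow> bool" where
  "compatible_metric X \<rho> \<longleftrightarrow>
     Metric_space (topspace X) \<rho> \<and> Metric_space.mtopology (topspace X) \<rho> = X"

definition rho_2 :: "('x \<Rightarrow> 'x \<Rightarrow> real) \<Rightarrow> nat \<Rightarrow> (nat \<Rightarrow> 'x) \<Rightarrow> (nat \<Rightarrow> 'x) \<Rightarrow> real" where
  "rho_2 \<rho> d \<phi> \<psi> = sqrt ((\<Sum>a\<in>{1..d}. (\<rho> (\<phi> a) (\<psi> a))\<^sup>2) / real d)"

definition rho_inf :: "('x \<Rightarrow> 'x \<Rightarrow> real) \<Rightarrow> nat \<Rightarrow> (nat \<Rightarrow> 'x) \<Rightarrow> (nat \<Rightarrow> 'x) \<Rightarrow> real" where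
  "rho_inf \<rho> d \<phi> \<psi> = Max ((\<lambda>a. \<rho> (\<phi> a) (\<psi> a)) ` {1..d})"

definition Map_space ::
  "'x topology \<Rightarrow> ('g \<Rightarrow> 'x \<Rightarrow> 'x) \<Rightarrow> ('x \<Rightarrow> 'x \<Rightarrow> real) \<Rightarrow> 'g set \<Rightarrow> real \<Rightarrow>
     nat \<Rightarrow> ('g \<Rightarrow> nat \<Rightarrow> nat) \<Rightarrow> (nat \<Rightarrow> 'x) set" where
  "Map_space X \<alpha> \<rho> F \<delta> d \<sigma> =
     {\<phi> \<in> {1..d} \<rightarrow>\<^sub>E topspace X. \<forall>s\<in>F. rho_2 \<rho> d (\<phi> \<circ> \<sigma> s) (\<alpha> s \<circ> \<phi>) \<le> \<delta>}"

definition nonempty_finite_subsets :: "'g set \<Rightarrow> 'g set set" where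
  "nonempty_finite_subsets A = {F. F \<subseteq> A \<and> finite F \<and> F \<noteq> {}}"

section \<open>Sofic mean topological dimension\<close>

definition power_cover :: "'x set set \<Rightarrow> nat \<Rightarrow> (nat \<Rightarrow> 'x) set set" where
  "power_cover \<U> d = {PiE {1..d} V | V. V \<in> {1..d} \<rightarrow> \<U>}"

definition restrict_cover :: "'a set set \<Rightarrow> 'a set \<Rightarrow> 'a set set" where
  "restrict_cover \<W> S = (\<lambda>W. W \<inter> S) ` \<W>"

definition D_map ::
  "'x topology \<Rightarrow> ('g \<Rightarrow> 'x \<Rightarrow> 'x) \<Rightarrow> 'x set set \<Rightarrow> ('x \<Rightarrow> 'x \<Rightarrow> real) \<Rightarrow> 'g set \<Rightarrow> real \<Rightarrow>
     nat \<Rightarrow> ('g \<Rightarrow> nat \<Rightarrow> nat) \<Rightarrow> ereal" where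
  "D_map X \<alpha> \<U> \<rho> F \<delta> d \<sigma> =
     cover_D (subtopology (product_topology (\<lambda>_. X) {1..d}) (Map_space X \<alpha> \<rho> F \<delta> d \<sigma>))
       (restrict_cover (power_cover \<U> d) (Map_space X \<alpha> \<rho> F \<delta> d \<sigma>))"

definition D_sofic_local ::
  "(nat \<Rightarrow> nat) \<Rightarrow> (nat \<Rightarrow> 'g \<Rightarrow> nat \<Rightarrow> nat) \<Rightarrow> 'x topology \<Rightarrow> ('g \<Rightarrow> 'x \<Rightarrow> 'x) \<Rightarrow>
     'x set set \<Rightarrow> ('x \<Rightarrow> 'x \<Rightarrow> real) \<Rightarrow> 'g set \<Rightarrow> real \<Rightarrow> ereal" where
  "D_sofic_local d \<sigma> X \<alpha> \<U> \<rho> F \<delta> =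
     (if \<forall>\<^sub>F i in sequentially. Map_space X \<alpha> \<rho> F \<delta> (d i) (\<sigma> i) = {} then -\<infinity>
      else limsup (\<lambda>i. D_map X \<alpha> \<U> \<rho> F \<delta> (d i) (\<sigma> i) / ereal (real (d i))))"

definition D_sofic ::
  "('g, 'm) monoid_scheme \<Rightarrow> (nat \<Rightarrow> nat) \<Rightarrow> (nat \<Rightarrow> 'g \<Rightarrow> nat \<Rightarrow> nat) \<Rightarrow> 'x topology \<Rightarrow>
     ('g \<Rightarrow> 'x \<Rightarrow> 'x) \<Rightarrow> ('x \<Rightarrow> 'x \<Rightarrow> real) \<Rightarrow> 'x set set \<Rightarrow> ereal" where
  "D_sofic G d \<sigma> X \<alpha> \<rho> \<U> =
     (INF F\<in>nonempty_finite_subsets (carrier G). INF \<delta>\<in>{0<..}. D_sofic_local d \<sigma> X \<alpha> \<U> \<rho> F \<delta>)"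

text \<open>The value does not depend on the compatible metric \<open>\<rho>\<close>, which is kept as an argument.\<close>

definition mdim_sofic ::
  "('g, 'm) monoid_scheme \<Rightarrow> (nat \<Rightarrow> nat) \<Rightarrow> (nat \<Rightarrow> 'g \<Rightarrow> nat \<Rightarrow> nat) \<Rightarrow> 'x topology \<Rightarrow>
     ('g \<Rightarrow> 'x \<Rightarrow> 'x) \<Rightarrow> ('x \<Rightarrow> 'x \<Rightarrow> real) \<Rightarrow> ereal" where
  "mdim_sofic G d \<sigma> X \<alpha> \<rho> = (SUP \<U>\<in>{\<U>. finite_open_cover X \<U>}. D_sofic G d \<sigma> X \<alpha> \<rho> \<U>)"

section \<open>Sofic metric mean dimension\<close>

definition metric_separated :: "('y \<Rightarrow> 'y \<Rightarrow> real) \<Rightarrow> real \<Rightarrow> 'y set \<Rightarrow> bool" where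
  "metric_separated \<rho> \<epsilon> A \<longleftrightarrow> (\<forall>y\<in>A. \<forall>z\<in>A. y \<noteq> z \<longrightarrow> \<epsilon> \<le> \<rho> y z)"

text \<open>Finite sets suffice: every subset of a separated set is separated, so an infinite separated
  set makes the supremum \<open>\<infinity>\<close>.\<close>

definition sep_number :: "real \<Rightarrow> 'y set \<Rightarrow> ('y \<Rightarrow> 'y \<Rightarrow> real) \<Rightarrow> enat" where
  "sep_number \<epsilon> Y \<rho> = (SUP A\<in>{A. A \<subseteq> Y \<and> finite A \<and> metric_separated \<rho> \<epsilon> A}. enat (card A))"

definition log_enat :: "enat \<Rightarrow> ereal" where
  "log_enat n = (case n of enat k \<Rightarrow> if k = 0 then -\<infinity> else ereal (ln (real k)) | \<infinity> \<Rightarrow> \<infinity>)"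

definition h_sofic_local ::
  "(nat \<Rightarrow> nat) \<Rightarrow> (nat \<Rightarrow> 'g \<Rightarrow> nat \<Rightarrow> nat) \<Rightarrow> 'x topology \<Rightarrow> ('g \<Rightarrow> 'x \<Rightarrow> 'x) \<Rightarrow>
     real \<Rightarrow> ('x \<Rightarrow> 'x \<Rightarrow> real) \<Rightarrow> 'g set \<Rightarrow> real \<Rightarrow> ereal" where
  "h_sofic_local d \<sigma> X \<alpha> \<epsilon> \<rho> F \<delta> =
     (if \<forall>\<^sub>F i in sequentially. Map_space X \<alpha> \<rho> F \<delta> (d i) (\<sigma> i) = {} then -\<infinity>
      else limsup (\<lambda>i. log_enat (sep_number \<epsilon> (Map_space X \<alpha> \<rho> F \<delta> (d i) (\<sigma> i)) (rho_inf \<rho> (d i)))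
                         / ereal (real (d i))))"

definition h_sofic ::
  "('g, 'm) monoid_scheme \<Rightarrow> (nat \<Rightarrow> nat) \<Rightarrow> (nat \<Rightarrow> 'g \<Rightarrow> nat \<Rightarrow> nat) \<Rightarrow> 'x topology \<Rightarrow>
     ('g \<Rightarrow> 'x \<Rightarrow> 'x) \<Rightarrow> real \<Rightarrow> ('x \<Rightarrow> 'x \<Rightarrow> real) \<Rightarrow> ereal" where
  "h_sofic G d \<sigma> X \<alpha> \<epsilon> \<rho> =
     (INF F\<in>nonempty_finite_subsets (carrier G). INF \<delta>\<in>{0<..}. h_sofic_local d \<sigma> X \<alpha> \<epsilon> \<rho> F \<delta>)"

definition mdim_sofic_metric_wrt ::
  "('g, 'm) monoid_scheme \<Rightarrow> (nat \<Rightarrow> nat) \<Rightarrow> (nat \<Rightarrow> 'g \<Rightarrow> nat \<Rightarrow> nat) \<Rightarrow> 'x topology \<Rightarrow>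
     ('g \<Rightarrow> 'x \<Rightarrow> 'x) \<Rightarrow> ('x \<Rightarrow> 'x \<Rightarrow> real) \<Rightarrow> ereal" where
  "mdim_sofic_metric_wrt G d \<sigma> X \<alpha> \<rho> =
     Liminf (at_right 0) (\<lambda>\<epsilon>. h_sofic G d \<sigma> X \<alpha> \<epsilon> \<rho> / ereal \<bar>ln \<epsilon>\<bar>)"

definition mdim_sofic_metric ::
  "('g, 'm) monoid_scheme \<Rightarrow> (nat \<Rightarrow> nat) \<Rightarrow> (nat \<Rightarrow> 'g \<Rightarrow> nat \<Rightarrow> nat) \<Rightarrow> 'x topology \<Rightarrow>
     ('g \<Rightarrow> 'x \<Rightarrow> 'x) \<Rightarrow> ereal" where
  "mdim_sofic_metric G d \<sigma> X \<alpha> =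
     (INF \<rho>\<in>{\<rho>. compatible_metric X \<rho>}. mdim_sofic_metric_wrt G d \<sigma> X \<alpha> \<rho>)"

section \<open>The full shift\<close>

definition shift_space :: "('g, 'm) monoid_scheme \<Rightarrow> 'z topology \<Rightarrow> ('g \<Rightarrow> 'z) topology" where
  "shift_space G Z = product_topology (\<lambda>_. Z) (carrier G)"

definition shift_action :: "('g, 'm) monoid_scheme \<Rightarrow> 'g \<Rightarrow> ('g \<Rightarrow> 'z) \<Rightarrow> 'g \<Rightarrow> 'z" where
  "shift_action G s x = (\<lambda>t\<in>carrier G. x (inv\<^bsub>G\<^esub> s \<otimes>\<^bsub>G\<^esub> t))"

lemma shift_space_compatible_metric_exists:
  assumes "countable (carrier G)" and "metrizable_space Z"
  shows "\<exists>\<rho>. compatible_metric (shift_space G Z) \<rho>"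
proof -
  have "metrizable_space (shift_space G Z)"
    unfolding shift_space_def metrizable_space_product_topology
    using assms by (auto intro: countable_subset[OF _ assms(1)])
  then obtain M \<rho> where "Metric_space M \<rho>" "shift_space G Z = Metric_space.mtopology M \<rho>"
    unfolding metrizable_space_def by blast
  then have "compatible_metric (shift_space G Z) \<rho>"
    by (simp add: compatible_metric_def Metric_space.topspace_mtopology)
  then show ?thesis by blast
qed

section \<open>Cubes\<close>

definition unit_cube :: "nat \<Rightarrow> (nat \<Rightarrow> real) topology" where
  "unit_cube n = product_topology (\<lambda>_. top_of_set {0..1}) {1..n}"

definition contains_copy :: "'z topology \<Rightarrow> 'y topology \<Rightarrow> bool" where
  "contains_copy Z Y \<longleftrightarrow> (\<exists>S. S \<subseteq> topspace Z \<and> subtopology Z S homeomorphic_space Y)"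

end

theory Submission
  imports Defs
begin

text \<open>
  Mean dimension is at most metric mean dimension: compose the map space with \<open>k d\<close> Lipschitz bump functions
  subordinate to the cover. If the map space has few \<open>\<epsilon>\<close>-separated points, a counting argument finds levels \<open>\<xi>\<close>
  of the bump functions such that no point is close to more than \<open>m\<close> of the walls \<open>f = \<xi>\<close>, where \<open>m/d\<close> is
  about the logarithm of the number of separated points divided by \<open>d |log \<epsilon>|\<close>. Stratifying the space by the
  number of nearby walls gives a refinement of order \<open>m\<close>.

  Metric mean dimension of the full shift is at most \<open>dim Z\<close>: by Pontryagin and Schnirelmann, \<open>Z\<close> has a
  metric whose lower box dimension is at most \<open>dim Z\<close>. It is obtained as a limit of pseudometrics pulled back
  from nerves of fine covers. An approximately equivariant map into \<open>Z\<^sup>G\<close> is determined, up to a small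
  set of points, by its identity coordinates.

  If \<open>Z\<close> contains the \<open>n\<close>-cube, then \<open>a \<mapsto> (z (\<sigma>(t\<^sup>-\<^sup>1) a))\<^sub>t\<close> embeds the cube of dimension \<open>n d\<close> into the map
  space, and Kuhn's labelling lemma yields the Lebesgue covering theorem for that cube.
\<close>

section \<open>Compact metric spaces\<close>

text \<open>The two dimensions meet in a count. Each bump function has about \<open>1/e\<close>
  candidate levels, and a given point is near at most one of them. Excluding that
  \<open>m + 1\<close> walls come near one of \<open>N\<close> points costs a union bound over at
  most \<open>2^(k d)\<close> sets of walls, so \<open>2^(k d) N < M^(m+1)\<close> suffices. After
  division by \<open>d\<close> the factor \<open>2^(k d)\<close> leaves the constant
  \<open>k log 2\<close>, which dies against \<open>|log e|\<close> only as \<open>e\<close> tends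
  to 0; this is why the cover, hence \<open>k\<close>, is fixed before the scale. For the upper
  bound the lower limit over scales is decisive: the metric on \<open>Z\<close> only has to be good
  along one sequence of scales, and such a condition, being stable under small uniform changes, can
  be imposed at infinitely many scales by successive perturbation. Mean dimension is evaluated in
  one given metric whereas metric mean dimension is an infimum over all compatible ones, so map
  spaces for two metrics are compared with constants independent of \<open>d\<close>. The empty
  space is carried along with the value \<open>-\<infinity>\<close> on every side.\<close>

lemma compatible_metricD:
  assumes "compatible_metric X \<rho>"
  shows "Metric_space (topspace X) \<rho>" "Metric_space.mtopology (topspace X) \<rho> = X"
  using assms by (auto simp: compatible_metric_def)

lemma compatible_metric_openin:
  assumes "compatible_metric X \<rho>"
  shows "openin X U \<longleftrightarrow> U \<subseteq> topspace X \<and>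
    (\<forall>x\<in>U. \<exists>r>0. \<forall>y\<in>topspace X. \<rho> x y < r \<longrightarrow> y \<in> U)"
proof -
  interpret Metric_space "topspace X" \<rho> using compatible_metricD[OF assms] by auto
  have "openin X U \<longleftrightarrow> openin mtopology U"
    using compatible_metricD[OF assms] by simp
  moreover have "mball x r \<subseteq> U \<longleftrightarrow> (\<forall>y\<in>topspace X. \<rho> x y < r \<longrightarrow> y \<in> U)" if "x \<in> topspace X" for x r
    using that by auto
  ultimately show ?thesis
    unfolding openin_mtopology by (metis subsetD)
qed

lemma compatible_metric_openin_ball:
  assumes "compatible_metric X \<rho>" "x \<in> topspace X"
  shows "openin X {y \<in> topspace X. \<rho> x y < r}"
proof -
  interpret Metric_space "topspace X" \<rho> using compatible_metricD[OF assms(1)] by auto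
  have "{y \<in> topspace X. \<rho> x y < r} = mball x r" using assms by auto
  then show ?thesis using openin_mball compatible_metricD[OF assms(1)] by metis
qed

lemma metrizable_compatible_metric:
  assumes "metrizable_space X"
  obtains \<rho> where "compatible_metric X \<rho>"
proof -
  obtain M \<rho> where "Metric_space M \<rho>" "X = Metric_space.mtopology M \<rho>"
    using assms unfolding metrizable_space_def by blast
  then have "compatible_metric X \<rho>"
    by (simp add: compatible_metric_def Metric_space.topspace_mtopology)
  then show ?thesis using that by blast
qed

text \<open>The gap between the radii \<open>r\<close> and \<open>2 * r\<close> is what later
  arguments consume: it is the room for the triangle inequality in the Lebesgue number and for the
  ramp of a bump function.\<close>

lemma compact_metric_balls:
  assumes X: "compatible_metric X \<rho>" "compact_space X"
    and U: "\<And>U. U \<in> \<U> \<Longrightarrow> openin X U" "topspace X \<subseteq> \<Union>\<U>"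
  obtains J W where "finite J" "\<And>x r. (x, r) \<in> J \<Longrightarrow> x \<in> topspace X \<and> 0 < r \<and> W (x, r) \<in> \<U>"
    "\<And>x r y. (x, r) \<in> J \<Longrightarrow> y \<in> topspace X \<Longrightarrow> \<rho> x y < 2 * r \<Longrightarrow> y \<in> W (x, r)"
    "\<And>y. y \<in> topspace X \<Longrightarrow> \<exists>(x, r)\<in>J. \<rho> x y < r"
proof -
  interpret Metric_space "topspace X" \<rho> using compatible_metricD[OF X(1)] by auto
  define P where "P = (\<lambda>(x, r) U. U \<in> \<U> \<and> (\<forall>y\<in>topspace X. \<rho> x y < 2 * r \<longrightarrow> y \<in> U))"
  define B where "B = (\<lambda>(x, r). {y \<in> topspace X. \<rho> x y < r})"
  define K where "K = {(x, r). x \<in> topspace X \<and> 0 < r \<and> Ex (P (x, r))}"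
  have op: "openin X V" if "V \<in> B ` K" for V
    using that compatible_metric_openin_ball[OF X(1)] by (auto simp: B_def K_def)
  have "topspace X \<subseteq> \<Union>(B ` K)"
  proof
    fix x assume x: "x \<in> topspace X"
    then obtain U where U': "U \<in> \<U>" "x \<in> U" using U by blast
    then obtain r where r: "r > 0" "\<forall>y\<in>topspace X. \<rho> x y < r \<longrightarrow> y \<in> U"
      using U(1) compatible_metric_openin[OF X(1)] by blast
    have "P (x, r / 2) U" using r U' by (auto simp: P_def)
    then have "(x, r / 2) \<in> K" using x r by (auto simp: K_def)
    moreover have "x \<in> B (x, r / 2)" using x r by (auto simp: B_def)
    ultimately show "x \<in> \<Union>(B ` K)" by blast
  qed
  then obtain \<F> where F: "finite \<F>" "\<F> \<subseteq> B ` K" "topspace X \<subseteq> \<Union>\<F>"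
    using X(2) op unfolding compact_space_alt by (metis (no_types, lifting))
  then obtain J where J: "J \<subseteq> K" "finite J" "\<F> = B ` J"
    by (meson finite_subset_image)
  have P: "P (x, r) (Eps (P (x, r)))" if "(x, r) \<in> J" for x r
    using J that unfolding K_def by (auto intro: someI_ex)
  show ?thesis
  proof (rule that[of J "\<lambda>p. Eps (P p)"])
    show "finite J" by fact
    show "x \<in> topspace X \<and> 0 < r \<and> Eps (P (x, r)) \<in> \<U>" if "(x, r) \<in> J" for x r
      using P[OF that] that J by (auto simp: K_def P_def)
    show "y \<in> Eps (P (x, r))" if "(x, r) \<in> J" "y \<in> topspace X" "\<rho> x y < 2 * r" for x r y
      using P[OF that(1)] that by (auto simp: P_def)
    show "\<exists>(x, r)\<in>J. \<rho> x y < r" if "y \<in> topspace X" for y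
      using that F(3) J(3) by (fastforce simp: B_def)
  qed
qed

lemma compact_metric_Lebesgue_number:
  assumes X: "compatible_metric X \<rho>" "compact_space X"
    and U: "\<And>U. U \<in> \<U> \<Longrightarrow> openin X U" "topspace X \<subseteq> \<Union>\<U>"
  obtains e where "0 < e" "\<And>x. x \<in> topspace X \<Longrightarrow> \<exists>U\<in>\<U>. \<forall>y\<in>topspace X. \<rho> x y < e \<longrightarrow> y \<in> U"
proof -
  interpret Metric_space "topspace X" \<rho> using compatible_metricD[OF X(1)] by auto
  obtain J W where J: "finite J" "\<And>x r. (x, r) \<in> J \<Longrightarrow> x \<in> topspace X \<and> 0 < r \<and> W (x, r) \<in> \<U>"
    "\<And>x r y. (x, r) \<in> J \<Longrightarrow> y \<in> topspace X \<Longrightarrow> \<rho> x y < 2 * r \<Longrightarrow> y \<in> W (x, r)"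
    "\<And>y. y \<in> topspace X \<Longrightarrow> \<exists>(x, r)\<in>J. \<rho> x y < r"
    using compact_metric_balls[OF X U] by metis
  define e where "e = Min (insert 1 (snd ` J))"
  have e: "e > 0" "\<And>x r. (x, r) \<in> J \<Longrightarrow> e \<le> r"
    using J(1,2) by (force simp: e_def intro!: Min_le)+
  show ?thesis
  proof (rule that[OF e(1)])
    fix x assume x: "x \<in> topspace X"
    obtain c r where c: "(c, r) \<in> J" "\<rho> c x < r" using J(4)[of x] x by auto
    have "y \<in> W (c, r)" if "y \<in> topspace X" "\<rho> x y < e" for y
    proof (rule J(3)[OF c(1) that(1)])
      have "\<rho> c y \<le> \<rho> c x + \<rho> x y" using triangle J(2)[OF c(1)] x that by blast
      then show "\<rho> c y < 2 * r" using c e(2)[OF c(1)] that by linarith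
    qed
    then show "\<exists>U\<in>\<U>. \<forall>y\<in>topspace X. \<rho> x y < e \<longrightarrow> y \<in> U"
      using J(2)[OF c(1)] by blast
  qed
qed

text \<open>Heine-Cantor for the identity map: a \<open>\<rho>\<close>-Lebesgue number of the cover
  by \<open>\<rho>'\<close>-balls of radius \<open>\<kappa> / 2\<close> serves as
  \<open>\<eta>\<close>.\<close>

lemma compatible_metric_uniform:
  assumes X: "compatible_metric X \<rho>" "compact_space X" and X': "compatible_metric X \<rho>'" and k: "\<kappa> > 0"
  obtains \<eta> where "0 < \<eta>" "\<And>x y. x \<in> topspace X \<Longrightarrow> y \<in> topspace X \<Longrightarrow> \<rho> x y < \<eta> \<Longrightarrow> \<rho>' x y < \<kappa>"
proof -
  interpret Metric_space "topspace X" \<rho> using compatible_metricD[OF X(1)] by auto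
  interpret M': Metric_space "topspace X" \<rho>' using compatible_metricD[OF X'] by auto
  let ?U = "(\<lambda>x. {y \<in> topspace X. \<rho>' x y < \<kappa> / 2}) ` topspace X"
  obtain e where e: "0 < e" "\<And>x. x \<in> topspace X \<Longrightarrow> \<exists>U\<in>?U. \<forall>y\<in>topspace X. \<rho> x y < e \<longrightarrow> y \<in> U"
  proof (rule compact_metric_Lebesgue_number[OF X, of ?U])
    show "openin X U" if "U \<in> ?U" for U
      using that compatible_metric_openin_ball[OF X', of _ "\<kappa> / 2"] by (auto simp del: less_divide_eq_numeral1)
    show "topspace X \<subseteq> \<Union> ?U" using k by fastforce
  qed blast
  show ?thesis
  proof (rule that[OF e(1)])
    fix x y assume xy: "x \<in> topspace X" "y \<in> topspace X" "\<rho> x y < e"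
    then obtain c where c: "c \<in> topspace X" "\<forall>y\<in>topspace X. \<rho> x y < e \<longrightarrow> \<rho>' c y < \<kappa> / 2"
      using e(2)[of x] by auto
    have "\<rho>' c x < \<kappa> / 2" "\<rho>' c y < \<kappa> / 2" using c xy e(1) by auto
    moreover have "\<rho>' x y \<le> \<rho>' c x + \<rho>' c y" using M'.triangle'' c xy by blast
    ultimately show "\<rho>' x y < \<kappa>" by linarith
  qed
qed

lemma compact_metric_bounded:
  assumes X: "compatible_metric X \<rho>" "compact_space X"
  obtains B where "0 < B" "\<And>x y. x \<in> topspace X \<Longrightarrow> y \<in> topspace X \<Longrightarrow> \<rho> x y \<le> B"
proof -
  interpret Metric_space "topspace X" \<rho> using compatible_metricD[OF X(1)] by auto
  have "compactin mtopology (topspace X)"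
    using X(2) compatible_metricD[OF X(1)] by (simp add: compact_space_def)
  then have "mbounded (topspace X)" by (rule compactin_imp_mbounded)
  then obtain B where "\<forall>x\<in>topspace X. \<forall>y\<in>topspace X. \<rho> x y \<le> B"
    unfolding mbounded_alt by blast
  then show ?thesis by (intro that[of "max 1 B"]) (auto simp: max.coboundedI2)
qed

text \<open>A continuous bijection from a compact space to a Hausdorff space is a homeomorphism.
  Hence only one inclusion between the two topologies, the hypothesis \<open>nbh\<close>, has to be
  verified in each later construction of a metric.\<close>

lemma compatible_metricI:
  assumes M: "Metric_space (topspace X) \<rho>" and X: "compact_space X"
    and nbh: "\<And>x r. x \<in> topspace X \<Longrightarrow> 0 < r \<Longrightarrow> \<exists>W. openin X W \<and> x \<in> W \<and> (\<forall>y\<in>W. \<rho> x y < r)"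
  shows "compatible_metric X \<rho>"
proof -
  interpret Metric_space "topspace X" \<rho> by fact
  have sub: "openin X U" if "openin mtopology U" for U
  proof (rule openin_subopen[THEN iffD2], rule ballI)
    fix x assume x: "x \<in> U"
    then obtain r where r: "r > 0" "mball x r \<subseteq> U" "U \<subseteq> topspace X"
      using \<open>openin mtopology U\<close> unfolding openin_mtopology by blast
    then obtain W where "openin X W" "x \<in> W" "\<forall>y\<in>W. \<rho> x y < r" using nbh[of x r] x r by blast
    moreover from this have "W \<subseteq> mball x r" using openin_subset[of X W] x r(3) by auto
    ultimately show "\<exists>T. openin X T \<and> x \<in> T \<and> T \<subseteq> U" using r by blast
  qed
  have "continuous_map X mtopology (\<lambda>x. x)"
    unfolding continuous_map_def
  proof (intro conjI allI impI)
    show "(\<lambda>x. x) \<in> topspace X \<rightarrow> topspace mtopology" by simp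
    fix U assume U: "openin mtopology U"
    then have "{x \<in> topspace X. x \<in> U} = U" using openin_subset by fastforce
    then show "openin X {x \<in> topspace X. x \<in> U}" using sub[OF U] by simp
  qed
  then have "homeomorphic_map X mtopology (\<lambda>x. x)"
    using X Hausdorff_space_mtopology by (intro continuous_imp_homeomorphic_map) auto
  then have "open_map X mtopology (\<lambda>x. x)" by (rule homeomorphic_imp_open_map)
  then have "openin mtopology U" if "openin X U" for U
    using that by (force simp: open_map_def)
  then have "mtopology = X" using sub by (auto simp: topology_eq)
  then show ?thesis using M by (simp add: compatible_metric_def)
qed

lemma Lipschitz_continuous_map:
  fixes f :: "'x \<Rightarrow> real"
  assumes X: "compatible_metric X \<rho>"
    and f: "\<And>x y. x \<in> topspace X \<Longrightarrow> y \<in> topspace X \<Longrightarrow> \<bar>f x - f y\<bar> \<le> C * \<rho> x y"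
  shows "continuous_map X euclideanreal f"
proof -
  interpret Metric_space "topspace X" \<rho> using compatible_metricD[OF X] by auto
  define D where "D = max 1 C"
  have D: "D > 0" "C \<le> D" by (auto simp: D_def)
  have f': "\<bar>f x - f y\<bar> \<le> D * \<rho> x y" if "x \<in> topspace X" "y \<in> topspace X" for x y
    using f[OF that] mult_right_mono[OF D(2), of "\<rho> x y"] nonneg by fastforce
  have "openin X {x \<in> topspace X. f x \<in> U}" if "open U" for U
    unfolding compatible_metric_openin[OF X]
  proof (intro conjI ballI)
    fix x assume "x \<in> {x \<in> topspace X. f x \<in> U}"
    then have x: "x \<in> topspace X" "f x \<in> U" by auto
    then obtain e where e: "e > 0" "\<And>y. \<bar>y - f x\<bar> < e \<Longrightarrow> y \<in> U"
      using \<open>open U\<close> unfolding open_dist dist_real_def by blast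
    have "f y \<in> U" if "y \<in> topspace X" "\<rho> x y < e / D" for y
    proof (rule e(2))
      have "\<bar>f x - f y\<bar> \<le> D * \<rho> x y" using f' x that by blast
      also have "\<dots> < e" using that D by (simp add: field_simps)
      finally show "\<bar>f y - f x\<bar> < e" by (simp add: abs_minus_commute)
    qed
    then show "\<exists>r>0. \<forall>y\<in>topspace X. \<rho> x y < r \<longrightarrow> y \<in> {x \<in> topspace X. f x \<in> U}"
      using e D by (intro exI[of _ "e / D"]) auto
  qed auto
  then show ?thesis by (simp add: continuous_map_def)
qed

lemma compact_metric_bumps:
  assumes X: "compatible_metric X \<rho>" "compact_space X"
    and U: "\<And>U. U \<in> \<U> \<Longrightarrow> openin X U" "topspace X \<subseteq> \<Union>\<U>"
  obtains J :: "('x \<times> real) set" and C :: real and W :: "'x \<times> real \<Rightarrow> 'x set" and f :: "'x \<times> real \<Rightarrow> 'x \<Rightarrow> real"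
  where "finite J" "0 < C" "\<And>j. j \<in> J \<Longrightarrow> W j \<in> \<U>"
    "\<And>j y. 0 \<le> f j y \<and> f j y \<le> 1"
    "\<And>j y. j \<in> J \<Longrightarrow> y \<in> topspace X \<Longrightarrow> 0 < f j y \<Longrightarrow> y \<in> W j"
    "\<And>y. y \<in> topspace X \<Longrightarrow> \<exists>j\<in>J. f j y = 1"
    "\<And>j x y. j \<in> J \<Longrightarrow> x \<in> topspace X \<Longrightarrow> y \<in> topspace X \<Longrightarrow> \<bar>f j x - f j y\<bar> \<le> C * \<rho> x y"
proof -
  interpret Metric_space "topspace X" \<rho> using compatible_metricD[OF X(1)] by auto
  obtain J W where J: "finite J" "\<And>x r. (x, r) \<in> J \<Longrightarrow> x \<in> topspace X \<and> 0 < r \<and> W (x, r) \<in> \<U>"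
    "\<And>x r y. (x, r) \<in> J \<Longrightarrow> y \<in> topspace X \<Longrightarrow> \<rho> x y < 2 * r \<Longrightarrow> y \<in> W (x, r)"
    "\<And>y. y \<in> topspace X \<Longrightarrow> \<exists>(x, r)\<in>J. \<rho> x y < r"
    using compact_metric_balls[OF X U] by metis
  \<comment> \<open>The function for \<open>(x, r)\<close> is 1 up to distance \<open>r\<close>,
    then falls linearly with slope \<open>1 / r\<close>, and vanishes from distance
    \<open>2 * r\<close> on.\<close>
  define f where "f = (\<lambda>(x, r) y. max 0 (min 1 (2 - \<rho> x y / r)))"
  \<comment> \<open>A crude common Lipschitz constant; the dummy pair \<open>(undefined, 1)\<close>
    makes it positive even if \<open>J\<close> is empty.\<close>
  define C where "C = (\<Sum>(x, r)\<in>insert (undefined, 1) J. 1 / r)"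
  have C: "1 / r \<le> C" if "(x, r) \<in> insert (undefined, 1) J" for x r
    unfolding C_def
    by (rule member_le_sum[of "(x, r)" _ "\<lambda>(x, r). 1 / r", simplified])
       (use that J in \<open>auto simp: less_imp_le\<close>)
  show ?thesis
  proof (rule that[of J C W f])
    show "finite J" by fact
    show "0 < C" using C[of undefined 1] by simp
    show "W j \<in> \<U>" if "j \<in> J" for j using that J(2) by (cases j) auto
    show "0 \<le> f j y \<and> f j y \<le> 1" for j y by (auto simp: f_def split: prod.split)
    show "y \<in> W j" if "j \<in> J" "y \<in> topspace X" "0 < f j y" for j y
    proof -
      obtain x r where x: "j = (x, r)" by (cases j) auto
      then have r: "r > 0" using J(2) that by auto
      have "0 < 2 - \<rho> x y / r" using that x by (simp add: f_def)
      then have "\<rho> x y < 2 * r" using r by (simp add: field_simps)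
      then show ?thesis using J(3) that x by blast
    qed
    show "\<exists>j\<in>J. f j y = 1" if "y \<in> topspace X" for y
    proof -
      obtain x r where x: "(x, r) \<in> J" "\<rho> x y < r" using J(4)[of y] \<open>y \<in> topspace X\<close> by auto
      then have "f (x, r) y = 1" using J(2)[of x r] by (auto simp: f_def max_def min_def field_simps)
      then show ?thesis using x by blast
    qed
    show "\<bar>f j x - f j y\<bar> \<le> C * \<rho> x y" if j: "j \<in> J" and xy: "x \<in> topspace X" "y \<in> topspace X" for j x y
    proof -
      obtain z r where z: "j = (z, r)" by (cases j) auto
      then have z': "z \<in> topspace X" "r > 0" using J(2) j by auto
      have "\<bar>\<rho> z x - \<rho> z y\<bar> \<le> \<rho> x y"
        using mdist_reverse_triangle[of x z y] xy z' commute by metis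
      then have "\<bar>\<rho> z x / r - \<rho> z y / r\<bar> \<le> \<rho> x y / r"
        using z' by (simp add: diff_divide_distrib[symmetric] divide_right_mono)
      moreover have "\<bar>f j x - f j y\<bar> \<le> \<bar>\<rho> z x / r - \<rho> z y / r\<bar>"
        by (auto simp: f_def z)
      moreover have "\<rho> x y / r \<le> C * \<rho> x y"
        using mult_right_mono[OF C[of z r] nonneg[of x y]] j z by simp
      ultimately show ?thesis by linarith
    qed
  qed
qed

section \<open>Product metrics and the Lebesgue covering theorem\<close>

text \<open>With constant weight 1 on a finite index set this is the maximum metric of the cube;
  with weights tending to 0 it metrizes a countable product. The inserted 0 covers an empty index
  set, and the value 0 outside the space gives the nonnegativity and symmetry that
  \<open>Metric_space\<close> demands of all arguments.\<close>

definition sup_metric :: "'i set \<Rightarrow> ('i \<Rightarrow> real) \<Rightarrow> 'z topology \<Rightarrow> ('z \<Rightarrow> 'z \<Rightarrow> real) \<Rightarrow> ('i \<Rightarrow> 'z) \<Rightarrow> ('i \<Rightarrow> 'z) \<Rightarrow> real"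
  where "sup_metric I w Z \<rho> x y =
    (if x \<in> I \<rightarrow>\<^sub>E topspace Z \<and> y \<in> I \<rightarrow>\<^sub>E topspace Z
     then Sup (insert 0 ((\<lambda>i. w i * \<rho> (x i) (y i)) ` I)) else 0)"

lemma sup_metric_bdd_above:
  assumes "compatible_metric Z \<rho>" "compact_space Z" and "\<And>i. i \<in> I \<Longrightarrow> 0 < w i \<and> w i \<le> 1"
    and "x \<in> I \<rightarrow>\<^sub>E topspace Z" "y \<in> I \<rightarrow>\<^sub>E topspace Z"
  shows "bdd_above (insert 0 ((\<lambda>i. w i * \<rho> (x i) (y i)) ` I))"
proof -
  interpret Metric_space "topspace Z" \<rho> using compatible_metricD[OF assms(1)] by auto
  obtain B where B: "0 < B" "\<And>x y. x \<in> topspace Z \<Longrightarrow> y \<in> topspace Z \<Longrightarrow> \<rho> x y \<le> B"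
    using compact_metric_bounded[OF assms(1,2)] by blast
  have "w i * \<rho> (x i) (y i) \<le> B" if "i \<in> I" for i
  proof -
    have "w i * \<rho> (x i) (y i) \<le> 1 * \<rho> (x i) (y i)"
      using assms(3) that nonneg by (intro mult_right_mono) auto
    also have "\<dots> \<le> B" using B(2) assms that by (auto simp: PiE_iff)
    finally show ?thesis .
  qed
  then show ?thesis using B(1) by (auto intro!: bdd_aboveI[of _ B])
qed

lemma sup_metric_le_iff:
  assumes "compatible_metric Z \<rho>" "compact_space Z" and "\<And>i. i \<in> I \<Longrightarrow> 0 < w i \<and> w i \<le> 1"
    and "x \<in> I \<rightarrow>\<^sub>E topspace Z" "y \<in> I \<rightarrow>\<^sub>E topspace Z" and "0 \<le> r"
  shows "sup_metric I w Z \<rho> x y \<le> r \<longleftrightarrow> (\<forall>i\<in>I. w i * \<rho> (x i) (y i) \<le> r)"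
  using assms(4-6) by (simp add: sup_metric_def cSup_le_iff[OF _ sup_metric_bdd_above[OF assms(1-5)]])

lemma sup_metric_upper:
  assumes "compatible_metric Z \<rho>" "compact_space Z" and "\<And>i. i \<in> I \<Longrightarrow> 0 < w i \<and> w i \<le> 1"
    and "x \<in> I \<rightarrow>\<^sub>E topspace Z" "y \<in> I \<rightarrow>\<^sub>E topspace Z" and "i \<in> I"
  shows "w i * \<rho> (x i) (y i) \<le> sup_metric I w Z \<rho> x y"
  using assms(4-6) by (auto simp: sup_metric_def intro!: cSup_upper sup_metric_bdd_above[OF assms(1-5)])

text \<open>Only the finitely many coordinates of weight at least \<open>r / (2 * B)\<close>, where
  \<open>B\<close> bounds \<open>\<rho>\<close>, can contribute more than \<open>r / 2\<close>; a
  box restricting these alone lies inside the ball of radius \<open>r\<close>.\<close>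

lemma compatible_sup_metric:
  assumes Z: "compatible_metric Z \<rho>" "compact_space Z" and w: "\<And>i. i \<in> I \<Longrightarrow> 0 < w i \<and> w i \<le> 1"
    and fin: "\<And>e. 0 < e \<Longrightarrow> finite {i \<in> I. e \<le> w i}"
  shows "compatible_metric (product_topology (\<lambda>_. Z) I) (sup_metric I w Z \<rho>)"
proof -
  interpret Metric_space "topspace Z" \<rho> using compatible_metricD[OF Z(1)] by auto
  let ?X = "product_topology (\<lambda>_. Z) I" and ?d = "sup_metric I w Z \<rho>"
  note le = sup_metric_le_iff[where I = I and w = w, OF Z w] and up = sup_metric_upper[where I = I and w = w, OF Z w]
  have ts: "topspace ?X = I \<rightarrow>\<^sub>E topspace Z" by simp
  have nn: "0 \<le> ?d x y" for x y
    using cSup_upper[OF _ sup_metric_bdd_above[OF Z w], of 0] by (auto simp: sup_metric_def)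
  have M: "Metric_space (topspace ?X) ?d"
  proof
    fix x y z
    show "0 \<le> ?d x y" by (rule nn)
    show "?d x y = ?d y x" by (simp add: sup_metric_def commute)
    assume x: "x \<in> topspace ?X" and y: "y \<in> topspace ?X"
    show "?d x y = 0 \<longleftrightarrow> x = y"
    proof
      assume "?d x y = 0"
      then have "\<forall>i\<in>I. w i * \<rho> (x i) (y i) \<le> 0" using le[of x y 0] x y by (simp add: ts)
      then have "\<forall>i\<in>I. \<rho> (x i) (y i) \<le> 0" using w by (meson mult_pos_pos not_le)
      then have "\<forall>i\<in>I. x i = y i" using x y zero nonneg by (metis PiE_mem antisym ts)
      then show "x = y" using x y PiE_ext by (metis ts)
    next
      assume "x = y"
      then have "?d x y \<le> 0" using le[of x y 0] x y by (auto simp: PiE_iff)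
      then show "?d x y = 0" using nn[of x y] by simp
    qed
    assume z: "z \<in> topspace ?X"
    have "w i * \<rho> (x i) (z i) \<le> ?d x y + ?d y z" if "i \<in> I" for i
    proof -
      have "w i * \<rho> (x i) (z i) \<le> w i * (\<rho> (x i) (y i) + \<rho> (y i) (z i))"
        using w[OF that] triangle[of "x i" "y i" "z i"] x y z that by (intro mult_left_mono) (auto simp: PiE_iff)
      also have "\<dots> \<le> ?d x y + ?d y z"
        using up[of x y i] up[of y z i] x y z that by (simp add: ring_distribs)
      finally show ?thesis .
    qed
    then show "?d x z \<le> ?d x y + ?d y z" using le[of x z "?d x y + ?d y z"] x z nn by (simp add: ts)
  qed
  show ?thesis
  proof (rule compatible_metricI[OF M])
    show "compact_space ?X" using Z(2) by (simp add: compact_space_product_topology)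
    fix x r assume x: "x \<in> topspace ?X" and r: "0 < (r::real)"
    obtain B where B: "0 < B" "\<And>x y. x \<in> topspace Z \<Longrightarrow> y \<in> topspace Z \<Longrightarrow> \<rho> x y \<le> B"
      using compact_metric_bounded[OF Z] by blast
    define K where "K = {i \<in> I. r / (2 * B) \<le> w i}"
    define W where "W = (\<lambda>i. if i \<in> K then {z \<in> topspace Z. \<rho> (x i) z < r / 2} else topspace Z)"
    have "finite K" unfolding K_def using r B by (intro fin) auto
    have xi: "x i \<in> topspace Z" if "i \<in> I" for i using x that by auto
    have "finite {i \<in> I. W i \<noteq> topspace Z}"
      by (rule finite_subset[OF _ \<open>finite K\<close>]) (auto simp: W_def)
    moreover have "openin Z (W i)" if "i \<in> I" for i
      using compatible_metric_openin_ball[OF Z(1) xi[OF that]] by (simp add: W_def del: less_divide_eq_numeral1)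
    ultimately have "openin ?X (PiE I W)" by (auto simp: openin_PiE_gen)
    moreover have "x \<in> PiE I W" using x r xi by (auto simp: W_def PiE_iff)
    moreover have "?d x y < r" if y: "y \<in> PiE I W" for y
    proof -
      have yZ: "y \<in> I \<rightarrow>\<^sub>E topspace Z" using y by (auto simp: W_def PiE_iff split: if_splits)
      have "w i * \<rho> (x i) (y i) \<le> r / 2" if i: "i \<in> I" for i
      proof (cases "i \<in> K")
        case True
        then have "\<rho> (x i) (y i) \<le> r / 2" using y i by (auto simp: W_def PiE_iff)
        then show ?thesis using mult_mono[of "w i" 1 "\<rho> (x i) (y i)" "r / 2"] w[OF i] r nonneg by fastforce
      next
        case False
        then have "w i \<le> r / (2 * B)" using i by (auto simp: K_def)
        moreover have "\<rho> (x i) (y i) \<le> B" using B xi i yZ by (auto simp: PiE_iff)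
        ultimately have "w i * \<rho> (x i) (y i) \<le> r / (2 * B) * B"
          using r B nonneg w[OF i] by (intro mult_mono) auto
        then show ?thesis using B by simp
      qed
      then have "?d x y \<le> r / 2" using le[of x y "r / 2"] x yZ r by simp
      then show ?thesis using r by simp
    qed
    ultimately show "\<exists>W. openin ?X W \<and> x \<in> W \<and> (\<forall>y\<in>W. ?d x y < r)" by blast
  qed
qed

text \<open>Kuhn's labelling of the grid: the label of a grid point only depends on a cover element chosen
  around it, so a completely labelled simplex meets \<open>N + 1\<close> different cover elements.\<close>

lemma cube_cover_order:
  fixes V :: "'i \<Rightarrow> (nat \<Rightarrow> real) set" and N :: nat
  defines "Q \<equiv> product_topology (\<lambda>_. top_of_set {0..1::real}) {..<N}"
  assumes I: "finite I" and op: "\<And>i. i \<in> I \<Longrightarrow> openin Q (V i)" and cov: "topspace Q \<subseteq> (\<Union>i\<in>I. V i)"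
    and faces: "\<And>i c x y. i \<in> I \<Longrightarrow> c < N \<Longrightarrow> x \<in> V i \<Longrightarrow> y \<in> V i \<Longrightarrow> x c = 0 \<Longrightarrow> y c \<noteq> 1"
  obtains x where "x \<in> topspace Q" "N < card {i \<in> I. x \<in> V i}"
proof -
  let ?C = "top_of_set {0..1::real}"
  define \<rho> where "\<rho> = sup_metric {..<N} (\<lambda>_. 1) ?C dist"
  have cC: "compatible_metric ?C dist"
  proof -
    interpret S: Submetric UNIV "dist :: real \<Rightarrow> real \<Rightarrow> real" "{0..1}" by unfold_locales auto
    show ?thesis
      using S.mtopology_submetric S.sub.Metric_space_axioms by (simp add: compatible_metric_def)
  qed
  have kC: "compact_space ?C" by (simp add: compact_space_subtopology)
  have Q: "compatible_metric Q \<rho>"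
    unfolding Q_def \<rho>_def by (rule compatible_sup_metric[OF cC kC]) auto
  have kQ: "compact_space Q" using kC by (simp add: Q_def compact_space_product_topology)
  obtain e where e: "0 < e" "\<And>x. x \<in> topspace Q \<Longrightarrow> \<exists>U\<in>V ` I. \<forall>y\<in>topspace Q. \<rho> x y < e \<longrightarrow> y \<in> U"
    using compact_metric_Lebesgue_number[OF Q kQ, of "V ` I"] op cov by auto
  \<comment> \<open>The mesh \<open>1 / p\<close> lies below the Lebesgue number, so the cover
    element chosen around any vertex of a grid simplex also contains its base vertex.\<close>
  obtain p :: nat where p: "0 < p" "1 / real p < e"
    using reals_Archimedean[OF e(1)] by (metis inverse_eq_divide of_nat_Suc zero_less_Suc)
  define pt where "pt = (\<lambda>x :: nat \<Rightarrow> nat. restrict (\<lambda>c. real (x c) / real p) {..<N})"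
  have pt: "pt x \<in> topspace Q" if "\<And>c. x c \<le> p" for x
    using that p by (auto simp: pt_def Q_def)
  define ch where "ch = (\<lambda>x. SOME i. i \<in> I \<and> (\<forall>y\<in>topspace Q. \<rho> (pt x) y < e \<longrightarrow> y \<in> V i))"
  have ch: "ch x \<in> I" "\<And>y. y \<in> topspace Q \<Longrightarrow> \<rho> (pt x) y < e \<Longrightarrow> y \<in> V (ch x)" if "\<And>c. x c \<le> p" for x
  proof -
    have "\<exists>i. i \<in> I \<and> (\<forall>y\<in>topspace Q. \<rho> (pt x) y < e \<longrightarrow> y \<in> V i)" using e(2)[of "pt x"] pt[of x] that by blast
    from someI_ex[OF this] show "ch x \<in> I" "\<And>y. y \<in> topspace Q \<Longrightarrow> \<rho> (pt x) y < e \<Longrightarrow> y \<in> V (ch x)"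
      unfolding ch_def by blast+
  qed
  interpret Metric_space "topspace Q" \<rho> using compatible_metricD[OF Q] by auto
  have ch_self: "pt x \<in> V (ch x)" if "\<And>c. x c \<le> p" for x
    using ch(2)[of x "pt x"] pt[of x] that e(1) by simp
  \<comment> \<open>Coordinate \<open>c\<close> of the label records whether the element meets the
    face \<open>x c = 0\<close>. By \<open>faces\<close> an element meeting the face
    \<open>x c = 1\<close> gets the value 1 there, which is the boundary condition of Kuhn's
    lemma.\<close>
  define L where "L = (\<lambda>i c. if \<exists>x\<in>V i. x c = 0 then 0 else (1::nat))"
  define lab where "lab = (\<lambda>x. L (ch x))"
  have "odd (card {s. ksimplex p N s \<and> (reduced N \<circ> lab) ` s = {..N}})"
  proof (rule kuhn_combinatorial[OF p(1)]; intro allI impI; elim conjE)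
    fix x :: "nat \<Rightarrow> nat" and j assume x: "\<forall>j. x j \<le> p" and j: "j < N"
    then have self: "pt x \<in> V (ch x)" and chI: "ch x \<in> I" using ch_self ch by auto
    show "lab x j = 0" if "x j = 0"
      using self j that by (auto simp: lab_def L_def pt_def intro!: bexI[of _ "pt x"])
    show "lab x j = 1" if "x j = p"
      using faces[OF chI j _ self] j that p by (auto simp: lab_def L_def pt_def)
  qed
  then have "{s. ksimplex p N s \<and> (reduced N \<circ> lab) ` s = {..N}} \<noteq> {}"
    by (rule odd_card_imp_not_empty)
  then obtain s b u where "kuhn_simplex p N b u s" and rl: "(reduced N \<circ> lab) ` s = {..N}"
    by (auto elim: ksimplex.cases)
  interpret kuhn_simplex p N b u s by fact
  have sp: "x c \<le> p" if "x \<in> s" for x c using that s_le_p by auto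
  have bp: "b c \<le> p" for c using sp[OF base_in_s] .
  have near: "pt b \<in> V (ch x)" if x: "x \<in> s" for x
  proof (rule ch(2))
    show "x c \<le> p" for c using sp x by auto
    show "pt b \<in> topspace Q" using pt bp by auto
    have "\<rho> (pt x) (pt b) \<le> 1 / real p"
      unfolding \<rho>_def
    proof (subst sup_metric_le_iff[OF cC kC])
      show "pt x \<in> {..<N} \<rightarrow>\<^sub>E topspace ?C" "pt b \<in> {..<N} \<rightarrow>\<^sub>E topspace ?C"
        using pt sp x bp by (auto simp: Q_def)
      have "\<bar>real (x c) / real p - real (b c) / real p\<bar> \<le> 1 / real p" for c
      proof -
        have "b c \<le> x c" "x c \<le> Suc (b c)" using base_le x le_Suc_base by auto
        then have "\<bar>real (x c) - real (b c)\<bar> \<le> 1" by auto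
        then have "\<bar>real (x c) - real (b c)\<bar> / real p \<le> 1 / real p" by (simp add: divide_right_mono)
        then show ?thesis by (simp add: diff_divide_distrib[symmetric])
      qed
      then show "\<forall>i\<in>{..<N}. 1 * dist (pt x i) (pt b i) \<le> 1 / real p"
        by (auto simp: pt_def dist_real_def)
    qed auto
    then show "\<rho> (pt x) (pt b) < e" using p by linarith
  qed
  \<comment> \<open>The \<open>N + 1\<close> reduced labels are functions of the chosen elements, so
    at least \<open>N + 1\<close> distinct elements occur on the vertices, and all of them contain
    the base vertex.\<close>
  have "Suc N = card ((reduced N \<circ> L) ` ch ` s)"
    using rl by (simp add: image_image lab_def comp_def)
  also have "\<dots> \<le> card (ch ` s)"
    using I ch(1) sp by (intro card_image_le finite_subset[OF _ I]) blast
  also have "\<dots> \<le> card {i \<in> I. pt b \<in> V i}"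
    using I ch(1) sp near by (intro card_mono) auto
  finally show ?thesis using that[of "pt b"] pt bp by auto
qed

section \<open>Mean dimension and metric mean dimension\<close>

text \<open>Union bound. For a point \<open>p\<close> and \<open>m + 1\<close> prescribed indices,
  the choices of \<open>\<xi>\<close> that agree with \<open>near p\<close> at these indices are at
  most one part in \<open>card \<Gamma> ^ Suc m\<close> of all choices, and there are at most
  \<open>2 ^ card A * card P\<close> such events.\<close>

lemma grid_avoidance:
  fixes near :: "'p \<Rightarrow> 'c \<Rightarrow> 'v"
  assumes A: "finite A" and P: "finite P" and G: "finite \<Gamma>"
    and less: "2 ^ card A * card P < card \<Gamma> ^ Suc m"
  obtains \<xi> where "\<xi> \<in> A \<rightarrow>\<^sub>E \<Gamma>" "\<And>p. p \<in> P \<Longrightarrow> card {c \<in> A. \<xi> c = near p c} \<le> m"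
proof -
  let ?M = "card \<Gamma>"
  have M: "0 < ?M" using less by (cases "?M = 0") auto
  define bad where "bad = (\<lambda>(p, S). {\<xi> \<in> A \<rightarrow>\<^sub>E \<Gamma>. \<forall>c\<in>S. \<xi> c = near p c})"
  define K where "K = P \<times> {S. S \<subseteq> A \<and> card S = Suc m}"
  have finK: "finite K" using A P by (auto simp: K_def)
  have cardK: "card K \<le> card P * 2 ^ card A"
  proof -
    have "card {S. S \<subseteq> A \<and> card S = Suc m} \<le> card (Pow A)"
      using A by (intro card_mono) auto
    then show ?thesis using A by (simp add: K_def card_cartesian_product card_Pow)
  qed
  have fin: "finite (A \<rightarrow>\<^sub>E \<Gamma>)" using A G by (simp add: finite_PiE)
  have cb: "card (bad (p, S)) * ?M ^ Suc m \<le> ?M ^ card A" if "(p, S) \<in> K" for p S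
  proof -
    have S: "S \<subseteq> A" "card S = Suc m" using that by (auto simp: K_def)
    have finS: "finite S" using S A finite_subset by blast
    have "bad (p, S) \<subseteq> PiE A (\<lambda>c. if c \<in> S then {near p c} else \<Gamma>)"
      by (auto simp: bad_def PiE_iff extensional_def)
    then have "card (bad (p, S)) \<le> card (PiE A (\<lambda>c. if c \<in> S then {near p c} else \<Gamma>))"
      using A G by (intro card_mono finite_PiE) auto
    also have "\<dots> = (\<Prod>c\<in>A. if c \<in> S then 1 else ?M)"
      using A by (subst card_PiE) (auto intro!: prod.cong)
    also have "\<dots> = (\<Prod>c\<in>A - S. ?M)"
      using A by (intro prod.mono_neutral_cong_right) auto
    also have "\<dots> = ?M ^ (card A - Suc m)"
      using S finS by (simp add: card_Diff_subset)
    finally have "card (bad (p, S)) * ?M ^ Suc m \<le> ?M ^ (card A - Suc m) * ?M ^ Suc m"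
      by (rule mult_right_mono) simp
    also have "\<dots> = ?M ^ card A"
      using card_mono[OF A S(1)] S(2) by (simp add: power_add[symmetric] del: power_Suc)
    finally show ?thesis .
  qed
  have "card (\<Union>k\<in>K. bad k) * ?M ^ Suc m \<le> (\<Sum>k\<in>K. card (bad k)) * ?M ^ Suc m"
    using card_UN_le[OF finK] by (intro mult_right_mono) auto
  also have "\<dots> = (\<Sum>k\<in>K. card (bad k) * ?M ^ Suc m)" by (simp only: sum_distrib_right)
  also have "\<dots> \<le> (\<Sum>k\<in>K. ?M ^ card A)" using cb by (intro sum_mono) auto
  also have "\<dots> = card K * ?M ^ card A" by simp
  also have "\<dots> \<le> card P * 2 ^ card A * ?M ^ card A" using cardK by (intro mult_right_mono) auto
  also have "\<dots> < ?M ^ Suc m * ?M ^ card A"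
    using less M by (intro mult_strict_right_mono) (auto simp: mult.commute)
  finally have "card (\<Union>k\<in>K. bad k) < ?M ^ card A" using M by (simp add: mult.commute del: power_Suc)
  also have "\<dots> = card (A \<rightarrow>\<^sub>E \<Gamma>)" using A by (simp add: card_PiE)
  finally have lt: "card (\<Union>k\<in>K. bad k) < card (A \<rightarrow>\<^sub>E \<Gamma>)" .
  have "finite (\<Union>k\<in>K. bad k)"
    by (rule finite_subset[OF _ fin]) (auto simp: bad_def)
  then have "\<not> (A \<rightarrow>\<^sub>E \<Gamma>) \<subseteq> (\<Union>k\<in>K. bad k)"
    using card_mono[of "\<Union>k\<in>K. bad k" "A \<rightarrow>\<^sub>E \<Gamma>"] lt by linarith
  then obtain \<xi> where xi: "\<xi> \<in> A \<rightarrow>\<^sub>E \<Gamma>" "\<And>k. k \<in> K \<Longrightarrow> \<xi> \<notin> bad k" by blast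
  show ?thesis
  proof (rule that[OF xi(1)])
    fix p assume p: "p \<in> P"
    show "card {c \<in> A. \<xi> c = near p c} \<le> m"
    proof (rule ccontr)
      assume "\<not> ?thesis"
      then obtain S where S: "S \<subseteq> {c \<in> A. \<xi> c = near p c}" "card S = Suc m"
        by (meson not_less_eq_eq obtain_subset_with_card_n)
      then have "(p, S) \<in> K" "\<xi> \<in> bad (p, S)" using p xi(1) by (auto simp: K_def bad_def)
      then show False using xi(2) by blast
    qed
  qed
qed

text \<open>Points lying close to exactly \<open>i\<close> of the walls \<open>g c = 0\<close> form disjoint open cells, so that every
  point is covered at most once for each \<open>i \<le> m\<close>. The thresholds \<open>r i\<close> increase with \<open>i\<close> in order
  that every point falls into a cell for some \<open>i\<close>.\<close>

lemma wall_cover: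
  fixes g :: "'c \<Rightarrow> 'y \<Rightarrow> real"
  assumes A: "finite A" and cont: "\<And>c. c \<in> A \<Longrightarrow> continuous_map Y euclideanreal (g c)" and R: "0 < R"
    and few: "\<And>y. y \<in> topspace Y \<Longrightarrow> card {c \<in> A. \<bar>g c y\<bar> \<le> R} \<le> m"
  obtains \<V> where "finite_open_cover Y \<V>"
    "\<And>y. y \<in> topspace Y \<Longrightarrow> card {V \<in> \<V>. y \<in> V} \<le> Suc m"
    "\<And>V c. V \<in> \<V> \<Longrightarrow> c \<in> A \<Longrightarrow> (\<forall>y\<in>V. - R < g c y) \<or> (\<forall>y\<in>V. g c y < 0)"
    "{} \<notin> \<V>"
proof -
  \<comment> \<open>The thresholds rise in equal steps up to \<open>r m = R\<close>, so the counts
    within \<open>r i\<close> for \<open>i \<le> m\<close> are controlled by the hypothesis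
    \<open>few\<close>.\<close>
  define r where "r = (\<lambda>i::nat. R * real (Suc i) / real (Suc m))"
  have r0: "0 < r i" for i using R by (simp add: r_def)
  have rmono: "r i < r (Suc i)" for i using R by (simp add: r_def divide_strict_right_mono)
  have rR: "r i \<le> R" if "i \<le> m" for i using R that by (simp add: r_def divide_le_eq)
  \<comment> \<open>\<open>T\<close> collects the nearby walls and \<open>S\<close> the far walls on
    whose positive side \<open>y\<close> lies; for the remaining ones \<open>y\<close> lies on the
    negative side. The threshold depends on \<open>card T\<close> alone.\<close>
  define V where "V = (\<lambda>(T, S). {y \<in> topspace Y. (\<forall>c\<in>T. \<bar>g c y\<bar> < r (card T)) \<and>
      (\<forall>c\<in>S. r (card T) < g c y) \<and> (\<forall>c\<in>A - T - S. g c y < - r (card T))})"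
  define K where "K = {(T, S). T \<subseteq> A \<and> S \<subseteq> A - T \<and> card T \<le> m}"
  have finK: "finite K"
    by (rule finite_subset[of _ "Pow A \<times> Pow A"]) (use A in \<open>auto simp: K_def\<close>)
  have opV: "openin Y (V k)" if "k \<in> K" for k
  proof -
    obtain T S where k: "k = (T, S)" by (cases k) auto
    then have TS: "T \<subseteq> A" "S \<subseteq> A" "finite T" "finite S" "finite (A - T - S)"
      using that A finite_subset[of T A] finite_subset[of S A] by (auto simp: K_def)
    let ?r = "r (card T)"
    have op: "openin Y {y \<in> topspace Y. g c y \<in> U}" if "c \<in> A" "open U" for c U
      using cont[OF that(1)] that(2) by (auto simp: continuous_map_def)
    have fin: "openin Y {y \<in> topspace Y. \<forall>c\<in>B. g c y \<in> U}" if "finite B" "B \<subseteq> A" "open U" for B U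
      using that
    proof (induction B rule: finite_induct)
      case (insert b B)
      have "{y \<in> topspace Y. \<forall>c\<in>insert b B. g c y \<in> U} =
          {y \<in> topspace Y. g b y \<in> U} \<inter> {y \<in> topspace Y. \<forall>c\<in>B. g c y \<in> U}" by auto
      then show ?case using insert op[of b U] by auto
    qed auto
    have "V k = {y \<in> topspace Y. \<forall>c\<in>T. g c y \<in> {- ?r<..< ?r}} \<inter>
        {y \<in> topspace Y. \<forall>c\<in>S. g c y \<in> {?r<..}} \<inter> {y \<in> topspace Y. \<forall>c\<in>A - T - S. g c y \<in> {..<- ?r}}"
      by (auto simp: V_def k abs_less_iff)
    then show ?thesis using fin TS by (simp only:) (intro openin_Int fin; auto)
  qed
  \<comment> \<open>For a fixed \<open>y\<close> the number \<open>card T\<close> determines the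
    threshold, hence \<open>T\<close>, hence the signs recorded by \<open>S\<close>. So
    \<open>y\<close> lies in at most one cell for each size up to \<open>m\<close>.\<close>
  have inj: "inj_on (\<lambda>(T, S). card T) {k \<in> K. y \<in> V k}" for y
  proof (rule inj_onI; clarify)
    fix T S T' S'
    assume h: "(T, S) \<in> K" "(T', S') \<in> K" "y \<in> V (T, S)" "y \<in> V (T', S')" "card T = card T'"
    have "T1 \<subseteq> T2" if "(T1, S1) \<in> K" "(T2, S2) \<in> K" "y \<in> V (T1, S1)" "y \<in> V (T2, S2)" "card T1 = card T2" for T1 T2 S1 S2
    proof
      fix c assume "c \<in> T1"
      then have "\<bar>g c y\<bar> < r (card T2)" "c \<in> A" using that by (auto simp: V_def K_def)
      moreover have "c \<in> S2 \<Longrightarrow> r (card T2) < g c y" "c \<in> A - T2 - S2 \<Longrightarrow> g c y < - r (card T2)"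
        using that(4) by (auto simp: V_def)
      ultimately show "c \<in> T2" by (cases "c \<in> T2"; cases "c \<in> S2") auto
    qed
    then have T: "T = T'" using h by (metis subset_antisym)
    have "S1 \<subseteq> S2" if "(T, S1) \<in> K" "(T, S2) \<in> K" "y \<in> V (T, S1)" "y \<in> V (T, S2)" for S1 S2
    proof
      fix c assume "c \<in> S1"
      then have "r (card T) < g c y" "c \<in> A - T" using that by (auto simp: V_def K_def)
      moreover have "c \<in> A - T - S2 \<Longrightarrow> g c y < - r (card T)"
        using that(4) by (auto simp: V_def)
      ultimately show "c \<in> S2" using r0[of "card T"] by (cases "c \<in> S2") auto
    qed
    then show "T = T' \<and> S = S'" using h T by (metis subset_antisym)
  qed
  have cov: "\<exists>k\<in>K. y \<in> V k" if y: "y \<in> topspace Y" for y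
  proof -
    define n where "n = (\<lambda>i. card {c \<in> A. \<bar>g c y\<bar> \<le> r i})"
    have "n m \<le> m"
      unfolding n_def using rR[of m] by (intro order_trans[OF card_mono few[OF y]]) (use A in auto)
    \<comment> \<open>The first index at which the count \<open>n i\<close> does not exceed
      \<open>i\<close>. If \<open>i > 0\<close>, minimality gives at least \<open>i\<close> walls
      already within \<open>r (i - 1)\<close>; so exactly \<open>i\<close> walls lie within
      \<open>r i\<close>, and none at distance exactly \<open>r i\<close>.\<close>
    define i where "i = (LEAST i. n i \<le> i)"
    have i: "n i \<le> i" "i \<le> m" unfolding i_def using \<open>n m \<le> m\<close> by (rule LeastI, intro Least_le)
    define T where "T = {c \<in> A. \<bar>g c y\<bar> \<le> r i}"
    have finT: "finite T" using A by (simp add: T_def)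
    have "i \<le> card {c \<in> A. \<bar>g c y\<bar> < r i}"
    proof (cases i)
      case (Suc j)
      then have "\<not> n j \<le> j" using not_less_Least[of j "\<lambda>i. n i \<le> i"] by (simp add: i_def)
      then have "i \<le> n j" using Suc by simp
      also have "\<dots> \<le> card {c \<in> A. \<bar>g c y\<bar> < r i}"
        unfolding n_def using rmono[of j] A Suc by (intro card_mono) auto
      finally show ?thesis .
    qed simp
    moreover have "{c \<in> A. \<bar>g c y\<bar> < r i} \<subseteq> T" by (auto simp: T_def)
    moreover have "card T \<le> i" using i by (simp add: n_def T_def)
    ultimately have eq: "{c \<in> A. \<bar>g c y\<bar> < r i} = T" "card T = i"
      using card_seteq[OF finT, of "{c \<in> A. \<bar>g c y\<bar> < r i}"] card_mono[OF finT, of "{c \<in> A. \<bar>g c y\<bar> < r i}"] by auto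
    define S where "S = {c \<in> A - T. 0 < g c y}"
    have "(T, S) \<in> K" using i eq by (auto simp: K_def S_def T_def)
    moreover have "y \<in> V (T, S)"
    proof -
      have in_T: "c \<in> T \<longleftrightarrow> \<bar>g c y\<bar> \<le> r i" if "c \<in> A" for c using that by (simp add: T_def)
      have "\<bar>g c y\<bar> < r i" if "c \<in> T" for c using that eq(1) by blast
      moreover have "r i < g c y" if "c \<in> S" for c using that in_T[of c] by (auto simp: S_def)
      moreover have "g c y < - r i" if "c \<in> A - T - S" for c
        using that in_T[of c] by (auto simp: S_def)
      ultimately show ?thesis using y by (auto simp: V_def eq(2))
    qed
    ultimately show ?thesis by blast
  qed
  show ?thesis
  proof (rule that[of "V ` K - {{}}"])
    show "finite_open_cover Y (V ` K - {{}})"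
    proof -
      have "\<Union>(V ` K - {{}}) = topspace Y" using cov openin_subset[OF opV] by fast
      then show ?thesis using finK opV by (auto simp: finite_open_cover_def)
    qed
    show "card {U \<in> V ` K - {{}}. y \<in> U} \<le> Suc m" if "y \<in> topspace Y" for y
    proof -
      have "card {U \<in> V ` K - {{}}. y \<in> U} \<le> card (V ` {k \<in> K. y \<in> V k})"
        using finK by (intro card_mono) auto
      also have "\<dots> \<le> card {k \<in> K. y \<in> V k}" using finK by (intro card_image_le) auto
      also have "\<dots> = card ((\<lambda>(T, S). card T) ` {k \<in> K. y \<in> V k})" using inj by (simp add: card_image)
      also have "\<dots> \<le> card {..m}" by (intro card_mono) (auto simp: K_def)
      finally show ?thesis by simp
    qed
    show "(\<forall>y\<in>U. - R < g c y) \<or> (\<forall>y\<in>U. g c y < 0)" if U: "U \<in> V ` K - {{}}" and c: "c \<in> A" for U c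
    proof -
      obtain T S where k: "(T, S) \<in> K" "U = V (T, S)" using U by auto
      have rr: "r (card T) \<le> R" using k by (intro rR) (auto simp: K_def)
      consider "c \<in> T" | "c \<in> S" | "c \<in> A - T - S" using c by blast
      then show ?thesis
      proof cases
        case 1
        then have "\<forall>y\<in>U. - R < g c y" using k rr by (fastforce simp: V_def)
        then show ?thesis ..
      next
        case 2
        then have "\<forall>y\<in>U. - R < g c y" using k R r0[of "card T"] by (fastforce simp: V_def)
        then show ?thesis ..
      next
        case 3
        then have "\<forall>y\<in>U. g c y < - r (card T)" using k by (auto simp: V_def)
        then have "\<forall>y\<in>U. g c y < 0" using r0[of "card T"] by fastforce
        then show ?thesis ..
      qed
    qed
  qed auto
qed

lemma cover_ord_le:
  assumes "\<And>y. y \<in> topspace Y \<Longrightarrow> card {V \<in> \<V>. y \<in> V} \<le> Suc m"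
  shows "cover_ord Y \<V> \<le> ereal (real m)"
proof -
  have "(SUP y\<in>topspace Y. ereal (real (card {U \<in> \<V>. y \<in> U}))) \<le> ereal (real (Suc m))"
    using assms by (intro SUP_least) (simp del: of_nat_Suc)
  then have "cover_ord Y \<V> \<le> ereal (real (Suc m)) - 1"
    unfolding cover_ord_def by (intro ereal_minus_mono) auto
  then show ?thesis by (simp add: one_ereal_def)
qed

lemma cover_D_le:
  assumes "finite_open_cover Y \<V>" "cover_refines \<V> \<U>"
    and "\<And>y. y \<in> topspace Y \<Longrightarrow> card {V \<in> \<V>. y \<in> V} \<le> Suc m"
  shows "cover_D Y \<U> \<le> ereal (real m)"
proof -
  have "cover_ord Y \<V> \<le> ereal (real m)" by (rule cover_ord_le) (rule assms(3))
  then show ?thesis unfolding cover_D_def using assms(1,2) by (intro INF_lower2[of \<V>]) auto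
qed

text \<open>A separated set of maximal size is a net, since a point at distance at least
  \<open>e\<close> from it could be added.\<close>

lemma sep_number_net:
  assumes "sep_number e Y \<rho> \<le> enat N"
    and "\<And>y. y \<in> Y \<Longrightarrow> \<rho> y y < e" and "\<And>x y. \<rho> x y = \<rho> y x"
  obtains P where "P \<subseteq> Y" "finite P" "card P \<le> N" "metric_separated \<rho> e P" "\<And>y. y \<in> Y \<Longrightarrow> \<exists>p\<in>P. \<rho> y p < e"
proof -
  define \<A> where "\<A> = {A. A \<subseteq> Y \<and> finite A \<and> metric_separated \<rho> e A}"
  have le: "card A \<le> N" if "A \<in> \<A>" for A
  proof -
    have "enat (card A) \<le> sep_number e Y \<rho>"
      unfolding sep_number_def by (rule SUP_upper2[of A]) (use that in \<open>auto simp: \<A>_def\<close>)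
    then show ?thesis using assms(1) by (metis enat_ord_simps(1) order_trans)
  qed
  have ne: "{} \<in> \<A>" by (simp add: \<A>_def metric_separated_def)
  obtain P where P: "P \<in> \<A>" "\<And>A. A \<in> \<A> \<Longrightarrow> card A \<le> card P"
    using ex_has_greatest_nat[of "\<lambda>A. A \<in> \<A>" "{}" card "Suc N"] ne le le_imp_less_Suc by blast
  show ?thesis
  proof (rule that[of P])
    show "P \<subseteq> Y" "finite P" "metric_separated \<rho> e P" using P by (auto simp: \<A>_def)
    show "card P \<le> N" using le P by auto
    fix y assume y: "y \<in> Y"
    show "\<exists>p\<in>P. \<rho> y p < e"
    proof (rule ccontr)
      assume "\<not> ?thesis"
      then have far: "\<And>p. p \<in> P \<Longrightarrow> e \<le> \<rho> y p" by force
      then have "y \<notin> P" using assms(2) y by force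
      moreover have "insert y P \<in> \<A>"
        using P(1) y far assms(3) by (auto simp: \<A>_def metric_separated_def)
      ultimately show False using P(2)[of "insert y P"] P(1) by (auto simp: \<A>_def)
    qed
  qed
qed

lemma rho_inf_le_iff:
  assumes "1 \<le> d"
  shows "rho_inf \<rho> d \<phi> \<psi> \<le> r \<longleftrightarrow> (\<forall>a\<in>{1..d}. \<rho> (\<phi> a) (\<psi> a) \<le> r)"
    "rho_inf \<rho> d \<phi> \<psi> < r \<longleftrightarrow> (\<forall>a\<in>{1..d}. \<rho> (\<phi> a) (\<psi> a) < r)"
  using assms by (auto simp: rho_inf_def)

text \<open>Here \<open>k\<close> counts the bump functions on \<open>X\<close> and \<open>C\<close>
  is governed by their Lipschitz constant, so both depend on the cover and the metric but not on
  \<open>d\<close>, \<open>Y\<close> or the scale. The condition on \<open>M\<close> says that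
  \<open>M\<close> levels with spacing \<open>C * e\<close> fit into the unit interval.\<close>

lemma cover_D_power_le_separated:
  fixes X :: "'x topology"
  assumes X: "compatible_metric X \<rho>" "compact_space X" and U: "finite_open_cover X \<U>"
  obtains k :: nat and C :: real where "0 < C"
    "\<And>d Y e N M m. \<lbrakk>1 \<le> d; Y \<subseteq> {1..d} \<rightarrow>\<^sub>E topspace X; 0 < e; sep_number e Y (rho_inf \<rho> d) \<le> enat N;
       real M * (C * e) \<le> 1; 2 ^ (k * d) * N < M ^ Suc m\<rbrakk> \<Longrightarrow>
     cover_D (subtopology (product_topology (\<lambda>_. X) {1..d}) Y) (restrict_cover (power_cover \<U> d) Y) \<le> ereal (real m)"
proof -
  interpret Metric_space "topspace X" \<rho> using compatible_metricD[OF X(1)] by auto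
  have U': "\<And>U. U \<in> \<U> \<Longrightarrow> openin X U" "topspace X \<subseteq> \<Union>\<U>"
    using U by (auto simp: finite_open_cover_def)
  show ?thesis
  proof (rule compact_metric_bumps[OF X U'])
    fix J C W f assume J: "finite J" "0 < C" "\<And>j. j \<in> J \<Longrightarrow> W j \<in> \<U>"
      "\<And>j y. 0 \<le> f j y \<and> f j y \<le> (1::real)"
      "\<And>j y. j \<in> J \<Longrightarrow> y \<in> topspace X \<Longrightarrow> 0 < f j y \<Longrightarrow> y \<in> W j"
      "\<And>y. y \<in> topspace X \<Longrightarrow> \<exists>j\<in>J. f j y = 1"
      "\<And>j x y. j \<in> J \<Longrightarrow> x \<in> topspace X \<Longrightarrow> y \<in> topspace X \<Longrightarrow> \<bar>f j x - f j y\<bar> \<le> C * \<rho> x y"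
    show ?thesis
    proof (rule that[of "3 * (C + 1)" "card J"])
      show "0 < 3 * (C + 1)" using J(2) by simp
      fix d Y and e :: real and N M m
      assume d: "1 \<le> d" and Y: "Y \<subseteq> {1..d} \<rightarrow>\<^sub>E topspace X" and e: "0 < e"
        and sep: "sep_number e Y (rho_inf \<rho> d) \<le> enat N"
        and M: "real M * (3 * (C + 1) * e) \<le> 1" and less: "2 ^ (card J * d) * N < M ^ Suc m"
      let ?Y = "subtopology (product_topology (\<lambda>_. X) {1..d}) Y"
      have tsY: "topspace ?Y = Y" using Y by auto
      have Ya: "y a \<in> topspace X" if "y \<in> Y" "a \<in> {1..d}" for y a using Y that by (auto simp: PiE_iff)
      obtain P where P: "P \<subseteq> Y" "finite P" "card P \<le> N" "\<And>y. y \<in> Y \<Longrightarrow> \<exists>p\<in>P. rho_inf \<rho> d y p < e"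
      proof (rule sep_number_net[OF sep])
        show "rho_inf \<rho> d y y < e" if "y \<in> Y" for y
          unfolding rho_inf_le_iff(2)[OF d] using Ya[OF that] e by auto
        show "rho_inf \<rho> d x y = rho_inf \<rho> d y x" for x y by (simp add: rho_inf_def commute)
      qed blast
      define A where "A = J \<times> {1..d}"
      \<comment> \<open>The value at a net point differs from the level of a nearby wall by at most
        \<open>(C + 1) * e\<close>: \<open>C * e\<close> for passing to the net point and
        \<open>e\<close> for the width of a wall. Spacing above twice this leaves at most one
        candidate level.\<close>
      define h where "h = 3 * (C + 1) * e"
      have "0 < C * e" using J(2) e by simp
      then have h: "0 < h" "e \<le> h" "2 * (C + 1) * e < h"
        unfolding h_def using e by (simp_all add: distrib_right distrib_left)
      \<comment> \<open>The lowest level is \<open>e\<close>, so exceeding a level minus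
        \<open>e\<close> forces a bump function to be positive.\<close>
      define \<Gamma> where "\<Gamma> = (\<lambda>q::nat. e + real q * h) ` {..<M}"
      have cardG: "card \<Gamma> = M"
        unfolding \<Gamma>_def using h by (subst card_image) (auto simp: inj_on_def)
      have \<Gamma>: "e \<le> \<xi> \<and> \<xi> \<le> 1" if "\<xi> \<in> \<Gamma>" for \<xi>
      proof -
        obtain q where q: "q < M" "\<xi> = e + real q * h" using \<open>\<xi> \<in> \<Gamma>\<close> by (auto simp: \<Gamma>_def)
        have "e + real q * h \<le> real (Suc q) * h" using h by (simp add: algebra_simps)
        also have "\<dots> \<le> real M * h" using q h by (intro mult_right_mono) auto
        also have "\<dots> \<le> 1" using M by (simp add: h_def)
        finally show ?thesis using q h by simp
      qed
      have unique: "\<xi> = \<xi>'" if G: "\<xi> \<in> \<Gamma>" "\<xi>' \<in> \<Gamma>" and lt: "\<bar>\<xi> - \<xi>'\<bar> < h" for \<xi> \<xi>'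
      proof -
        obtain q q' where q: "\<xi> = e + real q * h" "\<xi>' = e + real q' * h" using G by (auto simp: \<Gamma>_def)
        have "\<xi> - \<xi>' = (real q - real q') * h" by (simp add: q left_diff_distrib)
        then have "\<bar>real q - real q'\<bar> * h < 1 * h" using lt h(1) by (simp add: abs_mult)
        then have "\<bar>real q - real q'\<bar> < 1" using h by (simp only: mult_less_cancel_right_pos)
        then have "q = q'" by linarith
        then show ?thesis by (simp add: q)
      qed
      \<comment> \<open>The only level that may be near, and an arbitrary value if there is
        none.\<close>
      define near where "near = (\<lambda>p (j, a :: nat). SOME \<xi>. \<xi> \<in> \<Gamma> \<and> \<bar>f j (p a) - \<xi>\<bar> \<le> (C + 1) * e)"
      have near: "\<xi> = near p (j, a)" if "\<xi> \<in> \<Gamma>" "\<bar>f j (p a) - \<xi>\<bar> \<le> (C + 1) * e" for \<xi> p j a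
      proof -
        have near': "near p (j, a) \<in> \<Gamma> \<and> \<bar>f j (p a) - near p (j, a)\<bar> \<le> (C + 1) * e"
          unfolding near_def prod.case by (rule someI[of _ \<xi>]) (use that in auto)
        then have "\<bar>\<xi> - near p (j, a)\<bar> \<le> 2 * ((C + 1) * e)" using that(2) by linarith
        also have "2 * ((C + 1) * e) = 2 * (C + 1) * e" by simp
        finally have "\<bar>\<xi> - near p (j, a)\<bar> < h" using h(3) by linarith
        then show ?thesis using that(1) near' unique by blast
      qed
      have "2 ^ card A * card P < card \<Gamma> ^ Suc m"
      proof -
        have "2 ^ card A * card P \<le> 2 ^ (card J * d) * N"
          using P by (simp add: A_def card_cartesian_product)
        then show ?thesis using less cardG by simp
      qed
      then obtain \<xi> where xi: "\<xi> \<in> A \<rightarrow>\<^sub>E \<Gamma>" "\<And>p. p \<in> P \<Longrightarrow> card {c \<in> A. \<xi> c = near p c} \<le> m"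
        using grid_avoidance[of A P \<Gamma> m near] J(1) P(2) by (auto simp: A_def \<Gamma>_def)
      define g where "g = (\<lambda>c y. f (fst c) (y (snd c)) - \<xi> c)"
      obtain \<V> where V: "finite_open_cover ?Y \<V>"
        "\<And>y. y \<in> topspace ?Y \<Longrightarrow> card {V \<in> \<V>. y \<in> V} \<le> Suc m"
        "\<And>V c. V \<in> \<V> \<Longrightarrow> c \<in> A \<Longrightarrow> (\<forall>y\<in>V. - e < g c y) \<or> (\<forall>y\<in>V. g c y < 0)"
        "{} \<notin> \<V>"
      proof (rule wall_cover[of A ?Y g e m])
        show "finite A" using J by (simp add: A_def)
        show "0 < e" by fact
        show "continuous_map ?Y euclideanreal (g c)" if cA: "c \<in> A" for c
        proof -
          obtain j a where c: "c = (j, a)" "j \<in> J" "a \<in> {1..d}" using cA by (auto simp: A_def)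
          have "continuous_map X euclideanreal (f j)"
            using Lipschitz_continuous_map[OF X(1)] J(7)[OF c(2)] by blast
          moreover have "continuous_map ?Y X (\<lambda>y. y a)"
            using c by (intro continuous_map_from_subtopology continuous_map_product_projection)
          ultimately have "continuous_map ?Y euclideanreal (f j \<circ> (\<lambda>y. y a))"
            by (rule continuous_map_compose[rotated])
          then have "continuous_map ?Y euclideanreal (\<lambda>y. f j (y a) - \<xi> c)"
            by (intro continuous_map_diff) (auto simp: comp_def)
          then show ?thesis by (simp add: g_def c)
        qed
        show "card {c \<in> A. \<bar>g c y\<bar> \<le> e} \<le> m" if "y \<in> topspace ?Y" for y
        proof -
          have y: "y \<in> Y" using that tsY by simp
          then obtain p where p: "p \<in> P" "rho_inf \<rho> d y p < e" using P(4) by blast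
          have "\<xi> c = near p c" if c: "c \<in> A" "\<bar>g c y\<bar> \<le> e" for c
          proof -
            obtain j a where c': "c = (j, a)" "j \<in> J" "a \<in> {1..d}" using c by (auto simp: A_def)
            have "p \<in> Y" using p P by auto
            have "\<rho> (y a) (p a) \<le> e" using p(2) c' unfolding rho_inf_le_iff(2)[OF d] by fastforce
            then have "C * \<rho> (y a) (p a) \<le> C * e" using J(2) by (intro mult_left_mono) auto
            then have "\<bar>f j (y a) - f j (p a)\<bar> \<le> C * e"
              using J(7)[OF c'(2) Ya[OF y c'(3)] Ya[OF \<open>p \<in> Y\<close> c'(3)]] by linarith
            moreover have "\<bar>f j (y a) - \<xi> c\<bar> \<le> e" using c c' by (simp add: g_def)
            ultimately have "\<bar>f j (p a) - \<xi> c\<bar> \<le> (C + 1) * e" by (simp add: algebra_simps)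
            moreover have "\<xi> c \<in> \<Gamma>" using xi c by auto
            ultimately show ?thesis using near c' by blast
          qed
          then have "card {c \<in> A. \<bar>g c y\<bar> \<le> e} \<le> card {c \<in> A. \<xi> c = near p c}"
            using J(1) by (intro card_mono) (auto simp: A_def)
          then show ?thesis using xi(2)[OF p(1)] by simp
        qed
      qed blast
      have "cover_refines \<V> (restrict_cover (power_cover \<U> d) Y)"
        unfolding cover_refines_def
      proof
        fix V assume VV: "V \<in> \<V>"
        have VY: "V \<subseteq> Y" using V(1) VV tsY unfolding finite_open_cover_def by blast
        obtain y0 where y0: "y0 \<in> V" using V(4) VV by (metis ex_in_conv)
        \<comment> \<open>At a point of \<open>V\<close> some bump function takes the value 1 in
          coordinate \<open>a\<close>, and no level exceeds 1. So \<open>V\<close> cannot lie below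
          that wall, and the bump function is positive on all of \<open>V\<close>.\<close>
        have "\<exists>j\<in>J. \<forall>y\<in>V. 0 < f j (y a)" if a: "a \<in> {1..d}" for a
        proof -
          obtain j where j: "j \<in> J" "f j (y0 a) = 1" using J(6)[OF Ya[of y0 a]] y0 VY a by blast
          then have c: "(j, a) \<in> A" using a by (simp add: A_def)
          then have x: "e \<le> \<xi> (j, a)" "\<xi> (j, a) \<le> 1" using \<Gamma> xi by blast+
          have "\<not> (\<forall>y\<in>V. g (j, a) y < 0)" using y0 j x by (auto simp: g_def intro!: bexI[of _ y0])
          then have "\<forall>y\<in>V. - e < g (j, a) y" using V(3)[OF VV c] by blast
          then have "\<forall>y\<in>V. 0 < f j (y a)" using x by (force simp: g_def)
          then show ?thesis using j by blast
        qed
        then obtain jj where jj: "\<And>a. a \<in> {1..d} \<Longrightarrow> jj a \<in> J \<and> (\<forall>y\<in>V. 0 < f (jj a) (y a))" by metis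
        have "V \<subseteq> PiE {1..d} (\<lambda>a. W (jj a)) \<inter> Y"
        proof
          fix y assume y: "y \<in> V"
          then have "y a \<in> W (jj a)" if "a \<in> {1..d}" for a
            using J(5)[of "jj a" "y a"] jj[OF that] Ya[of y a] VY that by blast
          then show "y \<in> PiE {1..d} (\<lambda>a. W (jj a)) \<inter> Y" using y VY Y by (auto simp: PiE_iff)
        qed
        moreover have "PiE {1..d} (\<lambda>a. W (jj a)) \<in> power_cover \<U> d"
          unfolding power_cover_def using J(3) jj by blast
        ultimately show "\<exists>U\<in>restrict_cover (power_cover \<U> d) Y. V \<subseteq> U"
          unfolding restrict_cover_def by blast
      qed
      then show "cover_D ?Y (restrict_cover (power_cover \<U> d) Y) \<le> ereal (real m)"
        using V(1,2) by (intro cover_D_le)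
    qed
  qed
qed

section \<open>From fixed \<open>d\<close> to exponential growth rates\<close>

lemma cover_D_empty:
  assumes "topspace Y = {}"
  shows "cover_D Y \<U> = -\<infinity>"
proof -
  have "cover_D Y \<U> \<le> cover_ord Y {}"
    unfolding cover_D_def using assms by (intro INF_lower) (auto simp: finite_open_cover_def cover_refines_def)
  also have "\<dots> = -\<infinity>" using assms by (simp add: cover_ord_def bot_ereal_def one_ereal_def)
  finally show ?thesis by simp
qed

lemma sep_number_eq_0: "sep_number e Y \<rho> = enat 0 \<Longrightarrow> Y = {}"
proof (rule ccontr)
  assume s: "sep_number e Y \<rho> = enat 0" and "Y \<noteq> {}"
  then obtain y where "y \<in> Y" by blast
  then have "enat (card {y}) \<le> sep_number e Y \<rho>"
    unfolding sep_number_def by (intro SUP_upper) (auto simp: metric_separated_def)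
  then show False using s by (simp add: zero_enat_def)
qed

lemma sep_number_mono: "Y \<subseteq> Y' \<Longrightarrow> sep_number e Y \<rho> \<le> sep_number e Y' \<rho>"
  unfolding sep_number_def by (rule SUP_subset_mono) auto

text \<open>The least \<open>m\<close> with \<open>2 ^ (k * d) * N < M ^ Suc m\<close> satisfies
  \<open>M ^ m \<le> 2 ^ (k * d) * N\<close> when \<open>N > 0\<close>; taking logarithms bounds
  \<open>m / d\<close>. The infinite and empty cases are absorbed by the extended values of
  \<open>log_enat\<close>.\<close>

lemma log_enat_bound:
  fixes D :: ereal
  assumes d: "1 \<le> d" and M: "2 \<le> M"
    and empty: "S = enat 0 \<Longrightarrow> D = -\<infinity>"
    and step: "\<And>N m. S = enat N \<Longrightarrow> 2 ^ (k * d) * N < M ^ Suc m \<Longrightarrow> D \<le> ereal (real m)"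
  shows "D / ereal (real d) \<le> (log_enat S / ereal (real d) + ereal (real k * ln 2)) * ereal (1 / ln (real M))"
proof -
  have lnM: "0 < ln (real M)" using M by simp
  consider "S = \<infinity>" | "S = enat 0" | N where "S = enat N" "0 < N" by (cases S) auto
  then show ?thesis
  proof cases
    case 1
    then show ?thesis using d lnM by (simp add: log_enat_def)
  next
    case 2
    then show ?thesis using d lnM empty by (simp add: log_enat_def)
  next
    case (3 N)
    let ?n = "2 ^ (k * d) * N"
    have "\<exists>m. ?n < M ^ Suc m"
    proof
      have "?n < 2 ^ ?n" by (rule less_exp)
      also have "\<dots> \<le> 2 ^ Suc ?n" by simp
      also have "\<dots> \<le> M ^ Suc ?n" using M by (rule power_mono) simp
      finally show "?n < M ^ Suc ?n" .
    qed
    then obtain m where m: "?n < M ^ Suc m" "\<And>l. l < m \<Longrightarrow> \<not> ?n < M ^ Suc l"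
      using exists_least_iff[of "\<lambda>m. ?n < M ^ Suc m"] by blast
    have "M ^ m \<le> ?n"
    proof (cases m)
      case 0 then show ?thesis using 3 by simp
    next
      case (Suc l) then show ?thesis using m(2)[of l] by simp
    qed
    then have "real M ^ m \<le> 2 ^ (k * d) * real N"
      using of_nat_mono[of "M ^ m" ?n, where 'a = real] by simp
    then have "ln (real M ^ m) \<le> ln (2 ^ (k * d) * real N)"
      using M 3 by (subst ln_le_cancel_iff) auto
    then have "real m * ln (real M) \<le> real k * real d * ln 2 + ln (real N)"
      using M 3 by (simp add: ln_realpow ln_mult)
    then have "real m / real d \<le> (ln (real N) / real d + real k * ln 2) * (1 / ln (real M))"
      using d lnM by (simp add: field_simps)
    moreover have "D / ereal (real d) \<le> ereal (real m) / ereal (real d)"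
      using step[OF 3(1) m(1)] d by (intro ereal_divide_right_mono) auto
    ultimately show ?thesis using 3 d by (simp add: log_enat_def order_trans)
  qed
qed

lemma Map_space_subset:
  assumes X: "compatible_metric X \<rho>" "compact_space X" and X': "compatible_metric X \<rho>'"
    and F: "finite F" and \<alpha>: "\<And>s x. s \<in> F \<Longrightarrow> x \<in> topspace X \<Longrightarrow> \<alpha> s x \<in> topspace X" and \<delta>': "0 < \<delta>'"
  obtains \<delta> where "0 < \<delta>"
    "\<And>d \<sigma>. 1 \<le> d \<Longrightarrow> (\<And>s. s \<in> F \<Longrightarrow> \<sigma> s permutes {1..d}) \<Longrightarrow>
       Map_space X \<alpha> \<rho> F \<delta> d \<sigma> \<subseteq> Map_space X \<alpha> \<rho>' F \<delta>' d \<sigma>"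
proof -
  interpret Metric_space "topspace X" \<rho> using compatible_metricD[OF X(1)] by auto
  interpret M': Metric_space "topspace X" \<rho>' using compatible_metricD[OF X'] by auto
  obtain B where B: "0 < B" "\<And>x y. x \<in> topspace X \<Longrightarrow> y \<in> topspace X \<Longrightarrow> \<rho>' x y \<le> B"
    using compact_metric_bounded[OF X' X(2)] by blast
  obtain \<eta> where eta: "0 < \<eta>" "\<And>x y. x \<in> topspace X \<Longrightarrow> y \<in> topspace X \<Longrightarrow> \<rho> x y < \<eta> \<Longrightarrow> \<rho>' x y < \<delta>' / 2"
    using compatible_metric_uniform[OF X X', of "\<delta>' / 2"] \<delta>' by auto
  \<comment> \<open>\<open>\<rho>'\<^sup>2 \<le> \<delta>'\<^sup>2/4 + (B/\<eta>)\<^sup>2 \<rho>\<^sup>2\<close> pointwise, by distinguishing \<open>\<rho> < \<eta>\<close> from \<open>\<rho> \<ge> \<eta>\<close>.\<close>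
  define \<delta> where "\<delta> = \<delta>' * \<eta> / (2 * B)"
  have d0: "0 < \<delta>" using \<delta>' eta B by (simp add: \<delta>_def)
  have pw: "(\<rho>' x y)\<^sup>2 \<le> \<delta>'\<^sup>2 / 4 + (B / \<eta>)\<^sup>2 * (\<rho> x y)\<^sup>2" if xy: "x \<in> topspace X" "y \<in> topspace X" for x y
  proof (cases "\<rho> x y < \<eta>")
    case True
    then have "(\<rho>' x y)\<^sup>2 \<le> (\<delta>' / 2)\<^sup>2" using eta(2)[OF xy] by (intro power_mono) auto
    moreover have "0 \<le> (B / \<eta>)\<^sup>2 * (\<rho> x y)\<^sup>2" by simp
    moreover have "(\<delta>' / 2)\<^sup>2 = \<delta>'\<^sup>2 / 4" by (simp add: power_divide)
    ultimately show ?thesis by linarith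
  next
    case False
    then have "B \<le> B / \<eta> * \<rho> x y" using B eta by (simp add: field_simps)
    then have "(\<rho>' x y)\<^sup>2 \<le> (B / \<eta> * \<rho> x y)\<^sup>2" using B(2)[OF xy] by (intro power_mono) auto
    also have "\<dots> = (B / \<eta>)\<^sup>2 * (\<rho> x y)\<^sup>2" by (rule power_mult_distrib)
    finally show ?thesis using zero_le_power2[of \<delta>'] by linarith
  qed
  show ?thesis
  proof (rule that[OF d0], rule subsetI)
    fix d \<sigma> \<phi> assume d: "1 \<le> d" and \<sigma>: "\<And>s. s \<in> F \<Longrightarrow> \<sigma> s permutes {1..d}"
      and \<phi>: "\<phi> \<in> Map_space X \<alpha> \<rho> F \<delta> d \<sigma>"
    have "rho_2 \<rho>' d (\<phi> \<circ> \<sigma> s) (\<alpha> s \<circ> \<phi>) \<le> \<delta>'" if s: "s \<in> F" for s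
    proof -
      let ?r = "\<lambda>a. \<rho> ((\<phi> \<circ> \<sigma> s) a) ((\<alpha> s \<circ> \<phi>) a)" and ?r' = "\<lambda>a. \<rho>' ((\<phi> \<circ> \<sigma> s) a) ((\<alpha> s \<circ> \<phi>) a)"
      have \<phi>X: "\<phi> a \<in> topspace X" if "a \<in> {1..d}" for a using \<phi> that by (auto simp: Map_space_def)
      have in1: "(\<phi> \<circ> \<sigma> s) a \<in> topspace X" "(\<alpha> s \<circ> \<phi>) a \<in> topspace X" if "a \<in> {1..d}" for a
        using \<phi>X[of "\<sigma> s a"] \<phi>X[OF that] permutes_in_image[OF \<sigma>[OF s], of a] that \<alpha>[OF s] by auto
      have "sqrt ((\<Sum>a\<in>{1..d}. (?r a)\<^sup>2) / real d) \<le> \<delta>"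
        using \<phi> s by (auto simp: Map_space_def rho_2_def)
      then have "(\<Sum>a\<in>{1..d}. (?r a)\<^sup>2) / real d \<le> \<delta>\<^sup>2"
        using d0 by (simp add: sqrt_le_D)
      then have "(B / \<eta>)\<^sup>2 * ((\<Sum>a\<in>{1..d}. (?r a)\<^sup>2) / real d) \<le> (B / \<eta>)\<^sup>2 * \<delta>\<^sup>2"
        by (rule mult_left_mono) simp
      also have "\<dots> = \<delta>'\<^sup>2 / 4" using B eta by (simp add: \<delta>_def power_mult_distrib power_divide field_simps)
      finally have 1: "(B / \<eta>)\<^sup>2 * ((\<Sum>a\<in>{1..d}. (?r a)\<^sup>2) / real d) \<le> \<delta>'\<^sup>2 / 4" .
      have "(\<Sum>a\<in>{1..d}. (?r' a)\<^sup>2) \<le> (\<Sum>a\<in>{1..d}. \<delta>'\<^sup>2 / 4 + (B / \<eta>)\<^sup>2 * (?r a)\<^sup>2)"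
        using in1 by (intro sum_mono pw) auto
      also have "\<dots> = real d * (\<delta>'\<^sup>2 / 4) + (B / \<eta>)\<^sup>2 * (\<Sum>a\<in>{1..d}. (?r a)\<^sup>2)"
        by (simp add: sum.distrib sum_distrib_left)
      finally have "(\<Sum>a\<in>{1..d}. (?r' a)\<^sup>2) / real d
          \<le> (real d * (\<delta>'\<^sup>2 / 4) + (B / \<eta>)\<^sup>2 * (\<Sum>a\<in>{1..d}. (?r a)\<^sup>2)) / real d"
        by (rule divide_right_mono) simp
      also have "\<dots> = \<delta>'\<^sup>2 / 4 + (B / \<eta>)\<^sup>2 * ((\<Sum>a\<in>{1..d}. (?r a)\<^sup>2) / real d)"
        using d by (simp add: add_divide_distrib)
      also have "\<dots> \<le> \<delta>'\<^sup>2" using 1 zero_le_power2[of \<delta>'] by linarith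
      finally show ?thesis using \<delta>' by (simp add: rho_2_def real_le_lsqrt)
    qed
    then show "\<phi> \<in> Map_space X \<alpha> \<rho>' F \<delta>' d \<sigma>" using \<phi> by (simp add: Map_space_def)
  qed
qed

text \<open>Solving for \<open>h\<close> leaves on the left a quantity free of \<open>F\<close> and
  \<open>\<delta>\<close>, so that the infimum defining \<open>h_sofic\<close> can be taken
  afterwards.\<close>

lemma ereal_affine_le:
  fixes D h :: ereal
  assumes "D \<le> (h + ereal c) * ereal (1 / L)" "0 < L"
  shows "D * ereal L - ereal c \<le> h"
  using assms by (cases D; cases h) (auto simp: field_simps)

text \<open>\<open>k\<close> and \<open>C\<close> come from the cover and \<open>\<rho>'\<close>
  alone, before \<open>F\<close> and \<open>\<delta>\<close> are chosen. This uniformity lets the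
  infima over \<open>F\<close> and \<open>\<delta>\<close> pass through the estimate at a fixed
  scale \<open>e\<close>.\<close>

lemma D_sofic_le_h_sofic:
  assumes X: "compatible_metric X \<rho>" "compact_space X" and X': "compatible_metric X \<rho>'"
    and U: "finite_open_cover X \<U>"
    and \<sigma>: "\<And>i s. s \<in> carrier G \<Longrightarrow> \<sigma> i s permutes {1..d i}" and d: "filterlim d at_top sequentially"
    and \<alpha>: "\<And>s x. s \<in> carrier G \<Longrightarrow> x \<in> topspace X \<Longrightarrow> \<alpha> s x \<in> topspace X"
  obtains k :: nat and C :: real where "0 < C"
    "\<And>e M. 0 < e \<Longrightarrow> 2 \<le> M \<Longrightarrow> real M * (C * e) \<le> 1 \<Longrightarrow>
       D_sofic G d \<sigma> X \<alpha> \<rho> \<U> * ereal (ln (real M)) - ereal (real k * ln 2) \<le> h_sofic G d \<sigma> X \<alpha> e \<rho>'"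
proof -
  obtain k :: nat and C :: real where C: "0 < C"
    "\<And>d Y e N M m. \<lbrakk>1 \<le> d; Y \<subseteq> {1..d} \<rightarrow>\<^sub>E topspace X; 0 < e; sep_number e Y (rho_inf \<rho>' d) \<le> enat N;
       real M * (C * e) \<le> 1; 2 ^ (k * d) * N < M ^ Suc m\<rbrakk> \<Longrightarrow>
     cover_D (subtopology (product_topology (\<lambda>_. X) {1..d}) Y) (restrict_cover (power_cover \<U> d) Y) \<le> ereal (real m)"
    using cover_D_power_le_separated[OF X' X(2) U] by metis
  show ?thesis
  proof (rule that[OF C(1)])
    fix e :: real and M :: nat assume e: "0 < e" and M: "2 \<le> M" "real M * (C * e) \<le> 1"
    let ?L = "ln (real M)" and ?c = "real k * ln 2" and ?D = "D_sofic G d \<sigma> X \<alpha> \<rho> \<U>"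
    have L: "0 < ?L" using M by simp
    have d1: "\<forall>\<^sub>F i in sequentially. 1 \<le> d i" using d by (simp add: filterlim_at_top)
    have "?D * ereal ?L - ereal ?c \<le> h_sofic_local d \<sigma> X \<alpha> e \<rho>' F \<delta>'"
      if F: "F \<in> nonempty_finite_subsets (carrier G)" and \<delta>': "0 < \<delta>'" for F \<delta>'
    proof (rule ereal_affine_le[OF _ L])
      have FG: "F \<subseteq> carrier G" "finite F" using F by (auto simp: nonempty_finite_subsets_def)
      obtain \<delta> where \<delta>: "0 < \<delta>"
        "\<And>d \<sigma>. 1 \<le> d \<Longrightarrow> (\<And>s. s \<in> F \<Longrightarrow> \<sigma> s permutes {1..d}) \<Longrightarrow>
           Map_space X \<alpha> \<rho> F \<delta> d \<sigma> \<subseteq> Map_space X \<alpha> \<rho>' F \<delta>' d \<sigma>"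
      proof (rule Map_space_subset[OF X X' FG(2) _ \<delta>'])
        show "\<alpha> s x \<in> topspace X" if "s \<in> F" "x \<in> topspace X" for s x using \<alpha> FG that by blast
      qed blast
      let ?Y = "\<lambda>i. Map_space X \<alpha> \<rho> F \<delta> (d i) (\<sigma> i)" and ?Y' = "\<lambda>i. Map_space X \<alpha> \<rho>' F \<delta>' (d i) (\<sigma> i)"
      have sub: "?Y i \<subseteq> ?Y' i" if "1 \<le> d i" for i using \<delta>(2)[OF that, of "\<sigma> i"] \<sigma> FG by blast
      let ?b = "\<lambda>i. log_enat (sep_number e (?Y' i) (rho_inf \<rho>' (d i))) / ereal (real (d i))"
      have "?D \<le> D_sofic_local d \<sigma> X \<alpha> \<U> \<rho> F \<delta>"
        unfolding D_sofic_def using F \<delta>(1) by (intro INF_lower2[of F] INF_lower2[of \<delta>]) auto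
      also have "\<dots> \<le> (h_sofic_local d \<sigma> X \<alpha> e \<rho>' F \<delta>' + ereal ?c) * ereal (1 / ?L)"
      proof (cases "\<forall>\<^sub>F i in sequentially. ?Y i = {}")
        case True
        then show ?thesis by (simp add: D_sofic_local_def)
      next
        case False
        \<comment> \<open>The two default values must not clash: if the larger map spaces were
          eventually empty, so would be the smaller ones.\<close>
        have "\<not> (\<forall>\<^sub>F i in sequentially. ?Y' i = {})"
        proof
          assume "\<forall>\<^sub>F i in sequentially. ?Y' i = {}"
          with d1 have "\<forall>\<^sub>F i in sequentially. ?Y i = {}" by eventually_elim (use sub in blast)
          then show False using False by simp
        qed
        then have h: "h_sofic_local d \<sigma> X \<alpha> e \<rho>' F \<delta>' = limsup ?b" by (simp add: h_sofic_local_def)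
        have "limsup (\<lambda>i. D_map X \<alpha> \<U> \<rho> F \<delta> (d i) (\<sigma> i) / ereal (real (d i)))
            \<le> limsup (\<lambda>i. (?b i + ereal ?c) * ereal (1 / ?L))"
        proof (rule Limsup_mono, rule eventually_mono[OF d1])
          fix i assume di: "1 \<le> d i"
          have YX: "?Y i \<subseteq> {1..d i} \<rightarrow>\<^sub>E topspace X" by (auto simp: Map_space_def)
          have le: "sep_number e (?Y i) (rho_inf \<rho>' (d i)) \<le> sep_number e (?Y' i) (rho_inf \<rho>' (d i))"
            by (rule sep_number_mono[OF sub[OF di]])
          show "D_map X \<alpha> \<U> \<rho> F \<delta> (d i) (\<sigma> i) / ereal (real (d i)) \<le> (?b i + ereal ?c) * ereal (1 / ?L)"
          proof (rule log_enat_bound[OF di M(1)])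
            assume "sep_number e (?Y' i) (rho_inf \<rho>' (d i)) = enat 0"
            then have "?Y i = {}" using sep_number_eq_0 sub[OF di] by blast
            then show "D_map X \<alpha> \<U> \<rho> F \<delta> (d i) (\<sigma> i) = -\<infinity>"
              unfolding D_map_def by (intro cover_D_empty) simp
          next
            fix N m assume N: "sep_number e (?Y' i) (rho_inf \<rho>' (d i)) = enat N" and lt: "2 ^ (k * d i) * N < M ^ Suc m"
            show "D_map X \<alpha> \<U> \<rho> F \<delta> (d i) (\<sigma> i) \<le> ereal (real m)"
              unfolding D_map_def using C(2)[OF di YX e _ M(2) lt] le N by simp
          qed
        qed
        also have "\<dots> = (limsup ?b + ereal ?c) * ereal (1 / ?L)"
          using L by (simp add: Limsup_ereal_mult_right Limsup_add_ereal_right del: times_ereal.simps)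
        finally show ?thesis using False h by (simp add: D_sofic_local_def)
      qed
      finally show "?D \<le> (h_sofic_local d \<sigma> X \<alpha> e \<rho>' F \<delta>' + ereal ?c) * ereal (1 / ?L)" .
    qed
    then show "?D * ereal ?L - ereal ?c \<le> h_sofic G d \<sigma> X \<alpha> e \<rho>'"
      unfolding h_sofic_def by (intro INF_greatest) auto
  qed
qed

text \<open>For \<open>M = \<lfloor>1 / (C * e)\<rfloor>\<close> the numbers \<open>ln M\<close> and
  \<open>\<bar>ln e\<bar>\<close> differ by a bounded amount, so after division by
  \<open>\<bar>ln e\<bar>\<close> both that difference and \<open>c\<close> disappear in the limit.
  \<open>D\<close> may be infinite or negative.\<close>

lemma D_le_Liminf:
  fixes D :: ereal and h :: "real \<Rightarrow> ereal"
  assumes C: "0 < C"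
    and le: "\<And>e M. 0 < e \<Longrightarrow> 2 \<le> M \<Longrightarrow> real M * (C * e) \<le> 1 \<Longrightarrow> D * ereal (ln (real M)) - ereal c \<le> h e"
  shows "D \<le> Liminf (at_right 0) (\<lambda>e. h e / ereal \<bar>ln e\<bar>)"
proof -
  define M where "M = (\<lambda>e. nat \<lfloor>1 / (C * e)\<rfloor>)"
  define e0 where "e0 = min (1 / 2) (1 / (2 * C))"
  have e0: "0 < e0" using C by (simp add: e0_def)
  have ev: "\<forall>\<^sub>F e in at_right 0. 0 < e \<and> e < e0"
    using eventually_at_right_real[OF e0] by (rule eventually_mono) auto
  have M: "2 \<le> M e" "real (M e) \<le> 1 / (C * e)" "1 / (C * e) \<le> 2 * real (M e)"
    if e: "0 < e" "e < e0" for e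
  proof -
    have "e * (2 * C) \<le> 1" using e C by (simp add: e0_def field_simps)
    then have 2: "2 \<le> 1 / (C * e)" using C e by (simp add: field_simps)
    then have "2 \<le> \<lfloor>1 / (C * e)\<rfloor>" by (simp add: le_floor_iff)
    then have "nat 2 \<le> nat \<lfloor>1 / (C * e)\<rfloor>" by (rule nat_mono)
    then show M2: "2 \<le> M e" unfolding M_def by (simp only: nat_numeral)
    have M': "real (M e) = real_of_int \<lfloor>1 / (C * e)\<rfloor>" using M2 by (simp add: M_def)
    show "real (M e) \<le> 1 / (C * e)" unfolding M' by linarith
    have "1 / (C * e) \<le> real (M e) + 1" unfolding M' by linarith
    then show "1 / (C * e) \<le> 2 * real (M e)" using M2 by linarith
  qed
  have h: "D * ereal (ln (real (M e))) - ereal c \<le> h e" if e: "0 < e" "e < e0" for e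
  proof (rule le[OF e(1) M(1)[OF e]])
    have "real (M e) * (C * e) \<le> 1 / (C * e) * (C * e)" using M(2)[OF e] C e by (intro mult_right_mono) auto
    then show "real (M e) * (C * e) \<le> 1" using C e by simp
  qed
  have lne: "ln e < 0 \<and> 0 < \<bar>ln e\<bar> \<and> \<bar>ln e\<bar> = - ln e" if e: "0 < e" "e < e0" for e
  proof -
    have "ln e < 0" using e by (simp add: e0_def)
    then show ?thesis by simp
  qed
  show ?thesis
  proof (cases D)
    case (real r)
    \<comment> \<open>The term \<open>\<bar>r\<bar> * ln 2\<close> pays for the floor, which loses
      at most a factor 2; the absolute value covers both signs of \<open>r\<close>.\<close>
    have lim: "((\<lambda>e. r - (r * ln C + \<bar>r\<bar> * ln 2 + c) * inverse (- ln e)) \<longlongrightarrow> r - (r * ln C + \<bar>r\<bar> * ln 2 + c) * 0) (at_right 0)"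
    proof (intro tendsto_intros tendsto_inverse_0_at_top)
      show "filterlim (\<lambda>e. - ln e) at_top (at_right (0::real))"
        using ln_at_0 by (simp add: filterlim_uminus_at_top)
    qed
    have "D = Liminf (at_right 0) (\<lambda>e. ereal (r - (r * ln C + \<bar>r\<bar> * ln 2 + c) * inverse (- ln e)))"
      using lim_imp_Liminf[OF _ tendsto_ereal[OF lim]] real by simp
    also have "\<dots> \<le> Liminf (at_right 0) (\<lambda>e. h e / ereal \<bar>ln e\<bar>)"
    proof (rule Liminf_mono, rule eventually_mono[OF ev], elim conjE)
      fix e assume e: "0 < e" "e < e0"
      have Mpos: "0 < real (M e)" using M(1)[OF e] by simp
      have "ln (real (M e)) \<le> ln (1 / (C * e))" using M(2)[OF e] Mpos C e by (subst ln_le_cancel_iff) auto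
      moreover have "ln (1 / (C * e)) \<le> ln (2 * real (M e))"
        using M(3)[OF e] Mpos C e by (subst ln_le_cancel_iff) auto
      moreover have "ln (1 / (C * e)) = - ln C - ln e" using C e by (simp add: ln_div ln_mult)
      moreover have "ln (2 * real (M e)) = ln 2 + ln (real (M e))" using Mpos by (simp add: ln_mult)
      ultimately have b: "ln (real (M e)) \<le> - ln C - ln e" "- ln C - ln e - ln 2 \<le> ln (real (M e))" by linarith+
      have "r * (- ln C - ln e) - \<bar>r\<bar> * ln 2 \<le> r * ln (real (M e))"
      proof (cases "0 \<le> r")
        case True
        then show ?thesis using mult_left_mono[OF b(2), of r] by (simp add: algebra_simps)
      next
        case False
        then have "r * (- ln C - ln e) \<le> r * ln (real (M e))" using b(1) by (intro mult_left_mono_neg) auto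
        moreover have "0 \<le> \<bar>r\<bar> * ln 2" by simp
        ultimately show ?thesis by linarith
      qed
      moreover have "ereal (r * ln (real (M e)) - c) \<le> h e" using h[OF e] real by simp
      ultimately have "ereal (r * (- ln C - ln e) - \<bar>r\<bar> * ln 2 - c) \<le> h e"
        by (meson diff_right_mono ereal_less_eq(3) order_trans)
      then have "ereal (r * (- ln C - ln e) - \<bar>r\<bar> * ln 2 - c) / ereal \<bar>ln e\<bar> \<le> h e / ereal \<bar>ln e\<bar>"
        using lne[OF e] by (intro ereal_divide_right_mono) auto
      moreover have "r - (r * ln C + \<bar>r\<bar> * ln 2 + c) * inverse (- ln e) = (r * (- ln C - ln e) - \<bar>r\<bar> * ln 2 - c) / \<bar>ln e\<bar>"
        using lne[OF e] by (simp add: field_simps)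
      ultimately show "ereal (r - (r * ln C + \<bar>r\<bar> * ln 2 + c) * inverse (- ln e)) \<le> h e / ereal \<bar>ln e\<bar>"
        using lne[OF e] by simp
    qed
    finally show ?thesis .
  next
    case PInf
    have "\<forall>\<^sub>F e in at_right 0. \<infinity> \<le> h e / ereal \<bar>ln e\<bar>"
    proof (rule eventually_mono[OF ev], elim conjE)
      fix e assume e: "0 < e" "e < e0"
      have "0 < ln (real (M e))" using M(1)[OF e] by simp
      then have "h e = \<infinity>" using h[OF e] PInf by simp
      then show "\<infinity> \<le> h e / ereal \<bar>ln e\<bar>" using lne[OF e] by simp
    qed
    then have "\<infinity> \<le> Liminf (at_right 0) (\<lambda>e. h e / ereal \<bar>ln e\<bar>)"
      by (intro Liminf_bounded) auto
    then show ?thesis by simp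
  qed simp
qed

lemma mdim_sofic_le_mdim_sofic_metric:
  assumes X: "compatible_metric X \<rho>" "compact_space X"
    and \<sigma>: "\<And>i s. s \<in> carrier G \<Longrightarrow> \<sigma> i s permutes {1..d i}" and d: "filterlim d at_top sequentially"
    and \<alpha>: "\<And>s x. s \<in> carrier G \<Longrightarrow> x \<in> topspace X \<Longrightarrow> \<alpha> s x \<in> topspace X"
  shows "mdim_sofic G d \<sigma> X \<alpha> \<rho> \<le> mdim_sofic_metric G d \<sigma> X \<alpha>"
  unfolding mdim_sofic_def mdim_sofic_metric_def
proof (intro SUP_least INF_greatest)
  fix \<U> \<rho>' assume U: "\<U> \<in> {\<U>. finite_open_cover X \<U>}" and \<rho>': "\<rho>' \<in> {\<rho>. compatible_metric X \<rho>}"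
  show "D_sofic G d \<sigma> X \<alpha> \<rho> \<U> \<le> mdim_sofic_metric_wrt G d \<sigma> X \<alpha> \<rho>'"
  proof (rule D_sofic_le_h_sofic[of X \<rho> \<rho>' \<U> G \<sigma> d \<alpha>])
    fix k :: nat and C :: real
    assume "0 < C" "\<And>e M. 0 < e \<Longrightarrow> 2 \<le> M \<Longrightarrow> real M * (C * e) \<le> 1 \<Longrightarrow>
      D_sofic G d \<sigma> X \<alpha> \<rho> \<U> * ereal (ln (real M)) - ereal (real k * ln 2) \<le> h_sofic G d \<sigma> X \<alpha> e \<rho>'"
    then show ?thesis unfolding mdim_sofic_metric_wrt_def by (rule D_le_Liminf)
  qed (use X \<rho>' U \<sigma> d \<alpha> in auto)
qed

section \<open>Metrics of small box dimension\<close>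

text \<open>The functions \<open>l x\<close> are points of the \<open>n\<close>-skeleton of a
  simplex. Such a point is coded by its support and its coordinates rounded to multiples of
  \<open>1 / K\<close>, except one: that coordinate is controlled by the others because the sum is
  1. Omitting it gives the exponent \<open>n\<close> instead of \<open>n + 1\<close>.\<close>

lemma simplex_points_card_le:
  fixes l :: "'x \<Rightarrow> 'v \<Rightarrow> real"
  assumes V: "finite V" and K: "0 < K"
    and l: "\<And>x v. x \<in> A \<Longrightarrow> v \<in> V \<Longrightarrow> 0 \<le> l x v" "\<And>x. x \<in> A \<Longrightarrow> sum (l x) V = 1"
    and supp: "\<And>x. x \<in> A \<Longrightarrow> card {v \<in> V. l x v \<noteq> 0} \<le> Suc n"
    and far: "\<And>x y. x \<in> A \<Longrightarrow> y \<in> A \<Longrightarrow> x \<noteq> y \<Longrightarrow> 2 * real n / real K < (\<Sum>v\<in>V. \<bar>l x v - l y v\<bar>)"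
  shows "card A \<le> 2 ^ card V * Suc K ^ n"
proof -
  define S where "S = (\<lambda>x. {v \<in> V. l x v \<noteq> 0})"
  \<comment> \<open>The omitted vertex depends on the support alone, hence agrees for points with
    the same code.\<close>
  define u where "u = (\<lambda>S :: 'v set. SOME v. v \<in> S)"
  define g where "g = (\<lambda>x. (S x, restrict (\<lambda>v. nat \<lfloor>l x v * real K\<rfloor>) (S x - {u (S x)})))"
  define T where "T = (SIGMA S : {S \<in> Pow V. card S \<le> Suc n \<and> S \<noteq> {}}. (S - {u S}) \<rightarrow>\<^sub>E {..K})"
  have le1: "l x v \<le> 1" if "x \<in> A" "v \<in> V" for x v
    using member_le_sum[of v V "l x"] l that V by auto
  have Sne: "S x \<noteq> {}" if "x \<in> A" for x
  proof
    assume "S x = {}"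
    then have "sum (l x) V = 0" by (intro sum.neutral) (auto simp: S_def)
    then show False using l(2)[OF that] by simp
  qed
  have uS: "u S \<in> S" if "S \<noteq> {}" for S using that by (auto simp: u_def intro: someI)
  have gT: "g ` A \<subseteq> T"
  proof
    fix c assume "c \<in> g ` A"
    then obtain x where x: "x \<in> A" "c = g x" by blast
    have "nat \<lfloor>l x v * real K\<rfloor> \<le> K" if "v \<in> V" for v
    proof -
      have "l x v * real K \<le> 1 * real K" using le1[OF x(1) that] by (intro mult_right_mono) auto
      then show ?thesis by (simp add: nat_le_iff floor_le_iff)
    qed
    then show "c \<in> T" using x Sne[OF x(1)] supp[OF x(1)] by (auto simp: T_def g_def S_def)
  qed
  have finT: "finite T"
    unfolding T_def by (rule finite_SigmaI) (use V in \<open>auto intro!: finite_PiE intro: finite_subset\<close>)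
  have "inj_on g A"
  proof (rule inj_onI, rule ccontr)
    fix x y assume xy: "x \<in> A" "y \<in> A" "g x = g y" "x \<noteq> y"
    let ?S = "S x" and ?v = "u (S x)"
    have Sy: "S y = ?S" using xy by (simp add: g_def)
    have fS: "finite ?S" using V by (simp add: S_def)
    have cS: "card (?S - {?v}) \<le> n" using supp[OF xy(1)] uS[OF Sne[OF xy(1)]] fS by (simp add: S_def)
    have diff: "\<bar>l x v - l y v\<bar> \<le> 1 / real K" if v: "v \<in> ?S - {?v}" for v
    proof -
      have vV: "v \<in> V" using v by (auto simp: S_def)
      have "nat \<lfloor>l x v * real K\<rfloor> = nat \<lfloor>l y v * real K\<rfloor>"
      proof -
        have "snd (g x) v = snd (g y) v" using xy(3) by simp
        then show ?thesis using v Sy by (simp add: g_def)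
      qed
      moreover have "0 \<le> l x v * real K" "0 \<le> l y v * real K" using l(1) xy vV by auto
      ultimately have "\<lfloor>l x v * real K\<rfloor> = \<lfloor>l y v * real K\<rfloor>" by (simp add: eq_nat_nat_iff)
      then have "\<bar>l x v * real K - l y v * real K\<bar> \<le> 1" by linarith
      then have "\<bar>l x v - l y v\<bar> * real K \<le> 1" by (simp add: left_diff_distrib[symmetric] abs_mult)
      then show ?thesis using K by (simp add: field_simps)
    qed
    have sumS: "sum f V = f ?v + sum f (?S - {?v})" if "\<And>v. v \<in> V - ?S \<Longrightarrow> f v = 0" for f :: "'v \<Rightarrow> real"
    proof -
      have "sum f V = sum f ?S" using V that by (intro sum.mono_neutral_right) (auto simp: S_def)
      also have "\<dots> = f ?v + sum f (?S - {?v})" using fS uS[OF Sne[OF xy(1)]] by (rule sum.remove)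
      finally show ?thesis .
    qed
    have zero: "l x v = 0" "l y v = 0" if "v \<in> V - ?S" for v using that Sy by (auto simp: S_def)
    have rest: "(\<Sum>v\<in>?S - {?v}. \<bar>l x v - l y v\<bar>) \<le> real n / real K"
    proof -
      have "(\<Sum>v\<in>?S - {?v}. \<bar>l x v - l y v\<bar>) \<le> real (card (?S - {?v})) * (1 / real K)"
        using diff by (rule sum_bounded_above)
      also have "\<dots> \<le> real n * (1 / real K)" using cS by (intro mult_right_mono) auto
      finally show ?thesis by simp
    qed
    \<comment> \<open>The differences sum to 0, so the omitted coordinate differs by no more than
      the others together; this is the factor 2 in \<open>far\<close>.\<close>
    have "(\<Sum>v\<in>V. l x v - l y v) = 0" using l(2) xy by (simp add: sum_subtractf)
    then have "\<bar>l x ?v - l y ?v\<bar> = \<bar>\<Sum>v\<in>?S - {?v}. l x v - l y v\<bar>"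
      using sumS[of "\<lambda>v. l x v - l y v"] zero by simp
    also have "\<dots> \<le> (\<Sum>v\<in>?S - {?v}. \<bar>l x v - l y v\<bar>)" by (rule sum_abs)
    finally have "(\<Sum>v\<in>V. \<bar>l x v - l y v\<bar>) \<le> 2 * (real n / real K)"
      using sumS[of "\<lambda>v. \<bar>l x v - l y v\<bar>"] zero rest by simp
    then show False using far[OF xy(1,2,4)] by simp
  qed
  then have "card A = card (g ` A)" by (simp add: card_image)
  also have "\<dots> \<le> card T" by (rule card_mono[OF finT gT])
  also have "\<dots> = (\<Sum>S\<in>{S \<in> Pow V. card S \<le> Suc n \<and> S \<noteq> {}}. card ((S - {u S}) \<rightarrow>\<^sub>E {..K}))"
    unfolding T_def using V by (intro card_SigmaI) (auto intro!: finite_PiE intro: finite_subset)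
  also have "\<dots> \<le> (\<Sum>S\<in>{S \<in> Pow V. card S \<le> Suc n \<and> S \<noteq> {}}. Suc K ^ n)"
  proof (rule sum_mono)
    fix S assume S: "S \<in> {S \<in> Pow V. card S \<le> Suc n \<and> S \<noteq> {}}"
    then have fS: "finite S" using V finite_subset by auto
    then have "card (S - {u S}) \<le> n" using S uS[of S] by auto
    then show "card ((S - {u S}) \<rightarrow>\<^sub>E {..K}) \<le> Suc K ^ n"
      using fS by (simp add: card_PiE power_increasing del: power_Suc)
  qed
  also have "\<dots> = card {S \<in> Pow V. card S \<le> Suc n \<and> S \<noteq> {}} * Suc K ^ n" by simp
  also have "\<dots> \<le> card (Pow V) * Suc K ^ n"
    using V by (intro mult_right_mono card_mono) auto
  finally show ?thesis using V by (simp add: card_Pow)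
qed

text \<open>Several bump functions may be attached to the same cover element. Adding those and
  normalizing produces barycentric coordinates indexed by the cover itself, so the number of nonzero
  coordinates is bounded by the multiplicity of the cover.\<close>

lemma partition_of_unity:
  fixes Z :: "'z topology"
  assumes Z: "compatible_metric Z \<rho>" "compact_space Z" and V: "finite_open_cover Z \<V>"
  obtains l :: "'z \<Rightarrow> 'z set \<Rightarrow> real" where "\<And>x V. 0 \<le> l x V"
    "\<And>x. x \<in> topspace Z \<Longrightarrow> sum (l x) \<V> = 1"
    "\<And>x V. x \<in> topspace Z \<Longrightarrow> V \<in> \<V> \<Longrightarrow> l x V \<noteq> 0 \<Longrightarrow> x \<in> V"
    "\<And>V. continuous_map Z euclideanreal (\<lambda>x. l x V)"
proof -
  have V': "\<And>U. U \<in> \<V> \<Longrightarrow> openin Z U" "topspace Z \<subseteq> \<Union>\<V>"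
    using V by (auto simp: finite_open_cover_def)
  show ?thesis
  proof (rule compact_metric_bumps[OF Z V'])
    fix J C W f assume J: "finite J" "0 < C" "\<And>j. j \<in> J \<Longrightarrow> W j \<in> \<V>"
      "\<And>j y. 0 \<le> f j y \<and> f j y \<le> (1::real)"
      "\<And>j y. j \<in> J \<Longrightarrow> y \<in> topspace Z \<Longrightarrow> 0 < f j y \<Longrightarrow> y \<in> W j"
      "\<And>y. y \<in> topspace Z \<Longrightarrow> \<exists>j\<in>J. f j y = 1"
      "\<And>j x y. j \<in> J \<Longrightarrow> x \<in> topspace Z \<Longrightarrow> y \<in> topspace Z \<Longrightarrow> \<bar>f j x - f j y\<bar> \<le> C * \<rho> x y"
    define s where "s = (\<lambda>x. \<Sum>j\<in>J. f j x)"
    define l where "l = (\<lambda>x V. (\<Sum>j\<in>{j \<in> J. W j = V}. f j x) / s x)"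
    have cont: "continuous_map Z euclideanreal (f j)" if "j \<in> J" for j
      using Lipschitz_continuous_map[OF Z(1)] J(7)[OF that] by blast
    have s: "0 < s x" if x: "x \<in> topspace Z" for x
    proof -
      obtain j where "j \<in> J" "f j x = 1" using J(6)[OF x] by blast
      then have "1 \<le> s x" unfolding s_def using member_le_sum[of j J "\<lambda>j. f j x"] J by auto
      then show ?thesis by simp
    qed
    show ?thesis
    proof (rule that[of l])
      show "0 \<le> l x V" for x V
        using J by (auto simp: l_def s_def intro!: divide_nonneg_nonneg sum_nonneg)
      show "sum (l x) \<V> = 1" if "x \<in> topspace Z" for x
      proof -
        have "(\<Sum>V\<in>\<V>. \<Sum>j\<in>{j \<in> J. W j = V}. f j x) = s x"
          unfolding s_def using J V by (intro sum.group) (auto simp: finite_open_cover_def)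
        then show ?thesis using s[OF that] by (simp add: l_def sum_divide_distrib[symmetric])
      qed
      show "x \<in> V" if x: "x \<in> topspace Z" and V: "V \<in> \<V>" "l x V \<noteq> 0" for x V
      proof -
        have "(\<Sum>j\<in>{j \<in> J. W j = V}. f j x) \<noteq> 0" using V by (auto simp: l_def)
        then obtain j where j: "j \<in> J" "W j = V" "f j x \<noteq> 0"
          by (metis (mono_tags, lifting) mem_Collect_eq sum.neutral)
        then show ?thesis using J(5)[of j x] J(4)[of j x] x by force
      qed
      show "continuous_map Z euclideanreal (\<lambda>x. l x V)" for V
        unfolding l_def s_def
      proof (intro continuous_map_real_divide continuous_map_sum)
        show "(\<Sum>j\<in>J. f j x) \<noteq> 0" if "x \<in> topspace Z" for x using s[OF that] by (simp add: s_def)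
      qed (use J cont in auto)
    qed
  qed
qed

section \<open>Pseudometrics pulled back from nerves\<close>

text \<open>By the triangle inequality the last clause amounts to joint continuity; it is stated at
  a single centre because \<open>compatible_metricI\<close> asks for exactly such neighbourhoods.
  Pseudometrics are used since a map to a nerve may fail to be injective, and so that the constant 0
  can start the construction.\<close>

definition continuous_pseudometric :: "'z topology \<Rightarrow> ('z \<Rightarrow> 'z \<Rightarrow> real) \<Rightarrow> bool" where
  "continuous_pseudometric Z d \<longleftrightarrow>
     (\<forall>x\<in>topspace Z. \<forall>y\<in>topspace Z. 0 \<le> d x y \<and> d x y = d y x) \<and> (\<forall>x\<in>topspace Z. d x x = 0) \<and>
     (\<forall>x\<in>topspace Z. \<forall>y\<in>topspace Z. \<forall>z\<in>topspace Z. d x z \<le> d x y + d y z) \<and>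
     (\<forall>x\<in>topspace Z. \<forall>r>0. \<exists>W. openin Z W \<and> x \<in> W \<and> (\<forall>y\<in>W. d x y < r))"

text \<open>Equivalent to covering dimension at most \<open>n\<close>, phrased without extended
  reals.\<close>

definition refinable_to_order :: "'z topology \<Rightarrow> nat \<Rightarrow> bool" where
  "refinable_to_order Z n \<longleftrightarrow> (\<forall>\<U>. finite_open_cover Z \<U> \<longrightarrow>
     (\<exists>\<V>. finite_open_cover Z \<V> \<and> cover_refines \<V> \<U> \<and> (\<forall>y\<in>topspace Z. card {V \<in> \<V>. y \<in> V} \<le> Suc n)))"

text \<open>Balls of half the prescribed sizes bound the diameters of the pieces, and refining does
  not enlarge them. The empty set is removed because a point is later chosen in every
  element.\<close>

lemma fine_cover:
  assumes Z: "compatible_metric Z \<rho>" "compact_space Z" and d: "continuous_pseudometric Z d"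
    and dim: "refinable_to_order Z n"
    and s: "0 < s" and \<kappa>: "0 < \<kappa>"
  obtains \<V> where "finite_open_cover Z \<V>" "{} \<notin> \<V>"
    "\<And>y. y \<in> topspace Z \<Longrightarrow> card {V \<in> \<V>. y \<in> V} \<le> Suc n"
    "\<And>V x y. V \<in> \<V> \<Longrightarrow> x \<in> V \<Longrightarrow> y \<in> V \<Longrightarrow> \<rho> x y < \<kappa> \<and> d x y \<le> s"
proof -
  interpret Metric_space "topspace Z" \<rho> using compatible_metricD[OF Z(1)] by auto
  have "\<forall>x\<in>topspace Z. \<exists>W. openin Z W \<and> x \<in> W \<and> (\<forall>y\<in>W. d x y < s / 2)"
    using d s unfolding continuous_pseudometric_def by (metis half_gt_zero)
  then obtain W where W: "\<And>x. x \<in> topspace Z \<Longrightarrow> openin Z (W x) \<and> x \<in> W x \<and> (\<forall>y\<in>W x. d x y < s / 2)" by metis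
  define B where "B = (\<lambda>x. W x \<inter> {y \<in> topspace Z. \<rho> x y < \<kappa> / 2})"
  have opB: "openin Z (B x)" if "x \<in> topspace Z" for x
    unfolding B_def using W[OF that] by (intro openin_Int compatible_metric_openin_ball[OF Z(1) that]) simp
  have "topspace Z \<subseteq> \<Union>(B ` topspace Z)" using W \<kappa> by (fastforce simp: B_def)
  moreover have "\<forall>U\<in>B ` topspace Z. openin Z U" using opB by auto
  ultimately obtain \<F> where F: "finite \<F>" "\<F> \<subseteq> B ` topspace Z" "topspace Z \<subseteq> \<Union>\<F>"
    using Z(2) unfolding compact_space_alt by meson
  have opF: "openin Z U" if "U \<in> \<F>" for U using F(2) opB that by auto
  have "\<Union>\<F> = topspace Z" using F(3) openin_subset[OF opF] by blast
  then have "finite_open_cover Z \<F>" using F(1) opF by (simp add: finite_open_cover_def)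
  then obtain \<V> where V: "finite_open_cover Z \<V>" "cover_refines \<V> \<F>" "\<forall>y\<in>topspace Z. card {V \<in> \<V>. y \<in> V} \<le> Suc n"
    using dim unfolding refinable_to_order_def by blast
  show ?thesis
  proof (rule that[of "\<V> - {{}}"])
    show "finite_open_cover Z (\<V> - {{}})" using V(1) by (auto simp: finite_open_cover_def)
    show "card {V \<in> \<V> - {{}}. y \<in> V} \<le> Suc n" if "y \<in> topspace Z" for y
    proof -
      have "{V \<in> \<V> - {{}}. y \<in> V} = {V \<in> \<V>. y \<in> V}" by auto
      then show ?thesis using V(3) that by simp
    qed
    show "\<rho> x y < \<kappa> \<and> d x y \<le> s" if xy: "V \<in> \<V> - {{}}" "x \<in> V" "y \<in> V" for V x y
    proof -
      obtain c where c: "c \<in> topspace Z" "V \<subseteq> B c"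
        using V(2) F(2) xy(1) unfolding cover_refines_def by blast
      have in_Z: "x \<in> topspace Z" "y \<in> topspace Z" using c xy opB[OF c(1)] openin_subset by blast+
      have "\<rho> c x < \<kappa> / 2" "\<rho> c y < \<kappa> / 2" "d c x < s / 2" "d c y < s / 2"
        using c xy W[OF c(1)] by (auto simp: B_def)
      moreover have "\<rho> x y \<le> \<rho> c x + \<rho> c y" using triangle'' in_Z c by blast
      moreover have "d x y \<le> d x c + d c y" "d x c = d c x"
        using d in_Z c(1) unfolding continuous_pseudometric_def by blast+
      ultimately show ?thesis by linarith
    qed
  qed auto
qed

text \<open>The pseudometric is pulled back from the nerve of a fine cover: the first summand of \<open>d'\<close> is the
  Kuratowski distance with respect to the points \<open>z V\<close>, the second separates points whose sets of
  cover elements are disjoint.\<close>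

lemma pseudometric_approximation:
  fixes Z :: "'z topology"
  assumes Z: "compatible_metric Z \<rho>" "compact_space Z" and ne: "topspace Z \<noteq> {}"
    and d: "continuous_pseudometric Z d"
    and dim: "refinable_to_order Z n"
    and \<tau>: "0 < \<tau>" and \<kappa>: "0 < \<kappa>"
  obtains d' t K where "continuous_pseudometric Z d'"
    "\<And>x y. x \<in> topspace Z \<Longrightarrow> y \<in> topspace Z \<Longrightarrow> \<bar>d' x y - d x y\<bar> \<le> \<tau>" "0 < t"
    "\<And>x y. x \<in> topspace Z \<Longrightarrow> y \<in> topspace Z \<Longrightarrow> \<kappa> \<le> \<rho> x y \<Longrightarrow> t \<le> d' x y"
    "1 \<le> K" "\<And>A \<eta>. A \<subseteq> topspace Z \<Longrightarrow> 0 < \<eta> \<Longrightarrow> \<eta> \<le> 1 \<Longrightarrow> metric_separated d' \<eta> A \<Longrightarrow>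
      real (card A) \<le> K * (1 / \<eta>) ^ n"
proof -
  have d0: "0 \<le> d x y" and dsym: "d x y = d y x" if "x \<in> topspace Z" "y \<in> topspace Z" for x y
    using d that unfolding continuous_pseudometric_def by blast+
  have dtri: "d x z \<le> d x y + d y z" if "x \<in> topspace Z" "y \<in> topspace Z" "z \<in> topspace Z" for x y z
    using d that unfolding continuous_pseudometric_def by blast
  \<comment> \<open>The Kuratowski part will lie between \<open>d - 4 * s\<close> and
    \<open>d + 2 * s\<close>, and the second summand adds at most \<open>\<tau> / 2\<close>; both
    errors stay within \<open>\<tau>\<close>.\<close>
  define s where "s = \<tau> / 8"
  have s: "0 < s" using \<tau> by (simp add: s_def)
  obtain \<V> where V: "finite_open_cover Z \<V>" "{} \<notin> \<V>"
    "\<And>y. y \<in> topspace Z \<Longrightarrow> card {V \<in> \<V>. y \<in> V} \<le> Suc n"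
    "\<And>V x y. V \<in> \<V> \<Longrightarrow> x \<in> V \<Longrightarrow> y \<in> V \<Longrightarrow> \<rho> x y < \<kappa> \<and> d x y \<le> s"
  proof -
    show thesis by (rule fine_cover[OF Z d dim s \<kappa>]) (rule that)
  qed
  have finV: "finite \<V>" and VZ: "\<And>V. V \<in> \<V> \<Longrightarrow> V \<subseteq> topspace Z" and UV: "\<Union>\<V> = topspace Z"
    using V(1) openin_subset by (auto simp: finite_open_cover_def)
  have Vne: "\<V> \<noteq> {}" using ne UV by (metis Union_empty)
  define z where "z = (\<lambda>V :: 'z set. SOME x. x \<in> V)"
  have zV: "z V \<in> V" if "V \<in> \<V>" for V using that V(2) unfolding z_def by (metis ex_in_conv someI)
  have zZ: "z V \<in> topspace Z" if "V \<in> \<V>" for V using zV VZ that by blast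
  obtain l :: "'z \<Rightarrow> 'z set \<Rightarrow> real" where l: "\<And>x V. 0 \<le> l x V"
    "\<And>x. x \<in> topspace Z \<Longrightarrow> sum (l x) \<V> = 1"
    "\<And>x V. x \<in> topspace Z \<Longrightarrow> V \<in> \<V> \<Longrightarrow> l x V \<noteq> 0 \<Longrightarrow> x \<in> V"
    "\<And>V. continuous_map Z euclideanreal (\<lambda>x. l x V)"
  proof -
    show thesis by (rule partition_of_unity[OF Z V(1)]) (rule that)
  qed
  define E where "E = (\<lambda>x y. \<Sum>U\<in>\<V>. \<bar>l x U - l y U\<bar>)"
  \<comment> \<open>\<open>p V\<close> interpolates the distance to \<open>z V\<close> affinely over
    the nerve; as \<open>x\<close> lies within \<open>s\<close> of every \<open>z U\<close> with
    nonzero weight, the error is at most \<open>s\<close>.\<close>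
  define p where "p = (\<lambda>V x. \<Sum>U\<in>\<V>. l x U * d (z U) (z V))"
  define d1 where "d1 = (\<lambda>x y. Max ((\<lambda>V. \<bar>p V x - p V y\<bar>) ` \<V>))"
  define d' where "d' = (\<lambda>x y. d1 x y + \<tau> / 4 * E x y)"
  have d1_le: "d1 x y \<le> r \<longleftrightarrow> (\<forall>V\<in>\<V>. \<bar>p V x - p V y\<bar> \<le> r)" for x y r
    using finV Vne by (simp add: d1_def)
  have d1_up: "\<bar>p V x - p V y\<bar> \<le> d1 x y" if "V \<in> \<V>" for V x y using d1_le[of x y "d1 x y"] that by simp
  have d1_0: "0 \<le> d1 x y" for x y
  proof -
    obtain V where "V \<in> \<V>" using Vne by blast
    then show ?thesis using d1_up[of V x y] by simp
  qed
  have E0: "0 \<le> E x y" for x y by (simp add: E_def sum_nonneg)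
  have E2: "E x y \<le> 2" if "x \<in> topspace Z" "y \<in> topspace Z" for x y
  proof -
    have "E x y \<le> (\<Sum>U\<in>\<V>. l x U + l y U)"
      unfolding E_def
    proof (rule sum_mono)
      fix U show "\<bar>l x U - l y U\<bar> \<le> l x U + l y U" using l(1)[of x U] l(1)[of y U] by linarith
    qed
    also have "\<dots> = 2" using l(2) that by (simp add: sum.distrib)
    finally show ?thesis .
  qed
  have p_near: "\<bar>p V x - d x (z V)\<bar> \<le> s" if VV: "V \<in> \<V>" and x: "x \<in> topspace Z" for V x
  proof -
    have "p V x - d x (z V) = p V x - (\<Sum>U\<in>\<V>. l x U) * d x (z V)" using l(2)[OF x] by simp
    also have "\<dots> = (\<Sum>U\<in>\<V>. l x U * (d (z U) (z V) - d x (z V)))"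
      by (simp add: p_def sum_distrib_right sum_subtractf right_diff_distrib)
    finally have "\<bar>p V x - d x (z V)\<bar> \<le> (\<Sum>U\<in>\<V>. \<bar>l x U * (d (z U) (z V) - d x (z V))\<bar>)"
      by (metis sum_abs)
    also have "\<dots> \<le> (\<Sum>U\<in>\<V>. l x U * s)"
    proof (rule sum_mono)
      fix U assume U: "U \<in> \<V>"
      show "\<bar>l x U * (d (z U) (z V) - d x (z V))\<bar> \<le> l x U * s"
      proof (cases "l x U = 0")
        case False
        then have xU: "x \<in> U" using l(3)[OF x U] by blast
        have "d (z U) x \<le> s" using V(4)[OF U zV[OF U] xU] by blast
        moreover have "d (z U) (z V) \<le> d (z U) x + d x (z V)" "d x (z V) \<le> d x (z U) + d (z U) (z V)"
          using dtri x zZ U VV by auto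
        ultimately have "\<bar>d (z U) (z V) - d x (z V)\<bar> \<le> s" using dsym[OF x zZ[OF U]] by linarith
        then show ?thesis using l(1)[of x U] by (simp add: abs_mult mult_left_mono)
      qed simp
    qed
    also have "\<dots> = s" using l(2)[OF x] by (simp add: sum_distrib_right[symmetric])
    finally show ?thesis .
  qed
  have close: "\<bar>d' x y - d x y\<bar> \<le> \<tau>" if x: "x \<in> topspace Z" and y: "y \<in> topspace Z" for x y
  proof -
    have "d1 x y \<le> d x y + 2 * s"
      unfolding d1_le
    proof
      fix V assume V: "V \<in> \<V>"
      have "d x (z V) \<le> d x y + d y (z V)" "d y (z V) \<le> d y x + d x (z V)"
        using dtri x y zZ V by auto
      then show "\<bar>p V x - p V y\<bar> \<le> d x y + 2 * s"
        using p_near[OF V x] p_near[OF V y] dsym[OF x y] by linarith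
    qed
    moreover have "d x y - 4 * s \<le> d1 x y"
    proof -
      \<comment> \<open>Testing at a centre within \<open>s\<close> of \<open>y\<close> is enough to
        recover \<open>d x y\<close> from below.\<close>
      obtain V where V': "V \<in> \<V>" "y \<in> V" using UV y by blast
      have "d y (z V) \<le> s" using V(4)[OF V'(1) V'(2) zV[OF V'(1)]] by blast
      moreover have "d x y \<le> d x (z V) + d (z V) y" "d (z V) y = d y (z V)"
        using dtri dsym x y zZ[OF V'(1)] by blast+
      ultimately show ?thesis
        using p_near[OF V'(1) x] p_near[OF V'(1) y] d1_up[OF V'(1), of x y] by linarith
    qed
    moreover have "\<tau> / 4 * E x y \<le> \<tau> / 4 * 2" "0 \<le> \<tau> / 4 * E x y"
      using \<tau> E0 E2[OF x y] by (auto intro: mult_left_mono)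
    ultimately show ?thesis unfolding d'_def s_def using \<tau> by linarith
  qed
  let ?S = "\<Sum>U\<in>\<V>. \<Sum>V\<in>\<V>. d (z U) (z V)"
  define B where "B = ?S + \<tau> / 4"
  have B: "0 < B" unfolding B_def using \<tau> d0 zZ by (intro add_nonneg_pos sum_nonneg) auto
  \<comment> \<open>\<open>d'\<close> is Lipschitz in the \<open>l1\<close>-distance
    \<open>E\<close> of barycentric coordinates, so separation for \<open>d'\<close> is inherited by
    the points of the nerve.\<close>
  have d'_le: "d' x y \<le> B * E x y" for x y
  proof -
    have "d1 x y \<le> ?S * E x y"
      unfolding d1_le
    proof
      fix V assume V: "V \<in> \<V>"
      have "p V x - p V y = (\<Sum>U\<in>\<V>. (l x U - l y U) * d (z U) (z V))"
        by (simp add: p_def sum_subtractf left_diff_distrib)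
      then have "\<bar>p V x - p V y\<bar> \<le> (\<Sum>U\<in>\<V>. \<bar>(l x U - l y U) * d (z U) (z V)\<bar>)" by (metis sum_abs)
      also have "\<dots> \<le> (\<Sum>U\<in>\<V>. \<bar>l x U - l y U\<bar> * ?S)"
      proof (rule sum_mono)
        fix U assume U: "U \<in> \<V>"
        have "d (z U) (z V) \<le> (\<Sum>V\<in>\<V>. d (z U) (z V))"
          using V finV d0 zZ U by (intro member_le_sum) auto
        also have "\<dots> \<le> ?S"
          using U finV d0 zZ by (intro member_le_sum[of U \<V> "\<lambda>U. \<Sum>V\<in>\<V>. d (z U) (z V)"] sum_nonneg) auto
        finally show "\<bar>(l x U - l y U) * d (z U) (z V)\<bar> \<le> \<bar>l x U - l y U\<bar> * ?S"
          using d0 zZ U V by (simp add: abs_mult mult_left_mono)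
      qed
      also have "\<dots> = ?S * E x y"
        unfolding E_def by (simp only: sum_distrib_right[symmetric] mult.commute)
      finally show "\<bar>p V x - p V y\<bar> \<le> ?S * E x y" .
    qed
    then show ?thesis by (simp add: d'_def B_def distrib_right)
  qed
  have cpm: "continuous_pseudometric Z d'"
    unfolding continuous_pseudometric_def
  proof (intro conjI ballI allI impI)
    fix x y w
    show "0 \<le> d' x y" using d1_0[of x y] E0[of x y] \<tau> by (simp add: d'_def)
    show "d' x y = d' y x" by (simp add: d'_def d1_def E_def abs_minus_commute)
    show "d' x x = 0" using d'_le[of x x] d1_0[of x x] by (simp add: d'_def E_def)
    have "d1 x w \<le> d1 x y + d1 y w"
      unfolding d1_le
    proof
      fix V assume "V \<in> \<V>"
      then show "\<bar>p V x - p V w\<bar> \<le> d1 x y + d1 y w" using d1_up[of V x y] d1_up[of V y w] by linarith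
    qed
    moreover have "E x w \<le> E x y + E y w"
      unfolding E_def sum.distrib[symmetric] by (intro sum_mono) linarith
    then have "\<tau> / 4 * E x w \<le> \<tau> / 4 * (E x y + E y w)" using \<tau> by (intro mult_left_mono) auto
    ultimately show "d' x w \<le> d' x y + d' y w" by (simp add: d'_def distrib_left)
  next
    fix x and r :: real assume x: "x \<in> topspace Z" and r: "0 < r"
    have "continuous_map Z euclideanreal (\<lambda>y. E x y)"
      unfolding E_def using l(4) finV by (intro continuous_map_sum continuous_map_real_abs continuous_map_diff) auto
    then have "openin Z {y \<in> topspace Z. E x y \<in> {..<r / B}}"
      by (rule openin_continuous_map_preimage) simp
    moreover have "x \<in> {y \<in> topspace Z. E x y \<in> {..<r / B}}" using x r B by (simp add: E_def)
    moreover have "\<forall>y\<in>{y \<in> topspace Z. E x y \<in> {..<r / B}}. d' x y < r"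
    proof
      fix y assume "y \<in> {y \<in> topspace Z. E x y \<in> {..<r / B}}"
      then have "B * E x y < r" using B by (simp add: field_simps)
      then show "d' x y < r" using d'_le[of x y] by linarith
    qed
    ultimately show "\<exists>W. openin Z W \<and> x \<in> W \<and> (\<forall>y\<in>W. d' x y < r)" by blast
  qed
  have far: "\<tau> / 4 \<le> d' x y" if x: "x \<in> topspace Z" and y: "y \<in> topspace Z" and xy: "\<kappa> \<le> \<rho> x y" for x y
  proof -
    \<comment> \<open>Points at \<open>\<rho>\<close>-distance at least \<open>\<kappa>\<close>
      share no cover element, so their coordinates have disjoint supports and \<open>E\<close> is at
      least 1.\<close>
    have "l x U \<le> \<bar>l x U - l y U\<bar>" if U: "U \<in> \<V>" for U
    proof -
      have "l x U = 0 \<or> l y U = 0" using l(3)[OF x U] l(3)[OF y U] V(4)[OF U, of x y] xy by force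
      then show ?thesis using l(1)[of y U] l(1)[of x U] by auto
    qed
    then have "sum (l x) \<V> \<le> E x y" unfolding E_def by (rule sum_mono)
    then have "1 \<le> E x y" using l(2)[OF x] by simp
    then have "\<tau> / 4 * 1 \<le> \<tau> / 4 * E x y" using \<tau> by (intro mult_left_mono) auto
    then show ?thesis using d1_0[of x y] by (simp add: d'_def)
  qed
  define b where "b = 2 * (real n + 1) * B + 2"
  have b: "1 \<le> b" "0 < 2 * (real n + 1) * B" using B by (auto simp: b_def)
  show ?thesis
  proof (rule that[OF cpm close _ far, of "2 ^ card \<V> * b ^ n"])
    show "0 < \<tau> / 4" using \<tau> by simp
    have "1 * 1 \<le> (2::real) ^ card \<V> * b ^ n" using b by (intro mult_mono one_le_power) auto
    then show "1 \<le> 2 ^ card \<V> * b ^ n" by simp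
    fix A and \<eta> :: real assume A: "A \<subseteq> topspace Z" and \<eta>: "0 < \<eta>" "\<eta> \<le> 1" and sep: "metric_separated d' \<eta> A"
    \<comment> \<open>The factor \<open>n + 1\<close> in place of \<open>n\<close> gives the strict
      inequality \<open>2 * n / k < \<eta> / B\<close> that \<open>simplex_points_card_le\<close>
      requires; \<open>b\<close> above absorbs the rounding.\<close>
    define k where "k = nat \<lceil>2 * (real n + 1) * B / \<eta>\<rceil>"
    have k: "2 * (real n + 1) * B / \<eta> \<le> real k" "real k \<le> 2 * (real n + 1) * B / \<eta> + 1"
    proof -
      have "0 < 2 * (real n + 1) * B / \<eta>" using b \<eta> by simp
      then have "real k = real_of_int \<lceil>2 * (real n + 1) * B / \<eta>\<rceil>" by (simp add: k_def)
      then show "2 * (real n + 1) * B / \<eta> \<le> real k" "real k \<le> 2 * (real n + 1) * B / \<eta> + 1" by linarith+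
    qed
    have k0: "0 < real k" using k(1) divide_pos_pos[OF b(2) \<eta>(1)] by linarith
    have "card A \<le> 2 ^ card \<V> * Suc k ^ n"
    proof (rule simplex_points_card_le[OF finV])
      show "0 < k" using k0 by simp
      show "0 \<le> l x v" for x v by (rule l(1))
      show "sum (l x) \<V> = 1" if "x \<in> A" for x using l(2) A that by blast
      show "card {v \<in> \<V>. l x v \<noteq> 0} \<le> Suc n" if "x \<in> A" for x
      proof -
        have "x \<in> topspace Z" using A that by blast
        then have "card {v \<in> \<V>. l x v \<noteq> 0} \<le> card {V \<in> \<V>. x \<in> V}"
          using finV l(3) by (intro card_mono) auto
        then show ?thesis using V(3)[OF \<open>x \<in> topspace Z\<close>] by linarith
      qed
      show "2 * real n / real k < (\<Sum>v\<in>\<V>. \<bar>l x v - l y v\<bar>)" if xy: "x \<in> A" "y \<in> A" "x \<noteq> y" for x y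
      proof -
        have "\<eta> \<le> B * E x y" using sep xy d'_le[of x y] by (force simp: metric_separated_def)
        then have "\<eta> / B \<le> E x y" using B by (simp add: field_simps)
        moreover have "2 * real n / real k < \<eta> / B"
        proof -
          have "2 * (real n + 1) * B \<le> real k * \<eta>" using k(1) \<eta> by (simp add: field_simps)
          then have "2 * real n * B < real k * \<eta>" using B by (simp add: algebra_simps)
          then show ?thesis using k0 B by (simp add: field_simps)
        qed
        ultimately show ?thesis by (simp add: E_def)
      qed
    qed
    then have "real (card A) \<le> 2 ^ card \<V> * real (Suc k) ^ n"
      using of_nat_mono[of "card A" "2 ^ card \<V> * Suc k ^ n", where 'a = real] by simp
    also have "\<dots> \<le> 2 ^ card \<V> * (b / \<eta>) ^ n"
    proof (intro mult_left_mono power_mono)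
      have "2 \<le> 2 / \<eta>" using \<eta> by (simp add: field_simps)
      then show "real (Suc k) \<le> b / \<eta>" using k(2) by (simp add: b_def add_divide_distrib)
    qed auto
    finally show "real (card A) \<le> 2 ^ card \<V> * b ^ n * (1 / \<eta>) ^ n" by (simp add: power_divide)
  qed
qed

section \<open>Choice of scales and passage to a limit metric\<close>

text \<open>The surplus \<open>\<gamma> * ln (1 / \<eta>)\<close> outgrows every constant as
  \<open>\<eta>\<close> tends to 0. The factor 6 is a product: 2 because a perturbed metric is
  tested at scale \<open>2 * \<eta>\<close>, and 3 because the shift loses a factor 3 in the
  separation scale.\<close>

lemma log_scale_bound:
  fixes K \<gamma> :: real and n :: nat
  assumes K: "1 \<le> K" and \<gamma>: "0 < \<gamma>" and e: "0 < e"
  obtains \<eta> where "0 < \<eta>" "\<eta> < e" "6 * \<eta> < 1" "ln K + real n * ln (1 / \<eta>) \<le> (real n + \<gamma>) * ln (1 / (6 * \<eta>))"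
proof -
  define c where "c = (ln K + (real n + \<gamma>) * ln 6) / \<gamma>"
  define \<eta> where "\<eta> = min (min (e / 2) (1 / 7)) (exp (- c))"
  have \<eta>: "0 < \<eta>" "\<eta> < e" "6 * \<eta> < 1" "\<eta> \<le> exp (- c)" using e by (auto simp: \<eta>_def)
  have "ln \<eta> \<le> - c" using \<eta>(1,4) by (metis exp_gt_zero ln_exp ln_le_cancel_iff)
  then have "c * \<gamma> \<le> - ln \<eta> * \<gamma>" using \<gamma> by (intro mult_right_mono) auto
  moreover have "c * \<gamma> = ln K + (real n + \<gamma>) * ln 6" using \<gamma> by (simp add: c_def)
  ultimately have le: "ln K + (real n + \<gamma>) * ln 6 \<le> - ln \<eta> * \<gamma>" by simp
  have eqs: "ln (1 / \<eta>) = - ln \<eta>" "ln (1 / (6 * \<eta>)) = - ln 6 - ln \<eta>" using \<eta> by (auto simp: ln_div ln_mult)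
  have "ln K + real n * ln (1 / \<eta>) \<le> (real n + \<gamma>) * ln (1 / (6 * \<eta>))"
    unfolding eqs using le by (simp add: algebra_simps)
  then show ?thesis using that \<eta> by blast
qed

text \<open>The upper half of the Pontryagin--Schnirelmann theorem. Each \<open>d m\<close> of the sequence below has small
  separated sets at one scale, a property that survives uniform perturbations by at most \<open>\<tau> m\<close>.\<close>

lemma Pontryagin_Schnirelmann:
  fixes Z :: "'z topology"
  assumes Z: "metrizable_space Z" "compact_space Z" and ne: "topspace Z \<noteq> {}"
    and dim: "refinable_to_order Z n"
  obtains \<rho> where "compatible_metric Z \<rho>"
    "\<And>\<gamma> e. 0 < \<gamma> \<Longrightarrow> 0 < e \<Longrightarrow> \<exists>\<eta>. 0 < \<eta> \<and> \<eta> < e \<and> 3 * \<eta> < 1 \<and>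
       (\<forall>A\<subseteq>topspace Z. A \<noteq> {} \<longrightarrow> finite A \<longrightarrow> metric_separated \<rho> \<eta> A \<longrightarrow>
          ln (real (card A)) \<le> (real n + \<gamma>) * ln (1 / (3 * \<eta>)))"
proof -
  obtain \<rho>0 where \<rho>0: "compatible_metric Z \<rho>0" using metrizable_compatible_metric[OF Z(1)] by blast
  interpret M0: Metric_space "topspace Z" \<rho>0 using compatible_metricD[OF \<rho>0] by auto
  \<comment> \<open>One sequence serves as bound on the scale, as slack in the exponent and as
    threshold for separating points.\<close>
  define g where "g = (\<lambda>m. 1 / real (Suc m))"
  have g: "0 < g m" for m by (simp add: g_def)
  define small where "small = (\<lambda>m d''. \<exists>\<eta>. 0 < \<eta> \<and> \<eta> < g m \<and> 3 * \<eta> < 1 \<and>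
       (\<forall>A\<subseteq>topspace Z. A \<noteq> {} \<longrightarrow> finite A \<longrightarrow> metric_separated d'' \<eta> A \<longrightarrow>
          ln (real (card A)) \<le> (real n + g m) * ln (1 / (3 * \<eta>))))"
  define close where "close = (\<lambda>(d :: 'z \<Rightarrow> 'z \<Rightarrow> real) d' t. \<forall>x\<in>topspace Z. \<forall>y\<in>topspace Z. \<bar>d' x y - d x y\<bar> \<le> t)"
  \<comment> \<open>The conditions are imposed on every \<open>d''\<close> within
    \<open>\<tau>\<close> of \<open>d\<close>, whether or not it is a pseudometric, so that they can
    be applied to the limit directly.\<close>
  define P where "P = (\<lambda>m (d, \<tau> :: real). continuous_pseudometric Z d \<and> 0 < \<tau> \<and>
      (\<forall>d''. close d d'' \<tau> \<longrightarrow> small m d'' \<and>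
         (\<forall>x\<in>topspace Z. \<forall>y\<in>topspace Z. g m \<le> \<rho>0 x y \<longrightarrow> 0 < d'' x y)))"
  \<comment> \<open>Moves of at most half the current tolerance, with tolerances at least halving,
    keep all later terms within \<open>\<tau>\<close>.\<close>
  define Q where "Q = (\<lambda>(d, \<tau>) (d', \<tau>'). close d d' (\<tau> / 2) \<and> \<tau>' \<le> \<tau> / 2)"
  have step: "\<exists>d' \<tau>'. P m (d', \<tau>') \<and> close d d' (\<tau> / 2) \<and> \<tau>' \<le> \<tau> / 2"
    if d: "continuous_pseudometric Z d" and \<tau>: "0 < \<tau>" for d \<tau> m
  proof -
    have \<tau>2: "0 < \<tau> / 2" using \<tau> by simp
    show ?thesis
    proof (rule pseudometric_approximation[OF \<rho>0 Z(2) ne d dim \<tau>2 g[of m]])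
      fix d' t K assume d': "continuous_pseudometric Z d'"
        "\<And>x y. x \<in> topspace Z \<Longrightarrow> y \<in> topspace Z \<Longrightarrow> \<bar>d' x y - d x y\<bar> \<le> \<tau> / 2" "0 < t"
        "\<And>x y. x \<in> topspace Z \<Longrightarrow> y \<in> topspace Z \<Longrightarrow> g m \<le> \<rho>0 x y \<Longrightarrow> t \<le> d' x y"
        "1 \<le> K" "\<And>A \<eta>. A \<subseteq> topspace Z \<Longrightarrow> 0 < \<eta> \<Longrightarrow> \<eta> \<le> 1 \<Longrightarrow> metric_separated d' \<eta> A \<Longrightarrow>
          real (card A) \<le> K * (1 / \<eta>) ^ n"
      have g2: "0 < g m / 2" using g[of m] by simp
      obtain \<eta> where \<eta>: "0 < \<eta>" "\<eta> < g m / 2" "6 * \<eta> < 1"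
        "ln K + real n * ln (1 / \<eta>) \<le> (real n + g m) * ln (1 / (6 * \<eta>))"
        using log_scale_bound[OF d'(5) g[of m] g2] by blast
      \<comment> \<open>\<open>\<tau>' \<le> \<eta>\<close> turns
        \<open>2 * \<eta>\<close>-separation for \<open>d''\<close> into
        \<open>\<eta>\<close>-separation for \<open>d'\<close>, and
        \<open>\<tau>' \<le> t / 2\<close> keeps the distances of distant points positive.\<close>
      define \<tau>' where "\<tau>' = min (\<tau> / 2) (min \<eta> (t / 2))"
      have \<tau>': "0 < \<tau>'" "\<tau>' \<le> \<tau> / 2" "\<tau>' \<le> \<eta>" "\<tau>' \<le> t / 2" using \<tau> \<eta>(1) d'(3) by (auto simp: \<tau>'_def)
      have "small m d'' \<and> (\<forall>x\<in>topspace Z. \<forall>y\<in>topspace Z. g m \<le> \<rho>0 x y \<longrightarrow> 0 < d'' x y)"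
        if cl: "close d' d'' \<tau>'" for d''
      proof (intro conjI ballI impI)
        have cl': "\<bar>d'' x y - d' x y\<bar> \<le> \<tau>'" if "x \<in> topspace Z" "y \<in> topspace Z" for x y
          using cl that by (simp add: close_def)
        show "0 < d'' x y" if xy: "x \<in> topspace Z" "y \<in> topspace Z" "g m \<le> \<rho>0 x y" for x y
          using cl'[OF xy(1,2)] d'(4)[OF xy] \<tau>' d'(3) by linarith
        show "small m d''"
          unfolding small_def
        proof (intro exI[of _ "2 * \<eta>"] conjI allI impI)
          show "0 < 2 * \<eta>" "2 * \<eta> < g m" "3 * (2 * \<eta>) < 1" using \<eta> by auto
          fix A assume A: "A \<subseteq> topspace Z" "A \<noteq> {}" "finite A" "metric_separated d'' (2 * \<eta>) A"
          have "metric_separated d' \<eta> A"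
            unfolding metric_separated_def
          proof (intro ballI impI)
            fix x y assume xy: "x \<in> A" "y \<in> A" "x \<noteq> y"
            have "2 * \<eta> \<le> d'' x y" using A(4) xy by (simp add: metric_separated_def)
            moreover have "\<bar>d'' x y - d' x y\<bar> \<le> \<tau>'" using cl' A(1) xy by blast
            ultimately show "\<eta> \<le> d' x y" using \<tau>'(3) by linarith
          qed
          then have "real (card A) \<le> K * (1 / \<eta>) ^ n" using d'(6)[OF A(1) \<eta>(1)] \<eta>(3) by simp
          moreover have c0: "0 < real (card A)" using A by (simp add: card_gt_0_iff)
          ultimately have "ln (real (card A)) \<le> ln (K * (1 / \<eta>) ^ n)"
            by (subst ln_le_cancel_iff) (use d'(5) \<eta> in auto)
          also have "\<dots> = ln K + real n * ln (1 / \<eta>)"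
            using d'(5) \<eta>(1) by (subst ln_mult) (auto simp: ln_realpow)
          finally show "ln (real (card A)) \<le> (real n + g m) * ln (1 / (3 * (2 * \<eta>)))" using \<eta>(4) by simp
        qed
      qed
      then have "P m (d', \<tau>')" using d'(1) \<tau>'(1) by (simp add: P_def)
      moreover have "close d d' (\<tau> / 2)" using d'(2) by (simp add: close_def)
      ultimately show "\<exists>d' \<tau>'. P m (d', \<tau>') \<and> close d d' (\<tau> / 2) \<and> \<tau>' \<le> \<tau> / 2" using \<tau>'(2) by blast
    qed
  qed
  have zero: "continuous_pseudometric Z (\<lambda>x y. 0)"
    by (auto simp: continuous_pseudometric_def)
  have "\<exists>f. \<forall>m. P m (f m) \<and> Q (f m) (f (Suc m))"
  proof (rule dependent_nat_choice)
    show "\<exists>x. P 0 x" using step[OF zero, of 1 0] by auto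
    fix x m assume "P m x"
    then show "\<exists>y. P (Suc m) y \<and> Q x y"
      using step[of "fst x" "snd x" "Suc m"] by (cases x) (auto simp: P_def Q_def)
  qed
  then obtain f where f: "\<And>m. P m (f m)" "\<And>m. Q (f m) (f (Suc m))" by blast
  define d where "d = (\<lambda>m. fst (f m))"
  define \<tau> where "\<tau> = (\<lambda>m. snd (f m))"
  have dm: "continuous_pseudometric Z (d m)" "0 < \<tau> m"
    "\<And>d''. close (d m) d'' (\<tau> m) \<Longrightarrow> small m d''"
    "\<And>d'' x y. close (d m) d'' (\<tau> m) \<Longrightarrow> x \<in> topspace Z \<Longrightarrow> y \<in> topspace Z \<Longrightarrow> g m \<le> \<rho>0 x y \<Longrightarrow> 0 < d'' x y" for m
    using f(1)[of m] by (auto simp: P_def d_def \<tau>_def split_beta)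
  have dS: "close (d m) (d (Suc m)) (\<tau> m / 2)" "\<tau> (Suc m) \<le> \<tau> m / 2" for m
    using f(2)[of m] by (auto simp: Q_def d_def \<tau>_def split_beta)
  \<comment> \<open>Subtracting the remaining tolerance \<open>\<tau> (m + k)\<close> makes the
    induction close; dropping it afterwards gives the bound \<open>\<tau> m\<close>.\<close>
  have add: "\<bar>d (m + k) x y - d m x y\<bar> \<le> \<tau> m - \<tau> (m + k)" if xy: "x \<in> topspace Z" "y \<in> topspace Z" for m k x y
  proof (induction k)
    case (Suc k)
    have "\<bar>d (m + Suc k) x y - d (m + k) x y\<bar> \<le> \<tau> (m + k) / 2" using dS(1)[of "m + k"] xy by (simp add: close_def)
    moreover have "\<tau> (m + Suc k) \<le> \<tau> (m + k) / 2" using dS(2)[of "m + k"] by simp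
    ultimately show ?case using Suc by linarith
  qed simp
  have \<tau>_le: "\<tau> m \<le> \<tau> 0 * (1 / 2) ^ m" for m
  proof (induction m)
    case (Suc m) then show ?case using dS(2)[of m] by simp
  qed simp
  have \<tau>_lim: "\<tau> \<longlonglongrightarrow> 0"
  proof (rule tendsto_sandwich[of "\<lambda>_. 0" \<tau> _ "\<lambda>m. \<tau> 0 * (1 / 2) ^ m"])
    show "(\<lambda>m. \<tau> 0 * (1 / 2) ^ m) \<longlonglongrightarrow> 0" by (intro tendsto_mult_right_zero LIMSEQ_realpow_zero) auto
  qed (use \<tau>_le dm(2) in \<open>auto intro!: always_eventually less_imp_le\<close>)
  have near: "\<bar>d k x y - d m x y\<bar> \<le> \<tau> m" if xy: "x \<in> topspace Z" "y \<in> topspace Z" and "m \<le> k" for m k x y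
    using add[OF xy, of m "k - m"] dm(2)[of k] that(3) by simp
  define D where "D = (\<lambda>x y. if x \<in> topspace Z \<and> y \<in> topspace Z then lim (\<lambda>m. d m x y) else 0)"
  have lim: "(\<lambda>m. d m x y) \<longlonglongrightarrow> D x y" if xy: "x \<in> topspace Z" "y \<in> topspace Z" for x y
  proof -
    have "Cauchy (\<lambda>m. d m x y)"
    proof (rule metric_CauchyI)
      fix e :: real assume "0 < e"
      then have "\<forall>\<^sub>F m in sequentially. \<tau> m < e / 2" using \<tau>_lim by (intro order_tendstoD) auto
      then obtain M where M: "\<tau> M < e / 2" by (auto simp: eventually_sequentially)
      have "dist (d i x y) (d j x y) < e" if "M \<le> i" "M \<le> j" for i j
        using near[OF xy that(1)] near[OF xy that(2)] M by (simp add: dist_real_def)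
      then show "\<exists>M. \<forall>m\<ge>M. \<forall>n\<ge>M. dist (d m x y) (d n x y) < e" by blast
    qed
    then show ?thesis using xy by (simp add: D_def Cauchy_convergent convergent_LIMSEQ_iff[symmetric])
  qed
  have D_near: "close (d m) D (\<tau> m)" for m
    unfolding close_def
  proof (intro ballI)
    fix x y assume xy: "x \<in> topspace Z" "y \<in> topspace Z"
    have "(\<lambda>k. \<bar>d k x y - d m x y\<bar>) \<longlonglongrightarrow> \<bar>D x y - d m x y\<bar>" by (intro tendsto_intros lim xy)
    then show "\<bar>D x y - d m x y\<bar> \<le> \<tau> m"
      by (rule LIMSEQ_le_const2) (use near[OF xy] in blast)
  qed
  have dm0: "0 \<le> d m x y" "d m x y = d m y x" if "x \<in> topspace Z" "y \<in> topspace Z" for m x y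
    using dm(1)[of m] that unfolding continuous_pseudometric_def by blast+
  have dm1: "d m x x = 0" if "x \<in> topspace Z" for m x
    using dm(1)[of m] that unfolding continuous_pseudometric_def by blast
  have dm2: "d m x w \<le> d m x y + d m y w" if "x \<in> topspace Z" "y \<in> topspace Z" "w \<in> topspace Z" for m x y w
    using dm(1)[of m] that unfolding continuous_pseudometric_def by blast
  have Dm: "Metric_space (topspace Z) D"
  proof
    fix x y w
    show "0 \<le> D x y"
    proof (cases "x \<in> topspace Z \<and> y \<in> topspace Z")
      case True
      then show ?thesis using LIMSEQ_le_const[OF lim] dm0(1) by blast
    qed (auto simp: D_def)
    show "D x y = D y x" using dm0(2) by (auto simp: D_def)
    assume x: "x \<in> topspace Z" and y: "y \<in> topspace Z"
    show "D x y = 0 \<longleftrightarrow> x = y"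
    proof
      assume D0: "D x y = 0"
      show "x = y"
      proof (rule ccontr)
        assume "x \<noteq> y"
        then have "0 < \<rho>0 x y" using M0.mdist_pos_less x y by blast
        then obtain m where "g m < \<rho>0 x y"
          unfolding g_def using reals_Archimedean by (metis inverse_eq_divide)
        then show False using dm(4)[OF D_near x y, of m] D0 by simp
      qed
    next
      assume "x = y"
      then have "(\<lambda>m. d m x y) = (\<lambda>m. 0)" using dm1 y by auto
      then show "D x y = 0" using lim[OF x y] LIMSEQ_unique tendsto_const by metis
    qed
    assume w: "w \<in> topspace Z"
    show "D x w \<le> D x y + D y w"
      by (rule LIMSEQ_le[OF lim[OF x w] tendsto_add[OF lim[OF x y] lim[OF y w]]]) (use dm2[OF x y w] in blast)
  qed
  have D: "compatible_metric Z D"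
  proof (rule compatible_metricI[OF Dm Z(2)])
    fix x and r :: real assume x: "x \<in> topspace Z" and r: "0 < r"
    then have "\<forall>\<^sub>F m in sequentially. \<tau> m < r / 2" using \<tau>_lim by (intro order_tendstoD) auto
    then obtain m where m: "\<tau> m < r / 2" by (auto simp: eventually_sequentially)
    have "0 < r / 2" using r by simp
    then obtain W where W: "openin Z W" "x \<in> W" "\<forall>y\<in>W. d m x y < r / 2"
      using dm(1)[of m] x unfolding continuous_pseudometric_def by blast
    have "D x y < r" if y: "y \<in> W" for y
    proof -
      have "y \<in> topspace Z" using y W openin_subset by blast
      then have "\<bar>D x y - d m x y\<bar> \<le> \<tau> m" using D_near[of m] x by (simp add: close_def)
      moreover have "d m x y < r / 2" using W(3) y by blast
      ultimately show ?thesis using m by linarith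
    qed
    then show "\<exists>W. openin Z W \<and> x \<in> W \<and> (\<forall>y\<in>W. D x y < r)" using W by blast
  qed
  show ?thesis
  proof (rule that[OF D])
    fix \<gamma> e :: real assume "0 < \<gamma>" "0 < e"
    \<comment> \<open>Every index \<open>m\<close> supplies one good scale, so scales below any
      \<open>e\<close> and slacks below any \<open>\<gamma>\<close> occur.\<close>
    then obtain m where m: "g m < min \<gamma> e"
      unfolding g_def using reals_Archimedean[of "min \<gamma> e"] by (auto simp: inverse_eq_divide)
    obtain \<eta> where \<eta>: "0 < \<eta>" "\<eta> < g m" "3 * \<eta> < 1"
       "\<And>A. A \<subseteq> topspace Z \<Longrightarrow> A \<noteq> {} \<Longrightarrow> finite A \<Longrightarrow> metric_separated D \<eta> A \<Longrightarrow>
          ln (real (card A)) \<le> (real n + g m) * ln (1 / (3 * \<eta>))"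
      using dm(3)[OF D_near, of m] unfolding small_def by blast
    have "1 \<le> 1 / (3 * \<eta>)" using \<eta> by simp
    then have "0 \<le> ln (1 / (3 * \<eta>))" by (rule ln_ge_zero)
    then have "(real n + g m) * ln (1 / (3 * \<eta>)) \<le> (real n + \<gamma>) * ln (1 / (3 * \<eta>))"
      using m by (intro mult_right_mono) auto
    then have "ln (real (card A)) \<le> (real n + \<gamma>) * ln (1 / (3 * \<eta>))"
      if "A \<subseteq> topspace Z" "A \<noteq> {}" "finite A" "metric_separated D \<eta> A" for A
      using \<eta>(4)[OF that] by linarith
    then show "\<exists>\<eta>. 0 < \<eta> \<and> \<eta> < e \<and> 3 * \<eta> < 1 \<and>
       (\<forall>A\<subseteq>topspace Z. A \<noteq> {} \<longrightarrow> finite A \<longrightarrow> metric_separated D \<eta> A \<longrightarrow>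
          ln (real (card A)) \<le> (real n + \<gamma>) * ln (1 / (3 * \<eta>)))"
      using \<eta>(1-3) m by (intro exI[of _ \<eta>]) auto
  qed
qed

section \<open>Upper bound for the full shift\<close>

lemma sum_Pow_power_card:
  fixes y :: real
  assumes "finite A"
  shows "(\<Sum>S\<in>Pow A. y ^ card S) = (1 + y) ^ card A"
proof -
  have "(\<Prod>a\<in>A. y + 1) = (\<Sum>S\<in>Pow A. (\<Prod>a\<in>S. y) * (\<Prod>a\<in>A - S. 1))"
    using assms by (rule prod_add)
  then show ?thesis by (simp add: add.commute)
qed

text \<open>A Chernoff-type bound: on the small subsets \<open>(1 / y)\<close> to the power
  \<open>\<beta> * card A\<close>, times \<open>y ^ card S\<close>, is at least 1, and with this
  weight the sum over all subsets is evaluated by the binomial theorem. The rate is small if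
  \<open>y\<close> makes \<open>N * y\<close> small and then \<open>\<beta>\<close> makes
  \<open>\<beta> * ln (1 / y)\<close> small.\<close>

lemma small_subsets_sum_le:
  fixes \<beta> y :: real
  assumes A: "finite A" and y: "0 < y" "y \<le> 1" and \<beta>: "0 \<le> \<beta>"
  shows "(\<Sum>S\<in>{S \<in> Pow A. real (card S) \<le> \<beta> * real (card A)}. real N ^ card S)
    \<le> exp (real (card A) * (real N * y + \<beta> * ln (1 / y)))"
proof -
  let ?T = "{S \<in> Pow A. real (card S) \<le> \<beta> * real (card A)}"
  let ?c = "exp (real (card A) * (\<beta> * ln (1 / y)))"
  have c: "1 \<le> ?c * y ^ card S" if "S \<in> ?T" for S
  proof -
    have ly: "0 \<le> ln (1 / y)" using y by (intro ln_ge_zero) simp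
    have "1 = exp (real (card S) * ln (1 / y)) * y ^ card S"
      using y by (simp add: exp_of_nat_mult power_divide)
    also have "\<dots> \<le> exp (\<beta> * real (card A) * ln (1 / y)) * y ^ card S"
      using that ly y by (intro mult_right_mono) (auto intro: mult_right_mono)
    also have "\<beta> * real (card A) * ln (1 / y) = real (card A) * (\<beta> * ln (1 / y))" by simp
    finally show ?thesis .
  qed
  have "(\<Sum>S\<in>?T. real N ^ card S) \<le> (\<Sum>S\<in>?T. ?c * (real N * y) ^ card S)"
  proof (rule sum_mono)
    fix S assume "S \<in> ?T"
    from mult_left_mono[OF c[OF this], of "real N ^ card S"]
    show "real N ^ card S \<le> ?c * (real N * y) ^ card S" by (simp add: power_mult_distrib mult_ac)
  qed
  also have "\<dots> \<le> (\<Sum>S\<in>Pow A. ?c * (real N * y) ^ card S)"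
    using A y by (intro sum_mono2) auto
  also have "\<dots> = ?c * (1 + real N * y) ^ card A"
    using sum_Pow_power_card[OF A] by (simp add: sum_distrib_left[symmetric])
  also have "\<dots> \<le> ?c * exp (real N * y) ^ card A"
    using y by (intro mult_left_mono power_mono exp_ge_add_one_self) auto
  also have "\<dots> = exp (real (card A) * (real N * y + \<beta> * ln (1 / y)))"
    by (simp add: exp_of_nat_mult[symmetric] exp_add[symmetric] distrib_left add.commute)
  finally show ?thesis .
qed

lemma log_enat_sep_number_le:
  assumes "\<And>A. A \<subseteq> Y \<Longrightarrow> finite A \<Longrightarrow> metric_separated \<rho> e A \<Longrightarrow> real (card A) \<le> exp b"
  shows "log_enat (sep_number e Y \<rho>) \<le> ereal b"
proof -
  have "sep_number e Y \<rho> \<le> enat (nat \<lfloor>exp b\<rfloor>)"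
    unfolding sep_number_def
  proof (rule SUP_least)
    fix A assume "A \<in> {A. A \<subseteq> Y \<and> finite A \<and> metric_separated \<rho> e A}"
    then have "real (card A) \<le> exp b" using assms by blast
    then show "enat (card A) \<le> enat (nat \<lfloor>exp b\<rfloor>)" by (simp add: le_nat_floor)
  qed
  then obtain k where k: "sep_number e Y \<rho> = enat k" "k \<le> nat \<lfloor>exp b\<rfloor>" by (cases "sep_number e Y \<rho>") auto
  have "real k \<le> real (nat \<lfloor>exp b\<rfloor>)" using k(2) by (rule of_nat_mono)
  also have "\<dots> \<le> exp b" by (rule of_nat_floor) simp
  finally have kb: "real k \<le> exp b" .
  show ?thesis
  proof (cases "k = 0")
    case False
    then have "ln (real k) \<le> ln (exp b)" using kb by (subst ln_le_cancel_iff) auto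
    then show ?thesis using k False by (simp add: log_enat_def)
  qed (use k in \<open>simp add: log_enat_def\<close>)
qed

lemma compact_metric_net:
  assumes X: "compatible_metric X \<rho>" "compact_space X" and e: "0 < e"
  obtains P where "finite P" "P \<subseteq> topspace X" "\<And>x. x \<in> topspace X \<Longrightarrow> \<exists>p\<in>P. \<rho> x p < e"
proof -
  interpret Metric_space "topspace X" \<rho> using compatible_metricD[OF X(1)] by auto
  let ?B = "\<lambda>x. {y \<in> topspace X. \<rho> x y < e}"
  have "\<forall>U\<in>?B ` topspace X. openin X U" using compatible_metric_openin_ball[OF X(1)] by auto
  moreover have "topspace X \<subseteq> \<Union>(?B ` topspace X)" using e by fastforce
  ultimately obtain \<F> where F: "finite \<F>" "\<F> \<subseteq> ?B ` topspace X" "topspace X \<subseteq> \<Union>\<F>"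
    using X(2) unfolding compact_space_alt by meson
  obtain P where P: "P \<subseteq> topspace X" "finite P" "\<F> = ?B ` P"
    using finite_subset_image[OF F(1,2)] by blast
  show ?thesis
  proof (rule that[OF P(2,1)])
    fix x assume "x \<in> topspace X"
    then obtain p where "p \<in> P" "\<rho> p x < e" using F(3) P(3) by blast
    then show "\<exists>p\<in>P. \<rho> x p < e" using commute by metis
  qed
qed

definition shift_weight :: "('g, 'm) monoid_scheme \<Rightarrow> 'g \<Rightarrow> real" where
  "shift_weight G g = (1 / 2) ^ to_nat_on (carrier G) g"

lemma shift_weight_bounds: "0 < shift_weight G g \<and> shift_weight G g \<le> 1"
  by (simp add: shift_weight_def power_le_one)

lemma finite_shift_weight_ge:
  assumes "countable (carrier G)" "0 < e"
  shows "finite {g \<in> carrier G. e \<le> shift_weight G g}"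
proof -
  have "(\<lambda>k. (1 / 2 :: real) ^ k) \<longlonglongrightarrow> 0" by (rule LIMSEQ_realpow_zero) auto
  then have "\<forall>\<^sub>F k in sequentially. (1 / 2 :: real) ^ k < e" using assms(2) by (intro order_tendstoD) auto
  then obtain K where K: "\<And>k. K \<le> k \<Longrightarrow> (1 / 2 :: real) ^ k < e" by (auto simp: eventually_sequentially)
  have "to_nat_on (carrier G) ` {g \<in> carrier G. e \<le> shift_weight G g} \<subseteq> {..<K}"
    using K by (force simp: shift_weight_def not_le[symmetric])
  then have "finite (to_nat_on (carrier G) ` {g \<in> carrier G. e \<le> shift_weight G g})"
    using finite_subset by blast
  moreover have "inj_on (to_nat_on (carrier G)) {g \<in> carrier G. e \<le> shift_weight G g}"
    using inj_on_to_nat_on[OF assms(1)] by (rule inj_on_subset) auto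
  ultimately show ?thesis using finite_imageD by blast
qed

lemma shift_action_in_space:
  assumes "group G" "s \<in> carrier G" "x \<in> topspace (shift_space G Z)"
  shows "shift_action G s x \<in> topspace (shift_space G Z)"
proof -
  interpret group G by fact
  show ?thesis using assms by (auto simp: shift_space_def shift_action_def PiE_iff)
qed

text \<open>A point of the map space is determined up to \<open>3e\<close> by the cells of the identity coordinates of all
  \<open>\<phi> a\<close> together with the few \<open>a\<close> where \<open>\<phi>\<close> is far from equivariant and the cells of the full
  configurations \<open>\<phi> a\<close> there.\<close>

lemma shift_separated_card_le:
  fixes Z :: "'z topology" and G :: "('g, 'm) monoid_scheme" (structure)
  defines "X \<equiv> shift_space G Z" and "\<rho> \<equiv> \<lambda>\<rho>Z. sup_metric (carrier G) (shift_weight G) Z \<rho>Z"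
  assumes G: "group G" "countable (carrier G)" and Z: "compatible_metric Z \<rho>Z" "compact_space Z"
    and e: "0 < e" and P: "finite P" "P \<subseteq> topspace Z" "\<And>z. z \<in> topspace Z \<Longrightarrow> \<exists>p\<in>P. \<rho>Z z p < e"
    and \<theta>: "0 < \<theta>"
  obtains F \<delta> where "F \<in> nonempty_finite_subsets (carrier G)" "0 < \<delta>"
    "\<And>d \<sigma> A. 1 \<le> d \<Longrightarrow> (\<And>s. s \<in> carrier G \<Longrightarrow> \<sigma> s permutes {1..d}) \<Longrightarrow>
       A \<subseteq> Map_space X (shift_action G) (\<rho> \<rho>Z) F \<delta> d \<sigma> \<Longrightarrow> finite A \<Longrightarrow>
       metric_separated (rho_inf (\<rho> \<rho>Z) d) (3 * e) A \<Longrightarrow>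
       real (card A) \<le> real (card P) ^ d * exp (real d * \<theta>)"
proof -
  interpret group G by fact
  interpret MZ: Metric_space "topspace Z" \<rho>Z using compatible_metricD[OF Z(1)] by auto
  let ?w = "shift_weight G" and ?r = "\<rho> \<rho>Z"
  have rX: "compatible_metric X ?r"
    unfolding X_def shift_space_def \<rho>_def
    using compatible_sup_metric[OF Z shift_weight_bounds finite_shift_weight_ge[OF G(2)]] .
  have kX: "compact_space X" using Z(2) by (simp add: X_def shift_space_def compact_space_product_topology)
  interpret MX: Metric_space "topspace X" ?r using compatible_metricD[OF rX] by auto
  have tX: "topspace X = carrier G \<rightarrow>\<^sub>E topspace Z" by (simp add: X_def shift_space_def)
  have up: "?w g * \<rho>Z (u g) (v g) \<le> ?r u v" if "u \<in> topspace X" "v \<in> topspace X" "g \<in> carrier G" for u v g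
    unfolding \<rho>_def by (rule sup_metric_upper[OF Z shift_weight_bounds that[unfolded tX]])
  have le_iff: "?r u v \<le> b \<longleftrightarrow> (\<forall>g\<in>carrier G. ?w g * \<rho>Z (u g) (v g) \<le> b)"
    if "u \<in> topspace X" "v \<in> topspace X" "0 \<le> b" for u v b
    unfolding \<rho>_def by (rule sup_metric_le_iff[OF Z shift_weight_bounds that[unfolded tX]])
  obtain B where B: "0 < B" "\<And>x y. x \<in> topspace Z \<Longrightarrow> y \<in> topspace Z \<Longrightarrow> \<rho>Z x y \<le> B"
    using compact_metric_bounded[OF Z] by blast
  obtain PX where PX: "finite PX" "PX \<subseteq> topspace X" "\<And>x. x \<in> topspace X \<Longrightarrow> \<exists>p\<in>PX. ?r x p < e"
    using compact_metric_net[OF rX kX e] by metis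
  \<comment> \<open>The coordinates outside \<open>E\<close> contribute at most \<open>e\<close> to
    the distance of any two configurations.\<close>
  define E where "E = {g \<in> carrier G. e / B \<le> ?w g}"
  have finE: "finite E" unfolding E_def using e B by (intro finite_shift_weight_ge[OF G(2)]) simp
  \<comment> \<open>Acting by \<open>inv g\<close> moves coordinate \<open>g\<close> to the
    identity, so coordinate \<open>g\<close> of \<open>\<phi> a\<close> is nearly the identity
    coordinate of \<open>\<phi> (\<sigma> (inv g) a)\<close>. Adding \<open>\<one>\<close> keeps
    \<open>F\<close> nonempty.\<close>
  define F where "F = insert \<one> ((\<lambda>g. inv g) ` E)"
  have F: "F \<in> nonempty_finite_subsets (carrier G)"
    using finE by (auto simp: nonempty_finite_subsets_def F_def E_def)
  have FG: "F \<subseteq> carrier G" "finite F" "F \<noteq> {}" using F by (auto simp: nonempty_finite_subsets_def)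
  have cF: "0 < real (card F)" using FG by (simp add: card_gt_0_iff)
  \<comment> \<open>Division by the weight of \<open>\<one>\<close> turns an error
    \<open>\<kappa>\<close> in the product metric into an error \<open>e / 4\<close> in the identity
    coordinate.\<close>
  define \<kappa> where "\<kappa> = e / 4 * ?w \<one>"
  have \<kappa>: "0 < \<kappa>" using e shift_weight_bounds[of G] by (simp add: \<kappa>_def)
  define y where "y = min 1 (\<theta> / (2 * (real (card PX) + 1)))"
  have y: "0 < y" "y \<le> 1" using \<theta> by (auto simp: y_def)
  have Ny: "real (card PX) * y \<le> \<theta> / 2"
  proof -
    have "real (card PX) * y \<le> (real (card PX) + 1) * (\<theta> / (2 * (real (card PX) + 1)))"
      using y by (intro mult_mono) (auto simp: y_def)
    also have "\<dots> = \<theta> / 2" by (simp add: field_simps)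
    finally show ?thesis .
  qed
  define \<beta> where "\<beta> = \<theta> / (2 * (ln (1 / y) + 1))"
  have ly: "0 \<le> ln (1 / y)" using y by (intro ln_ge_zero) simp
  have \<beta>: "0 < \<beta>" using \<theta> ly by (simp add: \<beta>_def)
  have \<beta>y: "\<beta> * ln (1 / y) \<le> \<theta> / 2"
  proof -
    have "\<beta> * ln (1 / y) \<le> \<beta> * (ln (1 / y) + 1)" using \<beta> by (intro mult_left_mono) auto
    also have "\<dots> = \<theta> / 2" using ly by (simp add: \<beta>_def field_simps)
    finally show ?thesis .
  qed
  \<comment> \<open>By Chebyshev's inequality at most the fraction
    \<open>\<delta>\<^sup>2 / \<kappa>\<^sup>2\<close> of all \<open>a\<close> is bad for one
    \<open>s\<close>; this is \<open>\<beta> / card F\<close>, hence at most \<open>\<beta>\<close>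
    for all of \<open>F\<close> together.\<close>
  define \<delta> where "\<delta> = \<kappa> * sqrt (\<beta> / real (card F))"
  have \<delta>: "0 < \<delta>" using \<kappa> \<beta> cF by (simp add: \<delta>_def)
  have \<delta>2: "\<delta>\<^sup>2 = \<kappa>\<^sup>2 * (\<beta> / real (card F))" using \<beta> by (simp add: \<delta>_def power_mult_distrib)
  show ?thesis
  proof (rule that[OF F \<delta>])
    fix d :: nat and \<sigma> A
    assume d: "1 \<le> d" and \<sigma>: "\<And>s. s \<in> carrier G \<Longrightarrow> \<sigma> s permutes {1..d}"
      and A: "A \<subseteq> Map_space X (shift_action G) ?r F \<delta> d \<sigma>" and finA: "finite A"
      and sep: "metric_separated (rho_inf ?r d) (3 * e) A"
    have AM: "\<phi> \<in> {1..d} \<rightarrow>\<^sub>E topspace X" "\<And>s. s \<in> F \<Longrightarrow> rho_2 ?r d (\<phi> \<circ> \<sigma> s) (shift_action G s \<circ> \<phi>) \<le> \<delta>"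
      if "\<phi> \<in> A" for \<phi>
      using A that unfolding Map_space_def by blast+
    have \<phi>X: "\<phi> a \<in> topspace X" if "\<phi> \<in> A" "a \<in> {1..d}" for \<phi> a
      using AM(1)[OF that(1)] that(2) by (rule PiE_mem)
    have \<phi>Z: "\<phi> a g \<in> topspace Z" if "\<phi> \<in> A" "a \<in> {1..d}" "g \<in> carrier G" for \<phi> a g
      using \<phi>X[OF that(1,2)] that(3) by (auto simp: tX)
    have \<sigma>in: "\<sigma> s a \<in> {1..d}" if "s \<in> carrier G" "a \<in> {1..d}" for s a
      using permutes_in_image[OF \<sigma>[OF that(1)], of a] that by simp
    have \<alpha>X: "shift_action G s (\<phi> a) \<in> topspace X" if "\<phi> \<in> A" "a \<in> {1..d}" "s \<in> carrier G" for s a \<phi>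
      using shift_action_in_space[OF G(1) that(3)] \<phi>X[OF that(1,2)] by (simp add: X_def)
    define bad where "bad = (\<lambda>\<phi>. {a \<in> {1..d}. \<exists>s\<in>F. \<kappa> < ?r (\<phi> (\<sigma> s a)) (shift_action G s (\<phi> a))})"
    have bad: "real (card (bad \<phi>)) \<le> \<beta> * real d" if \<phi>: "\<phi> \<in> A" for \<phi>
    proof -
      define bs where "bs = (\<lambda>s. {a \<in> {1..d}. \<kappa> < ?r (\<phi> (\<sigma> s a)) (shift_action G s (\<phi> a))})"
      have "real (card (bs s)) \<le> \<beta> / real (card F) * real d" if s: "s \<in> F" for s
      proof -
        let ?f = "\<lambda>a. (?r (\<phi> (\<sigma> s a)) (shift_action G s (\<phi> a)))\<^sup>2"
        have "rho_2 ?r d (\<phi> \<circ> \<sigma> s) (shift_action G s \<circ> \<phi>) \<le> \<delta>" by (rule AM(2)[OF \<phi> s])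
        then have "sqrt ((\<Sum>a\<in>{1..d}. ?f a) / real d) \<le> \<delta>" by (simp add: rho_2_def)
        then have "(\<Sum>a\<in>{1..d}. ?f a) / real d \<le> \<delta>\<^sup>2" by (rule sqrt_le_D)
        then have "(\<Sum>a\<in>{1..d}. ?f a) \<le> \<delta>\<^sup>2 * real d" using d by (simp add: field_simps)
        moreover have "real (card (bs s)) * \<kappa>\<^sup>2 \<le> (\<Sum>a\<in>bs s. ?f a)"
          using \<kappa> by (intro sum_bounded_below) (auto simp: bs_def intro!: power_mono)
        moreover have "(\<Sum>a\<in>bs s. ?f a) \<le> (\<Sum>a\<in>{1..d}. ?f a)"
          by (intro sum_mono2) (auto simp: bs_def)
        ultimately have "real (card (bs s)) * \<kappa>\<^sup>2 \<le> \<beta> / real (card F) * real d * \<kappa>\<^sup>2"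
          unfolding \<delta>2 by (simp add: mult_ac)
        then show ?thesis using \<kappa> by (simp only: mult_le_cancel_right zero_less_power2)
      qed
      then have "(\<Sum>s\<in>F. real (card (bs s))) \<le> real (card F) * (\<beta> / real (card F) * real d)"
        by (rule sum_bounded_above)
      moreover have "bad \<phi> = (\<Union>s\<in>F. bs s)" by (auto simp: bad_def bs_def)
      then have "card (bad \<phi>) \<le> (\<Sum>s\<in>F. card (bs s))" using card_UN_le[OF FG(2)] by simp
      then have "real (card (bad \<phi>)) \<le> (\<Sum>s\<in>F. real (card (bs s)))"
        using of_nat_mono[of "card (bad \<phi>)" _, where 'a = real] by fastforce
      ultimately show ?thesis using cF by simp
    qed
    define cZ where "cZ = (\<lambda>z. SOME p. p \<in> P \<and> \<rho>Z z p < e)"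
    define cX where "cX = (\<lambda>x. SOME p. p \<in> PX \<and> ?r x p < e)"
    have cZ: "cZ z \<in> P \<and> \<rho>Z z (cZ z) < e" if "z \<in> topspace Z" for z
      unfolding cZ_def using P(3)[OF that] by (rule someI2_bex) blast
    have cX: "cX x \<in> PX \<and> ?r x (cX x) < e" if "x \<in> topspace X" for x
      unfolding cX_def using PX(3)[OF that] by (rule someI2_bex) blast
    \<comment> \<open>The full configuration is recorded only on the bad set. There are few such
      \<open>a\<close>, so this costs a factor of at most \<open>exp (d * \<theta>)\<close> however
      large \<open>PX\<close> is.\<close>
    define code where "code = (\<lambda>\<phi>. (restrict (\<lambda>a. cZ (\<phi> a \<one>)) {1..d}, bad \<phi>, restrict (\<lambda>a. cX (\<phi> a)) (bad \<phi>)))"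
    define S where "S = {S \<in> Pow {1..d}. real (card S) \<le> \<beta> * real (card {1..d})}"
    define T where "T = ({1..d} \<rightarrow>\<^sub>E P) \<times> (SIGMA S:S. S \<rightarrow>\<^sub>E PX)"
    have finS: "finite S" by (simp add: S_def)
    have finS': "finite R" if "R \<in> S" for R using that finite_subset by (auto simp: S_def)
    have finT: "finite T"
      unfolding T_def using P(1) PX(1) finS finS' by (intro finite_cartesian_product finite_SigmaI finite_PiE) auto
    have "code ` A \<subseteq> T"
    proof
      fix c assume "c \<in> code ` A"
      then obtain \<phi> where \<phi>: "\<phi> \<in> A" "c = code \<phi>" by blast
      have b: "bad \<phi> \<subseteq> {1..d}" by (auto simp: bad_def)
      have "restrict (\<lambda>a. cZ (\<phi> a \<one>)) {1..d} \<in> {1..d} \<rightarrow>\<^sub>E P"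
        using cZ \<phi>Z[OF \<phi>(1)] by auto
      moreover have "cX (\<phi> a) \<in> PX" if "a \<in> bad \<phi>" for a
        using cX[OF \<phi>X[OF \<phi>(1) subsetD[OF b that]]] by simp
      then have "restrict (\<lambda>a. cX (\<phi> a)) (bad \<phi>) \<in> bad \<phi> \<rightarrow>\<^sub>E PX" by (simp add: restrict_PiE_iff)
      moreover have "bad \<phi> \<in> S" using bad[OF \<phi>(1)] b by (simp add: S_def)
      ultimately show "c \<in> T" using \<phi> by (simp add: T_def code_def)
    qed
    moreover have "inj_on code A"
    proof (rule inj_onI, rule ccontr)
      fix \<phi> \<psi> assume h: "\<phi> \<in> A" "\<psi> \<in> A" "code \<phi> = code \<psi>" "\<phi> \<noteq> \<psi>"
      have c1: "cZ (\<phi> a \<one>) = cZ (\<psi> a \<one>)" if "a \<in> {1..d}" for a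
      proof -
        have "fst (code \<phi>) a = fst (code \<psi>) a" using h(3) by simp
        then show ?thesis using that by (simp add: code_def)
      qed
      have c2: "bad \<phi> = bad \<psi>" using h(3) by (simp add: code_def)
      have c3: "cX (\<phi> a) = cX (\<psi> a)" if "a \<in> bad \<phi>" for a
      proof -
        have "snd (snd (code \<phi>)) a = snd (snd (code \<psi>)) a" using h(3) by simp
        then show ?thesis using that c2 by (simp add: code_def)
      qed
      have "?r (\<phi> a) (\<psi> a) < 3 * e" if a: "a \<in> {1..d}" for a
      proof (cases "a \<in> bad \<phi>")
        case True
        note ca = cX[OF \<phi>X[OF h(1) a]] and cb = cX[OF \<phi>X[OF h(2) a]]
        have "?r (\<phi> a) (\<psi> a) \<le> ?r (\<phi> a) (cX (\<phi> a)) + ?r (\<psi> a) (cX (\<phi> a))"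
          using MX.triangle' \<phi>X h a ca PX(2) by blast
        then show ?thesis using ca cb c3[OF True] e by simp
      next
        case False
        \<comment> \<open>For \<open>g\<close> in \<open>E\<close> the errors are
          \<open>e / 4\<close> for each of two passages to the identity coordinate and
          \<open>2 * e\<close> for a common cell. Their sum \<open>5 / 2 * e\<close> is strictly
          below \<open>3 * e\<close>, as needed because separated points may lie at distance exactly
          \<open>3 * e\<close>.\<close>
        have "?w g * \<rho>Z (\<phi> a g) (\<psi> a g) \<le> 5 / 2 * e" if g: "g \<in> carrier G" for g
        proof (cases "g \<in> E")
          case True
          define s where "s = inv g"
          have s: "s \<in> F" "s \<in> carrier G" using True g by (auto simp: s_def F_def)
          let ?b = "\<sigma> s a"
          have b: "?b \<in> {1..d}" using \<sigma>in s a by blast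
          have val: "shift_action G s (\<omega> a) \<one> = \<omega> a g" for \<omega> :: "nat \<Rightarrow> 'g \<Rightarrow> 'z"
            using g by (simp add: shift_action_def s_def)
          have close: "\<rho>Z (\<omega> ?b \<one>) (\<omega> a g) \<le> e / 4" if \<omega>: "\<omega> \<in> A" "a \<notin> bad \<omega>" for \<omega>
          proof -
            have "?w \<one> * \<rho>Z (\<omega> ?b \<one>) (shift_action G s (\<omega> a) \<one>) \<le> ?r (\<omega> ?b) (shift_action G s (\<omega> a))"
              by (rule up[OF \<phi>X[OF \<omega>(1) b] \<alpha>X[OF \<omega>(1) a s(2)] one_closed])
            also have "\<dots> \<le> \<kappa>" using \<omega>(2) a s(1) by (auto simp: bad_def)
            finally show ?thesis using shift_weight_bounds[of G "\<one>"] unfolding val \<kappa>_def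
              by (simp add: mult.commute)
          qed
          have in1: "\<phi> ?b \<one> \<in> topspace Z" "\<psi> ?b \<one> \<in> topspace Z" "\<phi> a g \<in> topspace Z" "\<psi> a g \<in> topspace Z"
            using \<phi>Z h a b g by auto
          have "\<rho>Z (\<phi> ?b \<one>) (\<psi> ?b \<one>) \<le> \<rho>Z (\<phi> ?b \<one>) (cZ (\<phi> ?b \<one>)) + \<rho>Z (\<psi> ?b \<one>) (cZ (\<phi> ?b \<one>))"
            using MZ.triangle' in1 cZ[OF in1(1)] P(2) by blast
          also have "\<dots> \<le> 2 * e" using cZ[OF in1(1)] cZ[OF in1(2)] c1[OF b] by simp
          finally have mid: "\<rho>Z (\<phi> ?b \<one>) (\<psi> ?b \<one>) \<le> 2 * e" .
          have "\<rho>Z (\<phi> a g) (\<psi> a g) \<le> \<rho>Z (\<phi> ?b \<one>) (\<phi> a g) + \<rho>Z (\<phi> ?b \<one>) (\<psi> a g)"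
            using MZ.triangle'' in1 by blast
          moreover have "\<rho>Z (\<phi> ?b \<one>) (\<psi> a g) \<le> \<rho>Z (\<phi> ?b \<one>) (\<psi> ?b \<one>) + \<rho>Z (\<psi> ?b \<one>) (\<psi> a g)"
            using MZ.triangle in1 by blast
          ultimately have "\<rho>Z (\<phi> a g) (\<psi> a g) \<le> 5 / 2 * e"
            using mid close[OF h(1) False] close[OF h(2)] False c2 by simp
          moreover have "?w g * \<rho>Z (\<phi> a g) (\<psi> a g) \<le> 1 * \<rho>Z (\<phi> a g) (\<psi> a g)"
            using shift_weight_bounds[of G g] by (intro mult_right_mono) auto
          ultimately show ?thesis by simp
        next
          case False
          then have "?w g \<le> e / B" using g by (simp add: E_def)
          moreover have "\<rho>Z (\<phi> a g) (\<psi> a g) \<le> B" using B(2) \<phi>Z h a g by blast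
          ultimately have "?w g * \<rho>Z (\<phi> a g) (\<psi> a g) \<le> e / B * B"
            using e B shift_weight_bounds[of G g] by (intro mult_mono) auto
          then show ?thesis using B e by simp
        qed
        then have "?r (\<phi> a) (\<psi> a) \<le> 5 / 2 * e"
          using le_iff[OF \<phi>X[OF h(1) a] \<phi>X[OF h(2) a], of "5 / 2 * e"] e by simp
        then show ?thesis using e by simp
      qed
      then have "rho_inf ?r d \<phi> \<psi> < 3 * e" unfolding rho_inf_le_iff(2)[OF d] by blast
      moreover have "3 * e \<le> rho_inf ?r d \<phi> \<psi>" using sep h by (simp add: metric_separated_def)
      ultimately show False by simp
    qed
    ultimately have "card A \<le> card T" using card_inj_on_le finT by blast
    also have "card T = card P ^ d * (\<Sum>R\<in>S. card PX ^ card R)"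
    proof -
      have "card (SIGMA S:S. S \<rightarrow>\<^sub>E PX) = (\<Sum>R\<in>S. card (R \<rightarrow>\<^sub>E PX))"
        using finS finS' PX(1) by (intro card_SigmaI) (auto intro!: finite_PiE)
      also have "\<dots> = (\<Sum>R\<in>S. card PX ^ card R)" using finS' by (intro sum.cong) (auto simp: card_PiE)
      finally show ?thesis by (simp add: T_def card_cartesian_product card_PiE)
    qed
    finally have "real (card A) \<le> real (card P ^ d * (\<Sum>R\<in>S. card PX ^ card R))" by (rule of_nat_mono)
    also have "\<dots> = real (card P) ^ d * (\<Sum>R\<in>S. real (card PX) ^ card R)" by simp
    also have "\<dots> \<le> real (card P) ^ d * exp (real (card {1..d}) * (real (card PX) * y + \<beta> * ln (1 / y)))"
      unfolding S_def using y \<beta> by (intro mult_left_mono small_subsets_sum_le) auto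
    also have "\<dots> \<le> real (card P) ^ d * exp (real d * \<theta>)"
    proof (intro mult_left_mono)
      have "real d * (real (card PX) * y + \<beta> * ln (1 / y)) \<le> real d * \<theta>"
        using Ny \<beta>y by (intro mult_left_mono) auto
      then show "exp (real (card {1..d}) * (real (card PX) * y + \<beta> * ln (1 / y))) \<le> exp (real d * \<theta>)" by simp
    qed auto
    finally show "real (card A) \<le> real (card P) ^ d * exp (real d * \<theta>)" .
  qed
qed

section \<open>From counting to metric mean dimension\<close>

text \<open>The \<open>card P ^ d\<close> codes of identity coordinates give the rate
  \<open>ln (card P)\<close>; the recorded exceptions contribute \<open>\<theta>\<close>, which is
  arbitrary.\<close>

lemma h_sofic_shift_le:
  fixes Z :: "'z topology" and G :: "('g, 'm) monoid_scheme" (structure)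
  assumes G: "group G" "countable (carrier G)" and Z: "compatible_metric Z \<rho>Z" "compact_space Z"
    and \<sigma>: "\<And>i s. s \<in> carrier G \<Longrightarrow> \<sigma> i s permutes {1..d i}" and d: "filterlim d at_top sequentially"
    and e: "0 < e" and P: "finite P" "P \<noteq> {}" "P \<subseteq> topspace Z" "\<And>z. z \<in> topspace Z \<Longrightarrow> \<exists>p\<in>P. \<rho>Z z p < e"
  shows "h_sofic G d \<sigma> (shift_space G Z) (shift_action G) (3 * e) (sup_metric (carrier G) (shift_weight G) Z \<rho>Z)
    \<le> ereal (ln (real (card P)))"
proof (rule ereal_le_epsilon2)
  fix \<theta> :: real assume \<theta>: "0 < \<theta>"
  let ?X = "shift_space G Z" and ?r = "sup_metric (carrier G) (shift_weight G) Z \<rho>Z"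
  have cP: "0 < real (card P)" using P by (simp add: card_gt_0_iff)
  show "h_sofic G d \<sigma> ?X (shift_action G) (3 * e) ?r \<le> ereal (ln (real (card P))) + ereal \<theta>"
  proof (rule shift_separated_card_le[OF G Z e P(1,3,4) \<theta>], assumption)
    fix F \<delta> assume F: "F \<in> nonempty_finite_subsets (carrier G)" "0 < \<delta>"
      and card: "\<And>d \<sigma> A. 1 \<le> d \<Longrightarrow> (\<And>s. s \<in> carrier G \<Longrightarrow> \<sigma> s permutes {1..d}) \<Longrightarrow>
       A \<subseteq> Map_space ?X (shift_action G) ?r F \<delta> d \<sigma> \<Longrightarrow> finite A \<Longrightarrow>
       metric_separated (rho_inf ?r d) (3 * e) A \<Longrightarrow>
       real (card A) \<le> real (card P) ^ d * exp (real d * \<theta>)"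
    have "h_sofic G d \<sigma> ?X (shift_action G) (3 * e) ?r \<le> h_sofic_local d \<sigma> ?X (shift_action G) (3 * e) ?r F \<delta>"
      unfolding h_sofic_def using F by (intro INF_lower2[of F] INF_lower2[of \<delta>]) auto
    also have "\<dots> \<le> ereal (ln (real (card P)) + \<theta>)"
    proof -
      let ?l = "\<lambda>i. log_enat (sep_number (3 * e) (Map_space ?X (shift_action G) ?r F \<delta> (d i) (\<sigma> i)) (rho_inf ?r (d i)))"
      have "limsup (\<lambda>i. ?l i / ereal (real (d i))) \<le> ereal (ln (real (card P)) + \<theta>)"
      proof (rule Limsup_bounded)
        have "\<forall>\<^sub>F i in sequentially. 1 \<le> d i" using d by (simp add: filterlim_at_top)
        then show "\<forall>\<^sub>F i in sequentially. ?l i / ereal (real (d i)) \<le> ereal (ln (real (card P)) + \<theta>)"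
        proof (rule eventually_mono)
          fix i assume di: "1 \<le> d i"
          have "?l i \<le> ereal (real (d i) * (ln (real (card P)) + \<theta>))"
          proof (rule log_enat_sep_number_le)
            fix A assume "A \<subseteq> Map_space ?X (shift_action G) ?r F \<delta> (d i) (\<sigma> i)" "finite A"
              "metric_separated (rho_inf ?r (d i)) (3 * e) A"
            then have "real (card A) \<le> real (card P) ^ d i * exp (real (d i) * \<theta>)" using card[where d = "d i" and \<sigma> = "\<sigma> i" and A = A, OF di \<sigma>] by blast
            also have "\<dots> = exp (real (d i) * (ln (real (card P)) + \<theta>))"
              using cP by (simp add: distrib_left exp_add exp_of_nat_mult)
            finally show "real (card A) \<le> exp (real (d i) * (ln (real (card P)) + \<theta>))" .
          qed
          then have "?l i / ereal (real (d i)) \<le> ereal (real (d i) * (ln (real (card P)) + \<theta>)) / ereal (real (d i))"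
            using di by (intro ereal_divide_right_mono) auto
          then show "?l i / ereal (real (d i)) \<le> ereal (ln (real (card P)) + \<theta>)" using di by simp
        qed
      qed
      then show ?thesis by (simp add: h_sofic_local_def)
    qed
    finally show ?thesis by simp
  qed
qed

text \<open>As \<open>mdim_sofic_metric_wrt\<close> is a lower limit, a value above
  \<open>n + \<gamma>\<close> would force large quotients at all small scales; a single good scale
  \<open>3 * \<eta>\<close> of the metric from \<open>Pontryagin_Schnirelmann\<close> contradicts
  this.\<close>

lemma mdim_sofic_metric_shift_le:
  fixes Z :: "'z topology" and G :: "('g, 'm) monoid_scheme" (structure)
  assumes G: "group G" "countable (carrier G)" and Z: "metrizable_space Z" "compact_space Z" "topspace Z \<noteq> {}"
    and dim: "refinable_to_order Z n"
    and \<sigma>: "\<And>i s. s \<in> carrier G \<Longrightarrow> \<sigma> i s permutes {1..d i}" and d: "filterlim d at_top sequentially"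
  shows "mdim_sofic_metric G d \<sigma> (shift_space G Z) (shift_action G) \<le> ereal (real n)"
proof (rule Pontryagin_Schnirelmann[OF Z dim])
  fix \<rho>Z assume rZ: "compatible_metric Z \<rho>Z" and small:
    "\<And>\<gamma> e. 0 < \<gamma> \<Longrightarrow> 0 < e \<Longrightarrow> \<exists>\<eta>. 0 < \<eta> \<and> \<eta> < e \<and> 3 * \<eta> < 1 \<and>
       (\<forall>A\<subseteq>topspace Z. A \<noteq> {} \<longrightarrow> finite A \<longrightarrow> metric_separated \<rho>Z \<eta> A \<longrightarrow>
          ln (real (card A)) \<le> (real n + \<gamma>) * ln (1 / (3 * \<eta>)))"
  interpret Metric_space "topspace Z" \<rho>Z using compatible_metricD[OF rZ] by auto
  let ?X = "shift_space G Z" and ?r = "sup_metric (carrier G) (shift_weight G) Z \<rho>Z"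
  let ?h = "\<lambda>e. h_sofic G d \<sigma> ?X (shift_action G) e ?r"
  have rX: "compatible_metric ?X ?r"
    unfolding shift_space_def
    using compatible_sup_metric[OF rZ Z(2) shift_weight_bounds finite_shift_weight_ge[OF G(2)]] .
  have "mdim_sofic_metric_wrt G d \<sigma> ?X (shift_action G) ?r \<le> ereal (real n)"
  proof (rule ereal_le_epsilon2, rule ccontr)
    fix \<gamma> :: real assume \<gamma>: "0 < \<gamma>"
    assume "\<not> mdim_sofic_metric_wrt G d \<sigma> ?X (shift_action G) ?r \<le> ereal (real n) + ereal \<gamma>"
    then have "ereal (real n + \<gamma>) < Liminf (at_right 0) (\<lambda>e. ?h e / ereal \<bar>ln e\<bar>)"
      by (simp add: mdim_sofic_metric_wrt_def not_le)
    then have "\<forall>\<^sub>F e in at_right 0. ereal (real n + \<gamma>) < ?h e / ereal \<bar>ln e\<bar>" by (rule less_LiminfD)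
    then obtain b where b: "0 < b" "\<And>e. 0 < e \<Longrightarrow> e < b \<Longrightarrow> ereal (real n + \<gamma>) < ?h e / ereal \<bar>ln e\<bar>"
      unfolding eventually_at_right_field by blast
    have "0 < b / 3" using b by simp
    then obtain \<eta> where \<eta>: "0 < \<eta>" "\<eta> < b / 3" "3 * \<eta> < 1"
      "\<And>A. A \<subseteq> topspace Z \<Longrightarrow> A \<noteq> {} \<Longrightarrow> finite A \<Longrightarrow> metric_separated \<rho>Z \<eta> A \<Longrightarrow>
          ln (real (card A)) \<le> (real n + \<gamma>) * ln (1 / (3 * \<eta>))"
      using small[OF \<gamma>] by blast
    have l3: "0 < ln (1 / (3 * \<eta>))" "\<bar>ln (3 * \<eta>)\<bar> = ln (1 / (3 * \<eta>))"
    proof -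
      have "ln (3 * \<eta>) < 0" using \<eta> by simp
      moreover have "ln (1 / (3 * \<eta>)) = - ln (3 * \<eta>)" using \<eta> by (simp add: ln_div)
      ultimately show "0 < ln (1 / (3 * \<eta>))" "\<bar>ln (3 * \<eta>)\<bar> = ln (1 / (3 * \<eta>))" by auto
    qed
    have "sep_number \<eta> (topspace Z) \<rho>Z \<le> enat (nat \<lfloor>exp ((real n + \<gamma>) * ln (1 / (3 * \<eta>)))\<rfloor>)"
      unfolding sep_number_def
    proof (rule SUP_least)
      fix A assume A: "A \<in> {A. A \<subseteq> topspace Z \<and> finite A \<and> metric_separated \<rho>Z \<eta> A}"
      have "real (card A) \<le> exp ((real n + \<gamma>) * ln (1 / (3 * \<eta>)))"
      proof (cases "A = {}")
        case False
        then have "ln (real (card A)) \<le> (real n + \<gamma>) * ln (1 / (3 * \<eta>))" using A \<eta>(4) by blast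
        then have "exp (ln (real (card A))) \<le> exp ((real n + \<gamma>) * ln (1 / (3 * \<eta>)))" by (simp only: exp_le_cancel_iff)
        moreover have "0 < real (card A)" using A False by (simp add: card_gt_0_iff)
        ultimately show ?thesis by (simp only: exp_ln)
      qed simp
      then show "enat (card A) \<le> enat (nat \<lfloor>exp ((real n + \<gamma>) * ln (1 / (3 * \<eta>)))\<rfloor>)" by (simp add: le_nat_floor)
    qed
    \<comment> \<open>A maximal \<open>\<eta>\<close>-separated set plays both roles: it is a net,
      as \<open>h_sofic_shift_le\<close> requires, and its size is bounded by the choice of
      \<open>\<eta>\<close>.\<close>
    then obtain P where P: "P \<subseteq> topspace Z" "finite P" "metric_separated \<rho>Z \<eta> P" "\<And>y. y \<in> topspace Z \<Longrightarrow> \<exists>p\<in>P. \<rho>Z y p < \<eta>"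
      using sep_number_net[of \<eta> "topspace Z" \<rho>Z] \<eta>(1) commute mdist_zero by metis
    have Pne: "P \<noteq> {}" using Z(3) P(4) by blast
    have "?h (3 * \<eta>) \<le> ereal (ln (real (card P)))"
      by (rule h_sofic_shift_le[OF G rZ Z(2) \<sigma> d \<eta>(1) P(2) Pne P(1) P(4)])
    also have "\<dots> \<le> ereal ((real n + \<gamma>) * ln (1 / (3 * \<eta>)))" using \<eta>(4)[OF P(1) Pne P(2,3)] by simp
    finally have "?h (3 * \<eta>) / ereal \<bar>ln (3 * \<eta>)\<bar> \<le> ereal ((real n + \<gamma>) * ln (1 / (3 * \<eta>))) / ereal \<bar>ln (3 * \<eta>)\<bar>"
      using l3 by (intro ereal_divide_right_mono) auto
    also have "\<dots> = ereal (real n + \<gamma>)" using l3 by simp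
    finally show False using b(2)[of "3 * \<eta>"] \<eta> by simp
  qed
  then show ?thesis unfolding mdim_sofic_metric_def using rX by (intro INF_lower2[of ?r]) auto
qed

text \<open>Without points the map spaces are empty as soon as \<open>d i \<ge> 1\<close>, and the
  default value \<open>-\<infinity>\<close> survives all infima and limits, matching the dimension
  of the empty space.\<close>

lemma mdim_sofic_metric_empty:
  assumes X: "compatible_metric X \<rho>" "topspace X = {}" and G: "group G"
    and d: "filterlim d at_top sequentially"
  shows "mdim_sofic_metric G d \<sigma> X \<alpha> = -\<infinity>"
proof -
  interpret group G by fact
  have "h_sofic G d \<sigma> X \<alpha> e \<rho> = -\<infinity>" for e
  proof -
    have "\<forall>\<^sub>F i in sequentially. 1 \<le> d i" using d by (simp add: filterlim_at_top)
    then have "\<forall>\<^sub>F i in sequentially. Map_space X \<alpha> \<rho> {\<one>\<^bsub>G\<^esub>} 1 (d i) (\<sigma> i) = {}"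
      by (rule eventually_mono) (auto simp: Map_space_def X(2) PiE_eq_empty_iff)
    then have "h_sofic_local d \<sigma> X \<alpha> e \<rho> {\<one>\<^bsub>G\<^esub>} 1 = -\<infinity>" by (simp add: h_sofic_local_def)
    moreover have "h_sofic G d \<sigma> X \<alpha> e \<rho> \<le> h_sofic_local d \<sigma> X \<alpha> e \<rho> {\<one>\<^bsub>G\<^esub>} 1"
      unfolding h_sofic_def
      by (intro INF_lower2[of "{\<one>\<^bsub>G\<^esub>}"] INF_lower2[of 1]) (auto simp: nonempty_finite_subsets_def)
    ultimately show ?thesis by simp
  qed
  then have "mdim_sofic_metric_wrt G d \<sigma> X \<alpha> \<rho> = Liminf (at_right 0) (\<lambda>e. -\<infinity> / ereal \<bar>ln e\<bar>)"
    by (simp add: mdim_sofic_metric_wrt_def)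
  also have "\<dots> = Liminf (at_right 0) (\<lambda>e :: real. -\<infinity>)"
  proof (rule Liminf_eq)
    have "\<forall>\<^sub>F e in at_right 0. e \<in> {0<..<1::real}" by (rule eventually_at_right_real) simp
    then show "\<forall>\<^sub>F e in at_right 0. -\<infinity> / ereal \<bar>ln e\<bar> = -\<infinity>"
    proof (rule eventually_mono)
      fix e :: real assume "e \<in> {0<..<1}"
      then have "ln e < 0" by simp
      then show "-\<infinity> / ereal \<bar>ln e\<bar> = -\<infinity>" by simp
    qed
  qed
  also have "\<dots> = -\<infinity>" by (rule Liminf_const) simp
  finally have "mdim_sofic_metric_wrt G d \<sigma> X \<alpha> \<rho> = -\<infinity>" .
  moreover have "mdim_sofic_metric G d \<sigma> X \<alpha> \<le> mdim_sofic_metric_wrt G d \<sigma> X \<alpha> \<rho>"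
    unfolding mdim_sofic_metric_def using X by (intro INF_lower) simp
  ultimately show ?thesis by simp
qed

section \<open>Lower bound for the full shift\<close>

text \<open>The metric is an arbitrary compatible one, so no weights are at hand; compactness
  supplies finitely many small boxes, and together they restrict only finitely many
  coordinates.\<close>

lemma product_metric_finite_support:
  assumes X: "compatible_metric (product_topology (\<lambda>_. Z) I) \<rho>" "compact_space Z" and \<kappa>: "0 < \<kappa>"
  obtains E where "finite E" "E \<subseteq> I"
    "\<And>x y. x \<in> I \<rightarrow>\<^sub>E topspace Z \<Longrightarrow> y \<in> I \<rightarrow>\<^sub>E topspace Z \<Longrightarrow> (\<And>i. i \<in> E \<Longrightarrow> x i = y i) \<Longrightarrow> \<rho> x y < \<kappa>"
proof -
  let ?X = "product_topology (\<lambda>_. Z) I"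
  interpret Metric_space "topspace ?X" \<rho> using compatible_metricD[OF X(1)] by auto
  have kX: "compact_space ?X" using X(2) by (simp add: compact_space_product_topology)
  define V where "V = {(x, U). x \<in> topspace ?X \<and> finite {i \<in> I. U i \<noteq> topspace Z} \<and> (\<forall>i\<in>I. openin Z (U i)) \<and>
      x \<in> PiE I U \<and> (\<forall>y\<in>PiE I U. \<rho> x y < \<kappa> / 2)}"
  have "\<forall>W\<in>(\<lambda>(x, U). PiE I U) ` V. openin ?X W"
    by (auto simp: V_def openin_PiE_gen)
  moreover have "topspace ?X \<subseteq> \<Union>((\<lambda>(x, U). PiE I U) ` V)"
  proof
    fix x assume x: "x \<in> topspace ?X"
    have "openin ?X {y \<in> topspace ?X. \<rho> x y < \<kappa> / 2}" by (rule compatible_metric_openin_ball[OF X(1) x])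
    moreover have "x \<in> {y \<in> topspace ?X. \<rho> x y < \<kappa> / 2}" using x \<kappa> by simp
    ultimately obtain U where U: "finite {i \<in> I. U i \<noteq> topspace Z}" "\<forall>i\<in>I. openin Z (U i)" "x \<in> PiE I U"
        "PiE I U \<subseteq> {y \<in> topspace ?X. \<rho> x y < \<kappa> / 2}"
      unfolding openin_product_topology_alt by meson
    then have "(x, U) \<in> V" using x by (auto simp: V_def)
    then show "x \<in> \<Union>((\<lambda>(x, U). PiE I U) ` V)" using U(3) by blast
  qed
  ultimately obtain \<F> where F: "finite \<F>" "\<F> \<subseteq> (\<lambda>(x, U). PiE I U) ` V" "topspace ?X \<subseteq> \<Union>\<F>"
    using kX unfolding compact_space_alt by meson
  obtain V' where V': "V' \<subseteq> V" "finite V'" "\<F> = (\<lambda>(x, U). PiE I U) ` V'"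
    using finite_subset_image[OF F(1,2)] by blast
  define E where "E = (\<Union>(x, U)\<in>V'. {i \<in> I. U i \<noteq> topspace Z})"
  show ?thesis
  proof (rule that[of E])
    show "finite E" unfolding E_def using V'(1,2) by (intro finite_UN_I) (auto simp: V_def)
    show "E \<subseteq> I" by (auto simp: E_def)
    fix x y assume x: "x \<in> I \<rightarrow>\<^sub>E topspace Z" and y: "y \<in> I \<rightarrow>\<^sub>E topspace Z" and eq: "\<And>i. i \<in> E \<Longrightarrow> x i = y i"
    obtain c U where c: "(c, U) \<in> V'" "x \<in> PiE I U" using F(3) V'(3) x by auto
    have "y i \<in> U i" if "i \<in> I" for i
    proof (cases "U i = topspace Z")
      case True then show ?thesis using y that by auto
    next
      case False
      then have "i \<in> E" using c(1) that by (auto simp: E_def)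
      then show ?thesis using eq c(2) that by (metis PiE_mem)
    qed
    then have "y \<in> PiE I U" using y by (auto simp: PiE_iff)
    then have "\<rho> c x < \<kappa> / 2" "\<rho> c y < \<kappa> / 2" "c \<in> topspace ?X" using c V'(1) unfolding V_def by blast+
    moreover have "\<rho> x y \<le> \<rho> c x + \<rho> c y" using triangle'' x y calculation(3) by simp
    ultimately show "\<rho> x y < \<kappa>" by linarith
  qed
qed

text \<open>If \<open>\<sigma>\<close> were an action, this map would be exactly equivariant:
  \<open>\<sigma> (inv t)\<close> after \<open>\<sigma> s\<close> would be
  \<open>\<sigma> (inv (inv s \<otimes> t))\<close>. The inverse of \<open>t\<close> is dictated by
  the left shift.\<close>

definition orbit_map :: "('g, 'm) monoid_scheme \<Rightarrow> nat \<Rightarrow> ('g \<Rightarrow> nat \<Rightarrow> nat) \<Rightarrow> (nat \<Rightarrow> 'z) \<Rightarrow> nat \<Rightarrow> 'g \<Rightarrow> 'z" where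
  "orbit_map G d \<sigma> z = (\<lambda>a\<in>{1..d}. \<lambda>t\<in>carrier G. z (\<sigma> (inv\<^bsub>G\<^esub> t) a))"

text \<open>Equivariance at \<open>s\<close> and coordinate \<open>t\<close> fails only where
  \<open>\<sigma> (inv t)\<close> after \<open>\<sigma> s\<close> differs from
  \<open>\<sigma> (inv t \<otimes> s)\<close>, a vanishing proportion of \<open>a\<close> by almost
  multiplicativity. Only finitely many \<open>t\<close> matter up to \<open>\<delta> / 2\<close>,
  and the bad set does not depend on \<open>z\<close>, whence the uniformity in
  \<open>z\<close>.\<close>

lemma eventually_orbit_map_in_Map_space:
  fixes Z :: "'z topology" and G :: "('g, 'm) monoid_scheme" (structure)
  assumes G: "group G" and sof: "sofic_approximation G d \<sigma>" and Z: "compact_space Z"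
    and X: "compatible_metric (shift_space G Z) \<rho>"
    and F: "F \<subseteq> carrier G" "finite F" and \<delta>: "0 < \<delta>"
  shows "\<forall>\<^sub>F i in sequentially. 1 \<le> d i \<and> (\<forall>z. (\<forall>a\<in>{1..d i}. z a \<in> topspace Z) \<longrightarrow>
    orbit_map G (d i) (\<sigma> i) z \<in> Map_space (shift_space G Z) (shift_action G) \<rho> F \<delta> (d i) (\<sigma> i))"
proof -
  interpret group G by fact
  let ?X = "shift_space G Z"
  have tX: "topspace ?X = carrier G \<rightarrow>\<^sub>E topspace Z" by (simp add: shift_space_def)
  have kX: "compact_space ?X" using Z by (simp add: shift_space_def compact_space_product_topology)
  interpret Metric_space "topspace ?X" \<rho> using compatible_metricD[OF X] by auto
  obtain B where B: "0 < B" "\<And>x y. x \<in> topspace ?X \<Longrightarrow> y \<in> topspace ?X \<Longrightarrow> \<rho> x y \<le> B"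
    using compact_metric_bounded[OF X kX] by blast
  have \<delta>2: "0 < \<delta> / 2" using \<delta> by simp
  obtain E where E: "finite E" "E \<subseteq> carrier G"
    "\<And>x y. x \<in> topspace ?X \<Longrightarrow> y \<in> topspace ?X \<Longrightarrow> (\<And>i. i \<in> E \<Longrightarrow> x i = y i) \<Longrightarrow> \<rho> x y < \<delta> / 2"
    using product_metric_finite_support[OF X[unfolded shift_space_def] Z \<delta>2] unfolding tX by metis
  \<comment> \<open>The bad points contribute at most \<open>\<delta>\<^sup>2 / 2\<close> and the
    good ones \<open>\<delta>\<^sup>2 / 4\<close> to the mean square; the added 1 excludes division
    by 0.\<close>
  define \<xi> where "\<xi> = \<delta>\<^sup>2 / (2 * B\<^sup>2 * (real (card E) + 1))"
  have \<xi>: "0 < \<xi>" using \<delta> B by (simp add: \<xi>_def add_nonneg_pos)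
  have \<xi>E: "B\<^sup>2 * (real (card E) * \<xi>) \<le> \<delta>\<^sup>2 / 2"
  proof -
    have "B\<^sup>2 * (real (card E) * \<xi>) \<le> B\<^sup>2 * ((real (card E) + 1) * \<xi>)"
      using \<xi> by (intro mult_left_mono mult_right_mono) auto
    also have "\<dots> = \<delta>\<^sup>2 / 2"
    proof -
      have "B\<^sup>2 * (c * (\<delta>\<^sup>2 / (2 * B\<^sup>2 * c))) = \<delta>\<^sup>2 / 2" if "c \<noteq> 0" for c :: real
        using B(1) that by (simp add: field_simps)
      moreover have "real (card E) + 1 \<noteq> 0" by linarith
      ultimately show ?thesis unfolding \<xi>_def by blast
    qed
    finally show ?thesis .
  qed
  have perm: "\<sigma> i s permutes {1..d i}" if "s \<in> carrier G" for i s
    using sof that by (simp add: sofic_approximation_def)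
  have d1: "\<forall>\<^sub>F i in sequentially. 1 \<le> d i"
    using sof by (simp add: sofic_approximation_def filterlim_at_top)
  define bad where "bad = (\<lambda>i s t. {a \<in> {1..d i}. \<sigma> i (inv t) (\<sigma> i s a) \<noteq> \<sigma> i (inv t \<otimes> s) a})"
  have few_bad: "\<forall>\<^sub>F i in sequentially. real (card (bad i s t)) \<le> \<xi> * real (d i)" if "s \<in> F" "t \<in> E" for s t
  proof -
    let ?g = "\<lambda>i. {a \<in> {1..d i}. \<sigma> i (inv t) (\<sigma> i s a) = \<sigma> i (inv t \<otimes> s) a}"
    have "s \<in> carrier G" "inv t \<in> carrier G" using that F E by auto
    then have "(\<lambda>i. real (card (?g i)) / real (d i)) \<longlonglongrightarrow> 1"
      using sof unfolding sofic_approximation_def by blast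
    then have "\<forall>\<^sub>F i in sequentially. 1 - \<xi> < real (card (?g i)) / real (d i)"
      using \<xi> by (intro order_tendstoD) auto
    then show ?thesis using d1
    proof eventually_elim
      case (elim i)
      have "card {1..d i} = card (?g i \<union> bad i s t)"
        by (rule arg_cong[where f = card]) (auto simp: bad_def)
      also have "\<dots> = card (?g i) + card (bad i s t)"
        by (rule card_Un_disjoint) (auto simp: bad_def)
      finally have "card {1..d i} = card (?g i) + card (bad i s t)" .
      then have "real (d i) = real (card (?g i)) + real (card (bad i s t))" by simp
      moreover have "(1 - \<xi>) * real (d i) \<le> real (card (?g i))" using elim by (simp add: field_simps)
      ultimately show ?case by (simp add: algebra_simps)
    qed
  qed
  have "\<forall>\<^sub>F i in sequentially. \<forall>s\<in>F. \<forall>t\<in>E. real (card (bad i s t)) \<le> \<xi> * real (d i)"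
    by (intro eventually_ball_finite ballI F(2) E(1) few_bad)
  then show ?thesis using d1
  proof eventually_elim
    case (elim i)
    show ?case
    proof (intro conjI allI impI)
      show "1 \<le> d i" using elim by simp
      fix z assume z: "\<forall>a\<in>{1..d i}. z a \<in> topspace Z"
      let ?\<phi> = "orbit_map G (d i) (\<sigma> i) z"
      have \<sigma>in: "\<sigma> i s a \<in> {1..d i}" if "s \<in> carrier G" "a \<in> {1..d i}" for s a
        using permutes_in_image[OF perm[OF that(1)], of i a] that by simp
      have \<phi>X: "?\<phi> a \<in> topspace ?X" if "a \<in> {1..d i}" for a
        using that z \<sigma>in by (auto simp: orbit_map_def tX)
      have "rho_2 \<rho> (d i) (?\<phi> \<circ> \<sigma> i s) (shift_action G s \<circ> ?\<phi>) \<le> \<delta>" if s: "s \<in> F" for s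
      proof -
        have sG: "s \<in> carrier G" using s F by blast
        let ?f = "\<lambda>a. \<rho> (?\<phi> (\<sigma> i s a)) (shift_action G s (?\<phi> a))"
        define bs where "bs = (\<Union>t\<in>E. bad i s t)"
        have bs: "bs \<subseteq> {1..d i}" by (auto simp: bs_def bad_def)
        have "card bs \<le> (\<Sum>t\<in>E. card (bad i s t))" unfolding bs_def by (rule card_UN_le[OF E(1)])
        then have "real (card bs) \<le> (\<Sum>t\<in>E. real (card (bad i s t)))"
          using of_nat_mono[where 'a = real] by fastforce
        also have "\<dots> \<le> real (card E) * (\<xi> * real (d i))"
          using elim s by (intro sum_bounded_above) auto
        finally have cb: "real (card bs) \<le> real (card E) * (\<xi> * real (d i))" .
        have in_X: "?\<phi> (\<sigma> i s a) \<in> topspace ?X" "shift_action G s (?\<phi> a) \<in> topspace ?X" if "a \<in> {1..d i}" for a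
          using \<phi>X[OF \<sigma>in[OF sG that]] shift_action_in_space[OF G sG \<phi>X[OF that]] by auto
        have good: "?f a \<le> \<delta> / 2" if a: "a \<in> {1..d i} - bs" for a
        proof -
          have aa: "a \<in> {1..d i}" using a by blast
          have "?\<phi> (\<sigma> i s a) t = shift_action G s (?\<phi> a) t" if t: "t \<in> E" for t
          proof -
            have tG: "t \<in> carrier G" using t E by blast
            have "a \<notin> bad i s t" using a t by (auto simp: bs_def)
            then have "\<sigma> i (inv t) (\<sigma> i s a) = \<sigma> i (inv t \<otimes> s) a" using aa by (simp add: bad_def)
            moreover have "inv (inv s \<otimes> t) = inv t \<otimes> s" using sG tG by (simp add: inv_mult_group)
            moreover have "\<sigma> i s a \<in> {1..d i}" using \<sigma>in sG aa by blast
            ultimately show ?thesis using aa sG tG by (simp add: orbit_map_def shift_action_def)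
          qed
          then have "?f a < \<delta> / 2" using E(3) in_X[OF aa] by blast
          then show ?thesis by simp
        qed
        have "(\<Sum>a\<in>{1..d i}. (?f a)\<^sup>2) = (\<Sum>a\<in>{1..d i} - bs. (?f a)\<^sup>2) + (\<Sum>a\<in>bs. (?f a)\<^sup>2)"
          by (rule sum.subset_diff[OF bs]) simp
        also have "\<dots> \<le> real (card ({1..d i} - bs)) * (\<delta> / 2)\<^sup>2 + real (card bs) * B\<^sup>2"
        proof (intro add_mono sum_bounded_above)
          show "(?f a)\<^sup>2 \<le> (\<delta> / 2)\<^sup>2" if "a \<in> {1..d i} - bs" for a using good[OF that] by (intro power_mono) auto
          show "(?f a)\<^sup>2 \<le> B\<^sup>2" if "a \<in> bs" for a
            using B(2)[OF in_X[OF subsetD[OF bs that]]] by (intro power_mono) auto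
        qed
        also have "\<dots> \<le> real (d i) * (\<delta> / 2)\<^sup>2 + real (card E) * (\<xi> * real (d i)) * B\<^sup>2"
        proof (intro add_mono mult_right_mono cb)
          have "card ({1..d i} - bs) \<le> card {1..d i}" by (intro card_mono) auto
          then show "real (card ({1..d i} - bs)) \<le> real (d i)" by simp
        qed auto
        also have "\<dots> = real (d i) * ((\<delta> / 2)\<^sup>2 + B\<^sup>2 * (real (card E) * \<xi>))" by (simp add: algebra_simps)
        also have "\<dots> \<le> real (d i) * \<delta>\<^sup>2"
        proof (intro mult_left_mono)
          have "(\<delta> / 2)\<^sup>2 = \<delta>\<^sup>2 / 4" by (simp add: power_divide)
          then show "(\<delta> / 2)\<^sup>2 + B\<^sup>2 * (real (card E) * \<xi>) \<le> \<delta>\<^sup>2" using \<xi>E zero_le_power2[of \<delta>] by linarith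
        qed simp
        finally have "(\<Sum>a\<in>{1..d i}. (?f a)\<^sup>2) / real (d i) \<le> \<delta>\<^sup>2" using elim by (simp add: field_simps)
        then show ?thesis using \<delta> by (simp add: rho_2_def real_le_lsqrt)
      qed
      moreover have "?\<phi> \<in> {1..d i} \<rightarrow>\<^sub>E topspace ?X" using \<phi>X by (auto simp: orbit_map_def)
      ultimately show "?\<phi> \<in> Map_space ?X (shift_action G) \<rho> F \<delta> (d i) (\<sigma> i)" by (simp add: Map_space_def)
    qed
  qed
qed

section \<open>Covers of embedded cubes\<close>

text \<open>A piece is cut out of the cube by prescribing, for each coordinate, whether it stays
  below 1 or above 0; thus no piece meets two opposite faces. Extended to open sets of
  \<open>Z\<close> and completed by the complement of the embedded cube, which is closed by
  compactness, the pieces cover \<open>Z\<close>.\<close>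

lemma cover_separating_faces:
  fixes Z :: "'z topology"
  assumes Z: "compact_space Z" "Hausdorff_space Z" and copy: "contains_copy Z (unit_cube n)"
  obtains \<U> h where "finite_open_cover Z \<U>" "continuous_map (unit_cube n) Z h"
    "\<And>U p q c. U \<in> \<U> \<Longrightarrow> p \<in> topspace (unit_cube n) \<Longrightarrow> q \<in> topspace (unit_cube n) \<Longrightarrow>
       h p \<in> U \<Longrightarrow> h q \<in> U \<Longrightarrow> c \<in> {1..n} \<Longrightarrow> p c = 0 \<Longrightarrow> q c \<noteq> 1"
proof -
  let ?C = "unit_cube n"
  obtain S where S: "S \<subseteq> topspace Z" "subtopology Z S homeomorphic_space ?C"
    using copy by (auto simp: contains_copy_def)
  then have "?C homeomorphic_space subtopology Z S" using homeomorphic_space_sym by blast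
  then obtain h where h: "homeomorphic_map ?C (subtopology Z S) h"
    unfolding homeomorphic_space by blast
  have tS: "topspace (subtopology Z S) = S" using S(1) by auto
  have hS: "h ` topspace ?C = S" using homeomorphic_imp_surjective_map[OF h] tS by simp
  have inj: "inj_on h (topspace ?C)" using homeomorphic_imp_injective_map[OF h] .
  have conth: "continuous_map ?C (subtopology Z S) h" using homeomorphic_imp_continuous_map[OF h] .
  have "compact_space ?C" by (simp add: unit_cube_def compact_space_product_topology compact_space_subtopology)
  then have "compactin (subtopology Z S) (h ` topspace ?C)"
    using image_compactin conth by (metis compact_space_def)
  then have "compactin Z S" using hS by (simp add: compactin_subtopology)
  then have closedS: "closedin Z S" using Z(2) compactin_imp_closedin by blast
  define O' where "O' = (\<lambda>B. PiE {1..n} (\<lambda>c. {0..1::real} \<inter> (if c \<in> B then {..<1} else {0<..})))"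
  have opO: "openin ?C (O' B)" for B
  proof -
    have "openin (top_of_set {0..1::real}) ({0..1} \<inter> (if c \<in> B then {..<1} else {0<..}))" for c
      by (intro openin_open_Int) auto
    then show ?thesis by (simp add: O'_def unit_cube_def openin_PiE_gen)
  qed
  have "\<exists>T. openin Z T \<and> h ` O' B = T \<inter> S" for B
  proof -
    have "open_map ?C (subtopology Z S) h" using homeomorphic_imp_open_map[OF h] .
    then have "openin (subtopology Z S) (h ` O' B)" using opO by (simp add: open_map_def)
    then show ?thesis unfolding openin_subtopology by blast
  qed
  then obtain T where T: "\<And>B. openin Z (T B)" "\<And>B. h ` O' B = T B \<inter> S" by metis
  have in_O: "p \<in> O' B" if p: "p \<in> topspace ?C" "h p \<in> T B" for p B
  proof -
    have "h p \<in> S" using hS p by blast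
    then have "h p \<in> h ` O' B" using T(2) p by blast
    then obtain p' where p': "p' \<in> O' B" "h p = h p'" by blast
    moreover have "p' \<in> topspace ?C" using p' openin_subset[OF opO] by blast
    ultimately show ?thesis using inj p by (metis inj_onD)
  qed
  let ?U = "insert (topspace Z - S) (T ` Pow {1..n})"
  show ?thesis
  proof (rule that[of ?U h])
    show "continuous_map ?C Z h" using conth continuous_map_in_subtopology by blast
    have "topspace Z \<subseteq> \<Union>?U"
    proof
      fix x assume x: "x \<in> topspace Z"
      show "x \<in> \<Union>?U"
      proof (cases "x \<in> S")
        case True
        then obtain p where p: "p \<in> topspace ?C" "x = h p" using hS by blast
        define B where "B = {c \<in> {1..n}. p c < 1}"
        have p': "p \<in> {1..n} \<rightarrow>\<^sub>E {0..1}" using p(1) by (simp add: unit_cube_def)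
        have "p c \<in> {0..1} \<inter> (if c \<in> B then {..<1} else {0<..})" if c: "c \<in> {1..n}" for c
          using PiE_mem[OF p' c] c by (auto simp: B_def)
        then have "p \<in> O' B" using p' unfolding O'_def PiE_iff by blast
        then have "x \<in> T B" using T(2) p by blast
        moreover have "B \<in> Pow {1..n}" by (auto simp: B_def)
        ultimately show ?thesis by blast
      qed (use x in auto)
    qed
    moreover have op: "openin Z U" if "U \<in> ?U" for U
      using that T(1) closedS by (auto simp: closedin_def)
    moreover have "\<Union>?U \<subseteq> topspace Z" by (rule Union_least) (rule openin_subset[OF op])
    ultimately have "\<Union>?U = topspace Z" by (intro subset_antisym)
    moreover have "finite ?U" by simp
    ultimately show "finite_open_cover Z ?U" unfolding finite_open_cover_def using op by blast
    fix U p q c assume U: "U \<in> ?U" and p: "p \<in> topspace ?C" "h p \<in> U" and q: "q \<in> topspace ?C" "h q \<in> U"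
      and c: "c \<in> {1..n}" "p c = 0"
    have "h p \<in> S" using hS p by blast
    then obtain B where B: "U = T B" using U p by blast
    have "p c \<in> (if c \<in> B then {..<1} else {0<..})" "q c \<in> (if c \<in> B then {..<1} else {0<..})"
      using PiE_mem[OF in_O[of p B, unfolded O'_def] c(1)] PiE_mem[OF in_O[of q B, unfolded O'_def] c(1)] p q B by auto
    then show "q c \<noteq> 1" using c by (auto split: if_splits)
  qed
qed

lemma cover_ord_ge:
  assumes "y \<in> topspace Y" "N < card {V \<in> \<V>. y \<in> V}"
  shows "ereal (real N) \<le> cover_ord Y \<V>"
proof -
  have "ereal (real (Suc N)) \<le> ereal (real (card {V \<in> \<V>. y \<in> V}))" using assms by simp
  also have "\<dots> \<le> (SUP y\<in>topspace Y. ereal (real (card {U \<in> \<V>. y \<in> U})))" using assms by (intro SUP_upper)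
  finally have "ereal (real (Suc N)) - 1 \<le> cover_ord Y \<V>"
    unfolding cover_ord_def by (intro ereal_minus_mono) auto
  then show ?thesis by (simp add: one_ereal_def)
qed

text \<open>A refinement of the product cover, pulled back along the map \<open>\<Psi>\<close> from
  the cube of dimension \<open>n * d i\<close>, consists of sets that meet no two opposite faces;
  hence \<open>cube_cover_order\<close> gives a point in more than \<open>n * d i\<close> of them.
  The bound holds for every \<open>F\<close> and \<open>\<delta>\<close> with one and the same
  cover.\<close>

lemma mdim_sofic_shift_ge:
  fixes Z :: "'z topology" and G :: "('g, 'm) monoid_scheme" (structure)
  assumes G: "group G" and sof: "sofic_approximation G d \<sigma>" and Z: "compact_space Z" "metrizable_space Z"
    and X: "compatible_metric (shift_space G Z) \<rho>" and copy: "contains_copy Z (unit_cube n)"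
  shows "ereal (real n) \<le> mdim_sofic G d \<sigma> (shift_space G Z) (shift_action G) \<rho>"
proof (rule cover_separating_faces[OF Z(1) metrizable_imp_Hausdorff_space[OF Z(2)] copy])
  interpret group G by fact
  let ?X = "shift_space G Z" and ?C = "unit_cube n"
  have tX: "topspace ?X = carrier G \<rightarrow>\<^sub>E topspace Z" by (simp add: shift_space_def)
  fix \<U>0 h assume U0: "finite_open_cover Z \<U>0" and conth: "continuous_map ?C Z h"
    and faces: "\<And>U p q c. U \<in> \<U>0 \<Longrightarrow> p \<in> topspace ?C \<Longrightarrow> q \<in> topspace ?C \<Longrightarrow>
       h p \<in> U \<Longrightarrow> h q \<in> U \<Longrightarrow> c \<in> {1..n} \<Longrightarrow> p c = 0 \<Longrightarrow> q c \<noteq> (1::real)"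
  define \<U> where "\<U> = (\<lambda>U. {x \<in> topspace ?X. x \<one> \<in> U}) ` \<U>0"
  have U: "finite_open_cover ?X \<U>"
  proof -
    have "continuous_map ?X Z (\<lambda>x. x \<one>)"
      unfolding shift_space_def by (rule continuous_map_product_projection) simp
    then have "openin ?X {x \<in> topspace ?X. x \<one> \<in> U}" if "U \<in> \<U>0" for U
      using U0 that by (intro openin_continuous_map_preimage) (auto simp: finite_open_cover_def)
    moreover have "x \<one> \<in> \<Union>\<U>0" if "x \<in> topspace ?X" for x
      using U0 that unfolding tX finite_open_cover_def by auto
    ultimately show ?thesis using U0 by (auto simp: finite_open_cover_def \<U>_def)
  qed
  have perm: "\<sigma> i s permutes {1..d i}" if "s \<in> carrier G" for i s
    using sof that by (simp add: sofic_approximation_def)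
  have "ereal (real n) \<le> D_sofic_local d \<sigma> ?X (shift_action G) \<U> \<rho> F \<delta>"
    if F: "F \<in> nonempty_finite_subsets (carrier G)" and \<delta>: "0 < \<delta>" for F \<delta>
  proof -
    let ?Y = "\<lambda>i. Map_space ?X (shift_action G) \<rho> F \<delta> (d i) (\<sigma> i)"
      and ?D = "\<lambda>i. D_map ?X (shift_action G) \<U> \<rho> F \<delta> (d i) (\<sigma> i)"
    have ev: "\<forall>\<^sub>F i in sequentially. 1 \<le> d i \<and> (\<forall>z. (\<forall>a\<in>{1..d i}. z a \<in> topspace Z) \<longrightarrow> orbit_map G (d i) (\<sigma> i) z \<in> ?Y i)"
      using F by (intro eventually_orbit_map_in_Map_space[OF G sof Z(1) X _ _ \<delta>])
        (auto simp: nonempty_finite_subsets_def)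
    \<comment> \<open>A constant labelling shows the map spaces nonempty, which excludes the default
      value \<open>-\<infinity>\<close>.\<close>
    define z0 where "z0 = h (restrict (\<lambda>c. 0) {1..n})"
    have z0: "z0 \<in> topspace Z"
      unfolding z0_def by (rule continuous_map_image_subset_topspace[OF conth, THEN subsetD, OF imageI])
        (auto simp: unit_cube_def)
    have nonempty: "\<forall>\<^sub>F i in sequentially. ?Y i \<noteq> {}"
    proof (rule eventually_mono[OF ev], elim conjE)
      fix i assume "\<forall>z. (\<forall>a\<in>{1..d i}. z a \<in> topspace Z) \<longrightarrow> orbit_map G (d i) (\<sigma> i) z \<in> ?Y i"
      then have "orbit_map G (d i) (\<sigma> i) (\<lambda>_. z0) \<in> ?Y i" using z0 by simp
      then show "?Y i \<noteq> {}" by blast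
    qed
    have "\<not> (\<forall>\<^sub>F i in sequentially. ?Y i = {})"
    proof
      assume "\<forall>\<^sub>F i in sequentially. ?Y i = {}"
      with nonempty have "\<forall>\<^sub>F i in sequentially. False" by eventually_elim simp
      then show False by simp
    qed
    then have "D_sofic_local d \<sigma> ?X (shift_action G) \<U> \<rho> F \<delta> =
        limsup (\<lambda>i. ?D i / ereal (real (d i)))"
      by (simp add: D_sofic_local_def)
    moreover have "limsup (\<lambda>i. ereal (real n)) \<le> limsup (\<lambda>i. ?D i / ereal (real (d i)))"
    proof (rule Limsup_mono, rule eventually_mono[OF ev], elim conjE)
      fix i assume di: "1 \<le> d i" and orb: "\<forall>z. (\<forall>a\<in>{1..d i}. z a \<in> topspace Z) \<longrightarrow> orbit_map G (d i) (\<sigma> i) z \<in> ?Y i"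
      define N where "N = n * d i"
      let ?Q = "product_topology (\<lambda>_. top_of_set {0..1::real}) {..<N}"
      let ?T = "subtopology (product_topology (\<lambda>_. ?X) {1..d i}) (?Y i)"
      \<comment> \<open>Cube coordinate \<open>(a - 1) * n + (c - 1)\<close> is the
        \<open>c\<close>-th coordinate of the \<open>a\<close>-th copy of the \<open>n\<close>-cube;
        both indices start at 1.\<close>
      define blk where "blk = (\<lambda>(y :: nat \<Rightarrow> real) a. restrict (\<lambda>c. y ((a - 1) * n + (c - 1))) {1..n})"
      define \<Psi> where "\<Psi> = (\<lambda>y. orbit_map G (d i) (\<sigma> i) (\<lambda>a. h (blk y a)))"
      have idx: "(a - 1) * n + (c - 1) < N" if "a \<in> {1..d i}" "c \<in> {1..n}" for a c
      proof -
        have "(a - 1) * n + (c - 1) < (a - 1) * n + n" using that by auto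
        also have "\<dots> = a * n" using that by (cases a) auto
        also have "\<dots> \<le> d i * n" using that by (intro mult_right_mono) auto
        finally show ?thesis by (simp add: N_def mult.commute)
      qed
      have blk_cont: "continuous_map ?Q ?C (\<lambda>y. blk y a)" if a: "a \<in> {1..d i}" for a
        unfolding unit_cube_def
      proof (subst continuous_map_componentwise, intro conjI ballI)
        show "(\<lambda>y. blk y a) ` topspace ?Q \<subseteq> extensional {1..n}" by (auto simp: blk_def)
        fix c assume c: "c \<in> {1..n}"
        have "continuous_map ?Q (top_of_set {0..1}) (\<lambda>y. y ((a - 1) * n + (c - 1)))"
          using idx[OF a c] by (intro continuous_map_product_projection) simp
        then show "continuous_map ?Q (top_of_set {0..1}) (\<lambda>y. blk y a c)" using c by (simp add: blk_def)
      qed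
      have blk_in: "blk y a \<in> topspace ?C" if "y \<in> topspace ?Q" "a \<in> {1..d i}" for y a
        using continuous_map_image_subset_topspace[OF blk_cont[OF that(2)]] that(1) by blast
      have h_in: "h (blk y a) \<in> topspace Z" if "y \<in> topspace ?Q" "a \<in> {1..d i}" for y a
        using continuous_map_image_subset_topspace[OF conth] blk_in[OF that] by blast
      have \<Psi>Y: "\<Psi> y \<in> ?Y i" if "y \<in> topspace ?Q" for y
        unfolding \<Psi>_def by (rule orb[rule_format]) (rule h_in[OF that])
      have hb: "continuous_map ?Q Z (\<lambda>y. h (blk y a))" if "a \<in> {1..d i}" for a
        using continuous_map_compose[OF blk_cont[OF that] conth] by (simp add: comp_def)
      have \<sigma>in: "\<sigma> i s a \<in> {1..d i}" if "s \<in> carrier G" "a \<in> {1..d i}" for s a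
        using permutes_in_image[OF perm[OF that(1)], of i a] that by simp
      have \<Psi>: "continuous_map ?Q ?T \<Psi>"
      proof (subst continuous_map_in_subtopology, intro conjI)
        show "\<Psi> \<in> topspace ?Q \<rightarrow> ?Y i" using \<Psi>Y by blast
        show "continuous_map ?Q (product_topology (\<lambda>_. ?X) {1..d i}) \<Psi>"
        proof (subst continuous_map_componentwise, intro conjI ballI)
          show "\<Psi> ` topspace ?Q \<subseteq> extensional {1..d i}" by (auto simp: \<Psi>_def orbit_map_def)
          fix a assume a: "a \<in> {1..d i}"
          show "continuous_map ?Q ?X (\<lambda>y. \<Psi> y a)"
            unfolding shift_space_def
          proof (subst continuous_map_componentwise, intro conjI ballI)
            show "(\<lambda>y. \<Psi> y a) ` topspace ?Q \<subseteq> extensional (carrier G)"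
              using a by (auto simp: \<Psi>_def orbit_map_def)
            fix t assume t: "t \<in> carrier G"
            then have "continuous_map ?Q Z (\<lambda>y. h (blk y (\<sigma> i (inv t) a)))" using hb \<sigma>in a by simp
            then show "continuous_map ?Q Z (\<lambda>y. \<Psi> y a t)" using a t by (simp add: \<Psi>_def orbit_map_def)
          qed
        qed
      qed
      have YX: "topspace ?T = ?Y i"
        by (auto simp: Map_space_def)
      have "ereal (real N) \<le> ?D i"
        unfolding D_map_def cover_D_def
      proof (rule INF_greatest, elim CollectE conjE)
        fix \<V> assume V: "finite_open_cover ?T \<V>" and ref: "cover_refines \<V> (restrict_cover (power_cover \<U> (d i)) (?Y i))"
        obtain y where y: "y \<in> topspace ?Q" "N < card {V \<in> \<V>. y \<in> {y \<in> topspace ?Q. \<Psi> y \<in> V}}"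
        proof (rule cube_cover_order[of \<V> N "\<lambda>V. {y \<in> topspace ?Q. \<Psi> y \<in> V}"])
          show "finite \<V>" using V by (simp add: finite_open_cover_def)
          show "openin ?Q {y \<in> topspace ?Q. \<Psi> y \<in> V}" if "V \<in> \<V>" for V
            using V that by (intro openin_continuous_map_preimage[OF \<Psi>]) (auto simp: finite_open_cover_def)
          show "topspace ?Q \<subseteq> (\<Union>V\<in>\<V>. {y \<in> topspace ?Q. \<Psi> y \<in> V})"
          proof
            fix y assume y: "y \<in> topspace ?Q"
            have "\<Psi> y \<in> \<Union>\<V>" using V \<Psi>Y[OF y] YX by (simp add: finite_open_cover_def)
            then show "y \<in> (\<Union>V\<in>\<V>. {y \<in> topspace ?Q. \<Psi> y \<in> V})" using y by blast
          qed
          fix V k x y assume VV: "V \<in> \<V>" and k: "k < N" and xV: "x \<in> {y \<in> topspace ?Q. \<Psi> y \<in> V}"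
            and yV: "y \<in> {y \<in> topspace ?Q. \<Psi> y \<in> V}" and xk: "x k = 0"
          have n0: "0 < n" using k by (cases n) (auto simp: N_def)
          define a where "a = k div n + 1"
          define c where "c = k mod n + 1"
          have a: "a \<in> {1..d i}"
            using k n0 by (simp add: a_def N_def Suc_le_eq less_mult_imp_div_less mult.commute)
          have c: "c \<in> {1..n}" using n0 by (simp add: c_def Suc_le_eq)
          have kk: "(a - 1) * n + (c - 1) = k" by (simp add: a_def c_def)
          \<comment> \<open>\<open>\<sigma> i\<close> need not send the group identity to the
            identity permutation, so block \<open>a\<close> is read off at the preimage
            \<open>b\<close> of \<open>a\<close>.\<close>
          obtain b where b: "b \<in> {1..d i}" "\<sigma> i (inv \<one>) b = a"
            using permutes_image[OF perm[of "inv \<one>" i]] a by (metis imageE inv_closed one_closed)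
          obtain R where R: "R \<in> restrict_cover (power_cover \<U> (d i)) (?Y i)" "V \<subseteq> R"
            using ref VV unfolding cover_refines_def by blast
          obtain R' where R': "R' \<in> power_cover \<U> (d i)" "R = R' \<inter> ?Y i"
            using R(1) unfolding restrict_cover_def by (rule imageE)
          obtain W where W: "W \<in> {1..d i} \<rightarrow> \<U>" "R' = PiE {1..d i} W"
            using R'(1) unfolding power_cover_def by (elim CollectE exE conjE)
          have VW: "V \<subseteq> PiE {1..d i} W" using R(2) R'(2) W(2) by simp
          obtain U where U: "U \<in> \<U>0" "W b = {x \<in> topspace ?X. x \<one> \<in> U}"
            using funcset_mem[OF W(1) b(1)] unfolding \<U>_def by blast
          have val: "\<Psi> v b \<one> = h (blk v a)" for v using b by (simp add: \<Psi>_def orbit_map_def)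
          have "h (blk v a) \<in> U" if "v \<in> {y \<in> topspace ?Q. \<Psi> y \<in> V}" for v
          proof -
            have "\<Psi> v \<in> PiE {1..d i} W" using that VW by blast
            then have "\<Psi> v b \<in> W b" using b(1) by (rule PiE_mem)
            then show ?thesis using U(2) val by simp
          qed
          then have hU: "h (blk x a) \<in> U" "h (blk y a) \<in> U" using xV yV by blast+
          have "blk x a c = 0" "blk y a c = y k" using c kk xk by (simp_all add: blk_def)
          then show "y k \<noteq> 1" using faces[OF U(1) blk_in[OF _ a] blk_in[OF _ a] hU c] xV yV by simp
        qed blast
        have "{V \<in> \<V>. y \<in> {y \<in> topspace ?Q. \<Psi> y \<in> V}} = {V \<in> \<V>. \<Psi> y \<in> V}" using y(1) by auto
        then show "ereal (real N) \<le> cover_ord ?T \<V>"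
          using y \<Psi>Y[OF y(1)] YX by (intro cover_ord_ge[of "\<Psi> y"]) auto
      qed
      then have "ereal (real N) / ereal (real (d i)) \<le> ?D i / ereal (real (d i))"
        using di by (intro ereal_divide_right_mono) auto
      then show "ereal (real n) \<le> ?D i / ereal (real (d i))"
        using di by (simp add: N_def)
    qed
    ultimately show ?thesis by (simp add: Limsup_const)
  qed
  then have "ereal (real n) \<le> D_sofic G d \<sigma> ?X (shift_action G) \<rho> \<U>"
    unfolding D_sofic_def by (intro INF_greatest) auto
  then show ?thesis unfolding mdim_sofic_def using U by (intro SUP_upper2[of \<U>]) auto
qed

section \<open>Comparison with covering dimension\<close>

text \<open>On a nonempty space the infimum is a minimum over natural numbers. The case
  \<open>m = 0\<close> rests on every point lying in some element, larger \<open>m\<close> on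
  minimality. The attained value translates between covering dimension,
  \<open>refinable_to_order\<close> and the dimensions of embedded cubes.\<close>

lemma cover_D_nat:
  assumes Y: "topspace Y \<noteq> {}" and U: "finite_open_cover Y \<U>"
  obtains m \<V> where "cover_D Y \<U> = ereal (real m)" "finite_open_cover Y \<V>" "cover_refines \<V> \<U>"
    "\<And>y. y \<in> topspace Y \<Longrightarrow> card {V \<in> \<V>. y \<in> V} \<le> Suc m"
proof -
  define R where "R = (\<lambda>m \<V>. finite_open_cover Y \<V> \<and> cover_refines \<V> \<U> \<and> (\<forall>y\<in>topspace Y. card {V \<in> \<V>. y \<in> V} \<le> Suc m))"
  have "card {V \<in> \<U>. y \<in> V} \<le> Suc (card \<U>)" for y
    using U card_mono[of \<U> "{V \<in> \<U>. y \<in> V}"] by (auto simp: finite_open_cover_def)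
  then have ex: "\<exists>m. Ex (R m)" using U by (auto simp: R_def cover_refines_def)
  define m where "m = (LEAST m. Ex (R m))"
  have "Ex (R m)" unfolding m_def by (rule LeastI_ex[OF ex])
  then obtain \<V> where V: "R m \<V>" by blast
  have "cover_D Y \<U> \<le> ereal (real m)" using V unfolding R_def by (intro cover_D_le[of Y \<V>]) auto
  moreover have "ereal (real m) \<le> cover_D Y \<U>"
    unfolding cover_D_def
  proof (rule INF_greatest, elim CollectE conjE)
    fix \<W> assume W: "finite_open_cover Y \<W>" "cover_refines \<W> \<U>"
    have "\<exists>y\<in>topspace Y. m < card {V \<in> \<W>. y \<in> V}"
    proof (cases m)
      case 0
      obtain y where y: "y \<in> topspace Y" using Y by blast
      then have "{V \<in> \<W>. y \<in> V} \<noteq> {}" "finite {V \<in> \<W>. y \<in> V}" using W(1) by (auto simp: finite_open_cover_def)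
      then show ?thesis using y 0 by (auto simp: card_gt_0_iff)
    next
      case (Suc k)
      then have "\<not> Ex (R k)" using not_less_Least[of k "\<lambda>m. Ex (R m)"] by (simp add: m_def)
      then obtain y where "y \<in> topspace Y" "\<not> card {V \<in> \<W>. y \<in> V} \<le> Suc k" using W unfolding R_def by blast
      then show ?thesis unfolding Suc by (intro bexI[of _ y]) auto
    qed
    then obtain y where "y \<in> topspace Y" "m < card {V \<in> \<W>. y \<in> V}" by blast
    then show "ereal (real m) \<le> cover_ord Y \<W>" by (rule cover_ord_ge)
  qed
  ultimately have "cover_D Y \<U> = ereal (real m)" by (rule antisym)
  then show ?thesis using that[of m \<V>] V unfolding R_def by blast
qed

theorem theorem7p1:
  fixes G :: "('g, 'm) monoid_scheme"
    and d :: "nat \<Rightarrow> nat"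
    and \<sigma> :: "nat \<Rightarrow> 'g \<Rightarrow> nat \<Rightarrow> nat"
    and Z :: "'z topology"
    and \<rho> :: "('g \<Rightarrow> 'z) \<Rightarrow> ('g \<Rightarrow> 'z) \<Rightarrow> real"
  assumes "group G"
    and "countable (carrier G)"
    and "sofic_approximation G d \<sigma>"
    and "compact_space Z"
    and "metrizable_space Z"
    and "compatible_metric (shift_space G Z) \<rho>"
  shows "(mdim_sofic G d \<sigma> (shift_space G Z) (shift_action G) \<rho>
            \<le> mdim_sofic_metric G d \<sigma> (shift_space G Z) (shift_action G) \<and>
          mdim_sofic_metric G d \<sigma> (shift_space G Z) (shift_action G) \<le> covering_dim Z) \<and>
         ((\<forall>n::nat. ereal (real n) \<le> covering_dim Z \<longrightarrow> contains_copy Z (unit_cube n)) \<longrightarrow>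
          mdim_sofic G d \<sigma> (shift_space G Z) (shift_action G) \<rho>
            = mdim_sofic_metric G d \<sigma> (shift_space G Z) (shift_action G) \<and>
          mdim_sofic_metric G d \<sigma> (shift_space G Z) (shift_action G) = covering_dim Z)"
proof -
  let ?X = "shift_space G Z"
  let ?mdim = "mdim_sofic G d \<sigma> ?X (shift_action G) \<rho>" and ?mdimM = "mdim_sofic_metric G d \<sigma> ?X (shift_action G)"
  note G = assms(1,2) and sof = assms(3) and Z = assms(4,5) and X = assms(6)
  have perm: "\<And>i s. s \<in> carrier G \<Longrightarrow> \<sigma> i s permutes {1..d i}" and d: "filterlim d at_top sequentially"
    using sof by (auto simp: sofic_approximation_def)
  have kX: "compact_space ?X" using Z(1) by (simp add: shift_space_def compact_space_product_topology)
  have le1: "?mdim \<le> ?mdimM"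
    by (rule mdim_sofic_le_mdim_sofic_metric[OF X kX perm d shift_action_in_space[OF G(1)]])
  have le2: "?mdimM \<le> covering_dim Z"
  proof (cases "topspace Z = {}")
    case True
    have "\<one>\<^bsub>G\<^esub> \<in> carrier G" using G(1) by (simp add: group.is_monoid)
    then have "topspace ?X = {}" using True by (auto simp: shift_space_def PiE_eq_empty_iff)
    then show ?thesis using mdim_sofic_metric_empty[OF X _ G(1) d] by simp
  next
    case ne: False
    have cov: "cover_D Z \<U> \<le> covering_dim Z" if "finite_open_cover Z \<U>" for \<U>
      unfolding covering_dim_def using that by (intro SUP_upper) simp
    show ?thesis
    proof (cases "covering_dim Z")
      \<comment> \<open>The floor of a real supremum serves as the natural bound on the order; the
        value \<open>\<infinity>\<close> is trivial and \<open>-\<infinity>\<close> is impossible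
        for nonempty \<open>Z\<close>.\<close>
      case (real c)
      have "\<exists>\<V>. finite_open_cover Z \<V> \<and> cover_refines \<V> \<U> \<and>
          (\<forall>y\<in>topspace Z. card {V \<in> \<V>. y \<in> V} \<le> Suc (nat \<lfloor>c\<rfloor>))" if U: "finite_open_cover Z \<U>" for \<U>
      proof (rule cover_D_nat[OF ne U])
        fix m \<V> assume m: "cover_D Z \<U> = ereal (real m)" and V: "finite_open_cover Z \<V>" "cover_refines \<V> \<U>"
          "\<And>y. y \<in> topspace Z \<Longrightarrow> card {V \<in> \<V>. y \<in> V} \<le> Suc m"
        have "real m \<le> c" using cov[OF U] m real by simp
        then have "m \<le> nat \<lfloor>c\<rfloor>" by (rule le_nat_floor)
        then have "\<forall>y\<in>topspace Z. card {V \<in> \<V>. y \<in> V} \<le> Suc (nat \<lfloor>c\<rfloor>)" using V(3) by fastforce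
        then show ?thesis using V(1,2) by blast
      qed
      then have "refinable_to_order Z (nat \<lfloor>c\<rfloor>)" by (simp add: refinable_to_order_def)
      then have "?mdimM \<le> ereal (real (nat \<lfloor>c\<rfloor>))"
        by (rule mdim_sofic_metric_shift_le[OF G Z(2,1) ne _ perm d])
      moreover have "0 \<le> c"
      proof -
        have "finite_open_cover Z {topspace Z}" by (simp add: finite_open_cover_def)
        then obtain m where "cover_D Z {topspace Z} = ereal (real m)" using cover_D_nat[OF ne] by metis
        then have "real m \<le> c" using cov[of "{topspace Z}"] real by (simp add: finite_open_cover_def)
        then show ?thesis by linarith
      qed
      then have "real (nat \<lfloor>c\<rfloor>) \<le> c" by (rule of_nat_floor)
      ultimately show ?thesis unfolding real by (meson ereal_less_eq(3) order_trans)
    next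
      case MInf
      have U: "finite_open_cover Z {topspace Z}" by (simp add: finite_open_cover_def)
      then obtain m where "cover_D Z {topspace Z} = ereal (real m)" using cover_D_nat[OF ne] by metis
      then show ?thesis using cov[OF U] MInf by simp
    qed simp
  qed
  \<comment> \<open>For nonempty \<open>Z\<close> each \<open>cover_D\<close> is a natural number
    not above the dimension, so cubes of these dimensions suffice and infinite dimension is covered
    by the same argument.\<close>
  have ge: "covering_dim Z \<le> ?mdim" if copies: "\<forall>n::nat. ereal (real n) \<le> covering_dim Z \<longrightarrow> contains_copy Z (unit_cube n)"
    unfolding covering_dim_def
  proof (rule SUP_least)
    fix \<U> assume "\<U> \<in> {\<U>. finite_open_cover Z \<U>}"
    then have U: "finite_open_cover Z \<U>" by simp
    show "cover_D Z \<U> \<le> ?mdim"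
    proof (cases "topspace Z = {}")
      case True
      then show ?thesis by (simp add: cover_D_empty)
    next
      case False
      then obtain m where m: "cover_D Z \<U> = ereal (real m)" using cover_D_nat[OF _ U] by metis
      moreover have "cover_D Z \<U> \<le> covering_dim Z"
        unfolding covering_dim_def using U by (intro SUP_upper) simp
      ultimately have "contains_copy Z (unit_cube m)" using copies by simp
      then show ?thesis unfolding m by (rule mdim_sofic_shift_ge[OF G(1) sof Z X])
    qed
  qed
  show ?thesis using le1 le2 ge by (meson antisym order_trans)
qed

end
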